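(* Let $\mathscr V$ be a monoidal derivator, and let $p\colon K\to A$, $v\colon K\to M$, $u\colon A\to B$, $q\colon M\to B$ be functors between small categories together with a natural transformation $\alpha\colon u p\to q v$. If the square $(p,v,u,q,\alpha)$ is $\mathscr V$-exact, then it is $\mathscr D$-exact for all cocontinuous $\mathscr V$-modules $\mathscr D$ (in particular, for all $\mathscr V$-enriched derivators $\mathscr D$).
   Context: Derivators. $\mathrm{Cat}$ is the 2-category of small categories, $\mathrm{CAT}$ that of not necessarily small categories, $\mathbb 1$ the terminal category. A prederivator is a strict 2-functor $\mathscr D\colon\mathrm{Cat}^{\mathrm{op}}\to\mathrm{CAT}$ (1-cells reversed); write $u^*=\mathscr D(u)$ and $\alpha^*$ for the natural transformation induced by a natural transformation $\alpha$. It is a derivator if: (Der1) $\mathscr D(\coprod_i A_i)\to\prod_i\mathscr D(A_i)$ is an equivalence; (Der2) a morphism $f$ of $\mathscr D(A)$ is invertible iff $f_a:=a^*f$ is invertible for all objects $a\colon\mathbb 1\to A$; (Der3) every $u^*$ has a left adjoint $u_!$ and a right adjoint $u_*$; (Der4) for $u\colon A\to B$ and $b\in B$ the canonical maps $\operatorname{colim}_{(u/b)}p^*X\to (u_!X)_b$ and $(u_*X)_b\to\lim_{(b/u)}q^*X$ are isomorphisms, where here $p\colon(u/b)\to A$, $q\colon (b/u)\to A$ are the projections and $\operatorname{colim}_A=\pi_!$, $\lim_A=\pi_*$ for $\pi\colon A\to\mathbb 1$. Morphisms of derivators are pseudo-natural transformations; natural transformations between them are modifications. Exact squares. The square is $\mathscr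 D$-exact if the canonical mate $\alpha_!\colon v_!p^*\xrightarrow{\eta}v_!p^*u^*u_!\xrightarrow{\alpha^*}v_!v^*q^*u_!\xrightarrow{\varepsilon}q^*u_!$ is an isomorphism in $\mathscr D$ (equivalently, the conjugate mate $\alpha_*\colon u^*q_*\to p_*v^*$ is an isomorphism). Monoidal derivators and modules. A morphism $\otimes\colon\mathscr D_1\times\mathscr D_2\to\mathscr D_3$ of derivators gives external products $\otimes\colon\mathscr D_1(A)\times\mathscr D_2(B)\to\mathscr D_3(A\times B)$; it preserves colimits in both variables independently (is cocontinuous in each variable) if for every functor $u\colon A\to A'$ the canonical maps $(u\times\mathrm{id})_!(X\otimes Y)\to u_!X\otimes Y$ are isomorphisms, and similarly in the second variable. A monoidal derivator $\mathscr V$ is a derivator with a coherently associative and unital multiplication $\otimes\colon\mathscr V\times\mathscr V\to\mathscr V$ (a pseudo-monoid in the 2-category of derivators) that preserves colimits in both variables independently. A cocontinuous $\mathscr V$-module is a derivator $\mathscr D$ endowed with a (coherently) associative and unital action $\otimes\colon\mathscr V\times\mathscr D\to\mathscr D$ which preserves colimits in both variables independently. A $\mathscr V$-enriched derivator is a $\mathscr V$-module whose action is part of an adjunction of two variables (so that it is in particular a cocontinuous $\mathscr V$-module). *)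

theory Defs
  imports "HOL-Library.FuncSet"
begin

section \<open>Categories, functors, natural transformations\<close>

text \<open>
  Objects and arrows are carved out of arbitrary types, so the same record serves for small
  and for large categories.  All operations are extensional (\<^const>\<open>undefined\<close> outside of their
  domain); hence equality of categories, of functors and of natural transformations is equality
  of records, and strict 2-functoriality can be stated by equations.  The \<open>mk_\<close> functions below
  build a structure from raw operations by cutting these down to their domain.
\<close>

record ('o, 'm) cat =
  Ob :: "'o set"
  Ar :: "'m set"
  Src :: "'m \<Rightarrow> 'o"
  Tgt :: "'m \<Rightarrow> 'o"
  Idn :: "'o \<Rightarrow> 'm"
  Cmp :: "'m \<Rightarrow> 'm \<Rightarrow> 'm"  \<comment> \<open>\<open>Cmp C g f\<close> is \<open>g\<close> after \<open>f\<close>\<close>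

definition composable :: "('o, 'm) cat \<Rightarrow> 'm \<Rightarrow> 'm \<Rightarrow> bool" where
  "composable C g f \<longleftrightarrow> g \<in> Ar C \<and> f \<in> Ar C \<and> Src C g = Tgt C f"

definition category :: "('o, 'm) cat \<Rightarrow> bool" where
  "category C \<longleftrightarrow>
     Src C \<in> Ar C \<rightarrow>\<^sub>E Ob C \<and> Tgt C \<in> Ar C \<rightarrow>\<^sub>E Ob C \<and> Idn C \<in> Ob C \<rightarrow>\<^sub>E Ar C \<and>
     (\<forall>g f. \<not> composable C g f \<longrightarrow> Cmp C g f = undefined) \<and>
     (\<forall>g f. composable C g f \<longrightarrow>
        Cmp C g f \<in> Ar C \<and> Src C (Cmp C g f) = Src C f \<and> Tgt C (Cmp C g f) = Tgt C g) \<and>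
     (\<forall>x\<in>Ob C. Src C (Idn C x) = x \<and> Tgt C (Idn C x) = x) \<and>
     (\<forall>f\<in>Ar C. Cmp C f (Idn C (Src C f)) = f \<and> Cmp C (Idn C (Tgt C f)) f = f) \<and>
     (\<forall>h g f. composable C h g \<and> composable C g f \<longrightarrow>
        Cmp C h (Cmp C g f) = Cmp C (Cmp C h g) f)"

definition mk_cat ::
  "'o set \<Rightarrow> 'm set \<Rightarrow> ('m \<Rightarrow> 'o) \<Rightarrow> ('m \<Rightarrow> 'o) \<Rightarrow> ('o \<Rightarrow> 'm) \<Rightarrow> ('m \<Rightarrow> 'm \<Rightarrow> 'm) \<Rightarrow> ('o, 'm) cat" where
  "mk_cat X F s t i c =
     \<lparr>Ob = X, Ar = F, Src = restrict s F, Tgt = restrict t F, Idn = restrict i X,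
      Cmp = (\<lambda>g f. if g \<in> F \<and> f \<in> F \<and> s g = t f then c g f else undefined)\<rparr>"

definition hom :: "('o, 'm) cat \<Rightarrow> 'o \<Rightarrow> 'o \<Rightarrow> 'm set" where
  "hom C x y = {f \<in> Ar C. Src C f = x \<and> Tgt C f = y}"

definition is_inverse :: "('o, 'm) cat \<Rightarrow> 'm \<Rightarrow> 'm \<Rightarrow> bool" where
  "is_inverse C f g \<longleftrightarrow>
     f \<in> Ar C \<and> g \<in> hom C (Tgt C f) (Src C f) \<and>
     Cmp C g f = Idn C (Src C f) \<and> Cmp C f g = Idn C (Tgt C f)"

definition is_iso :: "('o, 'm) cat \<Rightarrow> 'm \<Rightarrow> bool" where
  "is_iso C f \<longleftrightarrow> (\<exists>g. is_inverse C f g)"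

definition inv_ar :: "('o, 'm) cat \<Rightarrow> 'm \<Rightarrow> 'm" where
  "inv_ar C f = (THE g. is_inverse C f g)"

record ('o1, 'm1, 'o2, 'm2) ftor =
  FDom :: "('o1, 'm1) cat"
  FCod :: "('o2, 'm2) cat"
  FO :: "'o1 \<Rightarrow> 'o2"
  FA :: "'m1 \<Rightarrow> 'm2"

definition mk_ftor ::
  "('o1, 'm1) cat \<Rightarrow> ('o2, 'm2) cat \<Rightarrow> ('o1 \<Rightarrow> 'o2) \<Rightarrow> ('m1 \<Rightarrow> 'm2) \<Rightarrow> ('o1, 'm1, 'o2, 'm2) ftor" where
  "mk_ftor C D fo fa = \<lparr>FDom = C, FCod = D, FO = restrict fo (Ob C), FA = restrict fa (Ar C)\<rparr>"

definition Funs :: "('o1, 'm1) cat \<Rightarrow> ('o2, 'm2) cat \<Rightarrow> ('o1, 'm1, 'o2, 'm2) ftor set" where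
  "Funs C D = {F. FDom F = C \<and> FCod F = D \<and> FO F \<in> Ob C \<rightarrow>\<^sub>E Ob D \<and> FA F \<in> Ar C \<rightarrow>\<^sub>E Ar D \<and>
     (\<forall>f\<in>Ar C. Src D (FA F f) = FO F (Src C f) \<and> Tgt D (FA F f) = FO F (Tgt C f)) \<and>
     (\<forall>x\<in>Ob C. FA F (Idn C x) = Idn D (FO F x)) \<and>
     (\<forall>g f. composable C g f \<longrightarrow> FA F (Cmp C g f) = Cmp D (FA F g) (FA F f))}"

definition idf :: "('o, 'm) cat \<Rightarrow> ('o, 'm, 'o, 'm) ftor" where
  "idf C = mk_ftor C C (\<lambda>x. x) (\<lambda>f. f)"

definition fcomp ::
  "('o2, 'm2, 'o3, 'm3) ftor \<Rightarrow> ('o1, 'm1, 'o2, 'm2) ftor \<Rightarrow> ('o1, 'm1, 'o3, 'm3) ftor"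
  (infixr "\<circ>\<^sub>F" 55) where
  "G \<circ>\<^sub>F F = mk_ftor (FDom F) (FCod G) (\<lambda>x. FO G (FO F x)) (\<lambda>f. FA G (FA F f))"

record ('o1, 'm1, 'o2, 'm2) ntrans =
  NSrc :: "('o1, 'm1, 'o2, 'm2) ftor"
  NTgt :: "('o1, 'm1, 'o2, 'm2) ftor"
  NC :: "'o1 \<Rightarrow> 'm2"

definition mk_nt ::
  "('o1, 'm1, 'o2, 'm2) ftor \<Rightarrow> ('o1, 'm1, 'o2, 'm2) ftor \<Rightarrow> ('o1 \<Rightarrow> 'm2) \<Rightarrow>
   ('o1, 'm1, 'o2, 'm2) ntrans" where
  "mk_nt F G c = \<lparr>NSrc = F, NTgt = G, NC = restrict c (Ob (FDom F))\<rparr>"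

definition Ntrs ::
  "('o1, 'm1, 'o2, 'm2) ftor \<Rightarrow> ('o1, 'm1, 'o2, 'm2) ftor \<Rightarrow> ('o1, 'm1, 'o2, 'm2) ntrans set" where
  "Ntrs F G = {\<alpha>. NSrc \<alpha> = F \<and> NTgt \<alpha> = G \<and> FDom F = FDom G \<and> FCod F = FCod G \<and>
     NC \<alpha> \<in> extensional (Ob (FDom F)) \<and>
     (\<forall>x\<in>Ob (FDom F). NC \<alpha> x \<in> hom (FCod F) (FO F x) (FO G x)) \<and>
     (\<forall>f\<in>Ar (FDom F). Cmp (FCod F) (NC \<alpha> (Tgt (FDom F) f)) (FA F f) =
                      Cmp (FCod F) (FA G f) (NC \<alpha> (Src (FDom F) f)))}"

definition is_nat_iso :: "('o1, 'm1, 'o2, 'm2) ntrans \<Rightarrow> bool" where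
  "is_nat_iso \<alpha> \<longleftrightarrow> (\<forall>x\<in>Ob (FDom (NSrc \<alpha>)). is_iso (FCod (NSrc \<alpha>)) (NC \<alpha> x))"

definition idn :: "('o1, 'm1, 'o2, 'm2) ftor \<Rightarrow> ('o1, 'm1, 'o2, 'm2) ntrans" where
  "idn F = mk_nt F F (\<lambda>x. Idn (FCod F) (FO F x))"

definition vcomp ::
  "('o1, 'm1, 'o2, 'm2) ntrans \<Rightarrow> ('o1, 'm1, 'o2, 'm2) ntrans \<Rightarrow> ('o1, 'm1, 'o2, 'm2) ntrans"
  (infixr "\<bullet>" 55) where
  "\<beta> \<bullet> \<alpha> = mk_nt (NSrc \<alpha>) (NTgt \<beta>) (\<lambda>x. Cmp (FCod (NSrc \<alpha>)) (NC \<beta> x) (NC \<alpha> x))"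

definition lwhisker ::
  "('o2, 'm2, 'o3, 'm3) ftor \<Rightarrow> ('o1, 'm1, 'o2, 'm2) ntrans \<Rightarrow> ('o1, 'm1, 'o3, 'm3) ntrans" where
  "lwhisker G \<alpha> = mk_nt (G \<circ>\<^sub>F NSrc \<alpha>) (G \<circ>\<^sub>F NTgt \<alpha>) (\<lambda>x. FA G (NC \<alpha> x))"

definition rwhisker ::
  "('o2, 'm2, 'o3, 'm3) ntrans \<Rightarrow> ('o1, 'm1, 'o2, 'm2) ftor \<Rightarrow> ('o1, 'm1, 'o3, 'm3) ntrans" where
  "rwhisker \<alpha> F = mk_nt (NSrc \<alpha> \<circ>\<^sub>F F) (NTgt \<alpha> \<circ>\<^sub>F F) (\<lambda>x. NC \<alpha> (FO F x))"

definition is_equivalence :: "('o1, 'm1, 'o2, 'm2) ftor \<Rightarrow> bool" where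
  "is_equivalence F \<longleftrightarrow>
     (\<exists>G\<in>Funs (FCod F) (FDom F).
        (\<exists>\<eta>\<in>Ntrs (idf (FDom F)) (G \<circ>\<^sub>F F). is_nat_iso \<eta>) \<and>
        (\<exists>\<epsilon>\<in>Ntrs (F \<circ>\<^sub>F G) (idf (FCod F)). is_nat_iso \<epsilon>))"

definition adjunction ::
  "('o1, 'm1, 'o2, 'm2) ftor \<Rightarrow> ('o2, 'm2, 'o1, 'm1) ftor \<Rightarrow>
   ('o1, 'm1, 'o1, 'm1) ntrans \<Rightarrow> ('o2, 'm2, 'o2, 'm2) ntrans \<Rightarrow> bool" where
  "adjunction F G \<eta> \<epsilon> \<longleftrightarrow>
     F \<in> Funs (FDom F) (FCod F) \<and> G \<in> Funs (FCod F) (FDom F) \<and>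
     \<eta> \<in> Ntrs (idf (FDom F)) (G \<circ>\<^sub>F F) \<and> \<epsilon> \<in> Ntrs (F \<circ>\<^sub>F G) (idf (FCod F)) \<and>
     (\<forall>x\<in>Ob (FDom F). Cmp (FCod F) (NC \<epsilon> (FO F x)) (FA F (NC \<eta> x)) = Idn (FCod F) (FO F x)) \<and>
     (\<forall>y\<in>Ob (FCod F). Cmp (FDom F) (FA G (NC \<epsilon> y)) (NC \<eta> (FO G y)) = Idn (FDom F) (FO G y))"

definition has_left_adjoint :: "('o2, 'm2, 'o1, 'm1) ftor \<Rightarrow> bool" where
  "has_left_adjoint G \<longleftrightarrow>
     (\<exists>(F :: ('o1, 'm1, 'o2, 'm2) ftor) \<eta> \<epsilon>. adjunction F G \<eta> \<epsilon>)"

definition has_right_adjoint :: "('o1, 'm1, 'o2, 'm2) ftor \<Rightarrow> bool" where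
  "has_right_adjoint F \<longleftrightarrow>
     (\<exists>(G :: ('o2, 'm2, 'o1, 'm1) ftor) \<eta> \<epsilon>. adjunction F G \<eta> \<epsilon>)"

text \<open>
  A fixed choice of adjoint, unit and counit; adjoints being unique up to unique isomorphism,
  none of the invertibility conditions below depends on it.
\<close>

definition ladj_data ::
  "('o2, 'm2, 'o1, 'm1) ftor \<Rightarrow>
   ('o1, 'm1, 'o2, 'm2) ftor \<times> ('o1, 'm1, 'o1, 'm1) ntrans \<times> ('o2, 'm2, 'o2, 'm2) ntrans" where
  "ladj_data G = (SOME (F, \<eta>, \<epsilon>). adjunction F G \<eta> \<epsilon>)"

definition ladj :: "('o2, 'm2, 'o1, 'm1) ftor \<Rightarrow> ('o1, 'm1, 'o2, 'm2) ftor" where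
  "ladj G = fst (ladj_data G)"
definition ladj_unit :: "('o2, 'm2, 'o1, 'm1) ftor \<Rightarrow> ('o1, 'm1, 'o1, 'm1) ntrans" where
  "ladj_unit G = fst (snd (ladj_data G))"
definition ladj_counit :: "('o2, 'm2, 'o1, 'm1) ftor \<Rightarrow> ('o2, 'm2, 'o2, 'm2) ntrans" where
  "ladj_counit G = snd (snd (ladj_data G))"

definition radj_data ::
  "('o1, 'm1, 'o2, 'm2) ftor \<Rightarrow>
   ('o2, 'm2, 'o1, 'm1) ftor \<times> ('o1, 'm1, 'o1, 'm1) ntrans \<times> ('o2, 'm2, 'o2, 'm2) ntrans" where
  "radj_data F = (SOME (G, \<eta>, \<epsilon>). adjunction F G \<eta> \<epsilon>)"

definition radj :: "('o1, 'm1, 'o2, 'm2) ftor \<Rightarrow> ('o2, 'm2, 'o1, 'm1) ftor" where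
  "radj F = fst (radj_data F)"
definition radj_unit :: "('o1, 'm1, 'o2, 'm2) ftor \<Rightarrow> ('o1, 'm1, 'o1, 'm1) ntrans" where
  "radj_unit F = fst (snd (radj_data F))"
definition radj_counit :: "('o1, 'm1, 'o2, 'm2) ftor \<Rightarrow> ('o2, 'm2, 'o2, 'm2) ntrans" where
  "radj_counit F = snd (snd (radj_data F))"

definition cprod :: "('o1, 'm1) cat \<Rightarrow> ('o2, 'm2) cat \<Rightarrow> ('o1 \<times> 'o2, 'm1 \<times> 'm2) cat" where
  "cprod C D = mk_cat (Ob C \<times> Ob D) (Ar C \<times> Ar D)
     (\<lambda>(f, g). (Src C f, Src D g)) (\<lambda>(f, g). (Tgt C f, Tgt D g))
     (\<lambda>(x, y). (Idn C x, Idn D y)) (\<lambda>(f', g') (f, g). (Cmp C f' f, Cmp D g' g))"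

definition fprod ::
  "('o1, 'm1, 'p1, 'n1) ftor \<Rightarrow> ('o2, 'm2, 'p2, 'n2) ftor \<Rightarrow>
   ('o1 \<times> 'o2, 'm1 \<times> 'm2, 'p1 \<times> 'p2, 'n1 \<times> 'n2) ftor" where
  "fprod F G = mk_ftor (cprod (FDom F) (FDom G)) (cprod (FCod F) (FCod G))
     (\<lambda>(x, y). (FO F x, FO G y)) (\<lambda>(f, g). (FA F f, FA G g))"

definition fpair ::
  "('o, 'm, 'o1, 'm1) ftor \<Rightarrow> ('o, 'm, 'o2, 'm2) ftor \<Rightarrow> ('o, 'm, 'o1 \<times> 'o2, 'm1 \<times> 'm2) ftor" where
  "fpair F G = mk_ftor (FDom F) (cprod (FCod F) (FCod G))
     (\<lambda>x. (FO F x, FO G x)) (\<lambda>f. (FA F f, FA G f))"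

definition big_prod :: "'i set \<Rightarrow> ('i \<Rightarrow> ('o, 'm) cat) \<Rightarrow> ('i \<Rightarrow> 'o, 'i \<Rightarrow> 'm) cat" where
  "big_prod I C = mk_cat (\<Pi>\<^sub>E i\<in>I. Ob (C i)) (\<Pi>\<^sub>E i\<in>I. Ar (C i))
     (\<lambda>f. \<lambda>i\<in>I. Src (C i) (f i)) (\<lambda>f. \<lambda>i\<in>I. Tgt (C i) (f i))
     (\<lambda>x. \<lambda>i\<in>I. Idn (C i) (x i)) (\<lambda>g f. \<lambda>i\<in>I. Cmp (C i) (g i) (f i))"

definition unit_cat :: "(unit, unit) cat" where
  "unit_cat = mk_cat UNIV UNIV (\<lambda>_. ()) (\<lambda>_. ()) (\<lambda>_. ()) (\<lambda>_ _. ())"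

section \<open>The 2-category of small categories\<close>

text \<open>
  Small categories have objects and arrows in \<open>'a code\<close>, a type with a built-in pairing,
  so that products, coproducts and comma categories stay within one type.
  Which sets of codes count as small is prescribed by a family \<open>U\<close>.  The closure properties
  demanded are those of a regular cardinal bound; they suffice for all constructions on small
  categories that occur in the definition of a derivator.  The sets of cardinality below an
  inaccessible cardinal \<open>\<kappa>\<close> (for \<open>'a\<close> of cardinality \<open>\<kappa>\<close>), i.e. the small sets of a
  Grothendieck universe, are an instance.
\<close>

datatype 'a code = Atom 'a | Star | Pr (cfst: "'a code") (csnd: "'a code")

type_synonym 'a scat = "('a code, 'a code) cat"
type_synonym 'a sftor = "('a code, 'a code, 'a code, 'a code) ftor"
type_synonym 'a sntrans = "('a code, 'a code, 'a code, 'a code) ntrans"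

definition universe :: "'a code set set \<Rightarrow> bool" where
  "universe U \<longleftrightarrow>
     (\<forall>X. finite X \<longrightarrow> X \<in> U) \<and>
     (\<forall>X\<in>U. \<forall>Y. Y \<subseteq> X \<longrightarrow> Y \<in> U) \<and>
     (\<forall>I\<in>U. \<forall>F :: 'a code \<Rightarrow> 'a code set. (\<forall>i\<in>I. F i \<in> U) \<longrightarrow> (\<Union>i\<in>I. F i) \<in> U)"

definition Cat :: "'a code set set \<Rightarrow> 'a scat set" where
  "Cat U = {A. category A \<and> Ob A \<in> U \<and> Ar A \<in> U}"

definition one :: "'a scat" where
  "one = mk_cat {Star} {Star} (\<lambda>_. Star) (\<lambda>_. Star) (\<lambda>_. Star) (\<lambda>_ _. Star)"

definition sprod :: "'a scat \<Rightarrow> 'a scat \<Rightarrow> 'a scat" (infixr "\<times>\<^sub>C" 80) where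
  "A \<times>\<^sub>C B = mk_cat
     {Pr a b | a b. a \<in> Ob A \<and> b \<in> Ob B} {Pr f g | f g. f \<in> Ar A \<and> g \<in> Ar B}
     (\<lambda>h. Pr (Src A (cfst h)) (Src B (csnd h))) (\<lambda>h. Pr (Tgt A (cfst h)) (Tgt B (csnd h)))
     (\<lambda>x. Pr (Idn A (cfst x)) (Idn B (csnd x)))
     (\<lambda>k h. Pr (Cmp A (cfst k) (cfst h)) (Cmp B (csnd k) (csnd h)))"

definition pr1 :: "'a scat \<Rightarrow> 'a scat \<Rightarrow> 'a sftor" where
  "pr1 A B = mk_ftor (A \<times>\<^sub>C B) A cfst cfst"
definition pr2 :: "'a scat \<Rightarrow> 'a scat \<Rightarrow> 'a sftor" where
  "pr2 A B = mk_ftor (A \<times>\<^sub>C B) B csnd csnd"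

definition sprod_ftor :: "'a sftor \<Rightarrow> 'a sftor \<Rightarrow> 'a sftor" (infixr "\<times>\<^sub>F" 80) where
  "u \<times>\<^sub>F v = mk_ftor (FDom u \<times>\<^sub>C FDom v) (FCod u \<times>\<^sub>C FCod v)
     (\<lambda>x. Pr (FO u (cfst x)) (FO v (csnd x))) (\<lambda>h. Pr (FA u (cfst h)) (FA v (csnd h)))"

definition coprod :: "'a code set \<Rightarrow> ('a code \<Rightarrow> 'a scat) \<Rightarrow> 'a scat" where
  "coprod I A = mk_cat
     {Pr i x | i x. i \<in> I \<and> x \<in> Ob (A i)} {Pr i f | i f. i \<in> I \<and> f \<in> Ar (A i)}
     (\<lambda>h. Pr (cfst h) (Src (A (cfst h)) (csnd h))) (\<lambda>h. Pr (cfst h) (Tgt (A (cfst h)) (csnd h)))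
     (\<lambda>x. Pr (cfst x) (Idn (A (cfst x)) (csnd x)))
     (\<lambda>k h. Pr (cfst h) (Cmp (A (cfst h)) (csnd k) (csnd h)))"

definition inj_ftor :: "'a code set \<Rightarrow> ('a code \<Rightarrow> 'a scat) \<Rightarrow> 'a code \<Rightarrow> 'a sftor" where
  "inj_ftor I A i = mk_ftor (A i) (coprod I A) (Pr i) (Pr i)"

text \<open>
  The comma category \<open>(u/w)\<close> of \<open>u : A \<rightarrow> B\<close> and \<open>w : C \<rightarrow> B\<close>: an object \<open>Pr (Pr a c) f\<close> is an
  arrow \<open>f : u a \<rightarrow> w c\<close>; an arrow \<open>Pr (Pr x y) (Pr g h)\<close> from \<open>x\<close> to \<open>y\<close> is a pair of arrows
  \<open>g\<close> of \<open>A\<close> and \<open>h\<close> of \<open>C\<close> making the evident square commute.  For \<open>b : 1 \<rightarrow> B\<close> the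
  slices \<open>(u/b)\<close> and \<open>(b/u)\<close> are the comma categories of the pairs \<open>u, b\<close> and \<open>b, u\<close>.
\<close>

definition comma_ob :: "'a sftor \<Rightarrow> 'a sftor \<Rightarrow> 'a code set" where
  "comma_ob u w = {Pr (Pr a c) f | a c f.
     a \<in> Ob (FDom u) \<and> c \<in> Ob (FDom w) \<and> f \<in> hom (FCod u) (FO u a) (FO w c)}"

definition comma_ar :: "'a sftor \<Rightarrow> 'a sftor \<Rightarrow> 'a code set" where
  "comma_ar u w = {Pr (Pr x y) (Pr g h) | x y g h.
     x \<in> comma_ob u w \<and> y \<in> comma_ob u w \<and>
     g \<in> hom (FDom u) (cfst (cfst x)) (cfst (cfst y)) \<and>
     h \<in> hom (FDom w) (csnd (cfst x)) (csnd (cfst y)) \<and>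
     Cmp (FCod u) (csnd y) (FA u g) = Cmp (FCod u) (FA w h) (csnd x)}"

definition comma :: "'a sftor \<Rightarrow> 'a sftor \<Rightarrow> 'a scat" where
  "comma u w = mk_cat (comma_ob u w) (comma_ar u w)
     (\<lambda>k. cfst (cfst k)) (\<lambda>k. csnd (cfst k))
     (\<lambda>x. Pr (Pr x x) (Pr (Idn (FDom u) (cfst (cfst x))) (Idn (FDom w) (csnd (cfst x)))))
     (\<lambda>l k. Pr (Pr (cfst (cfst k)) (csnd (cfst l)))
              (Pr (Cmp (FDom u) (cfst (csnd l)) (cfst (csnd k)))
                  (Cmp (FDom w) (csnd (csnd l)) (csnd (csnd k)))))"

definition comma_pr1 :: "'a sftor \<Rightarrow> 'a sftor \<Rightarrow> 'a sftor" where
  "comma_pr1 u w = mk_ftor (comma u w) (FDom u) (\<lambda>x. cfst (cfst x)) (\<lambda>k. cfst (csnd k))"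
definition comma_pr2 :: "'a sftor \<Rightarrow> 'a sftor \<Rightarrow> 'a sftor" where
  "comma_pr2 u w = mk_ftor (comma u w) (FDom w) (\<lambda>x. csnd (cfst x)) (\<lambda>k. csnd (csnd k))"
definition comma_nt :: "'a sftor \<Rightarrow> 'a sftor \<Rightarrow> 'a sntrans" where
  "comma_nt u w = mk_nt (u \<circ>\<^sub>F comma_pr1 u w) (w \<circ>\<^sub>F comma_pr2 u w) csnd"

section \<open>Derivators\<close>

text \<open>
  All the (possibly large) categories \<open>PD D A\<close> have their objects in one type \<open>'o\<close> and
  their arrows in one type \<open>'m\<close>.  \<open>PF D u\<close> is \<open>u\<^sup>*\<close> and \<open>PN D \<alpha>\<close> is \<open>\<alpha>\<^sup>*\<close>.
\<close>

record ('a, 'o, 'm) prederiv =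
  PD :: "'a scat \<Rightarrow> ('o, 'm) cat"
  PF :: "'a sftor \<Rightarrow> ('o, 'm, 'o, 'm) ftor"
  PN :: "'a sntrans \<Rightarrow> ('o, 'm, 'o, 'm) ntrans"

definition prederivator :: "'a code set set \<Rightarrow> ('a, 'o, 'm) prederiv \<Rightarrow> bool" where
  "prederivator U D \<longleftrightarrow>
     (\<forall>A\<in>Cat U. category (PD D A)) \<and>
     (\<forall>A\<in>Cat U. \<forall>B\<in>Cat U. \<forall>u\<in>Funs A B. PF D u \<in> Funs (PD D B) (PD D A)) \<and>
     (\<forall>A\<in>Cat U. \<forall>B\<in>Cat U. \<forall>u\<in>Funs A B. \<forall>v\<in>Funs A B. \<forall>\<alpha>\<in>Ntrs u v.
        PN D \<alpha> \<in> Ntrs (PF D u) (PF D v)) \<and>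
     (\<forall>A\<in>Cat U. PF D (idf A) = idf (PD D A)) \<and>
     (\<forall>A\<in>Cat U. \<forall>B\<in>Cat U. \<forall>C\<in>Cat U. \<forall>u\<in>Funs A B. \<forall>v\<in>Funs B C.
        PF D (v \<circ>\<^sub>F u) = PF D u \<circ>\<^sub>F PF D v) \<and>
     (\<forall>A\<in>Cat U. \<forall>B\<in>Cat U. \<forall>u\<in>Funs A B. PN D (idn u) = idn (PF D u)) \<and>
     (\<forall>A\<in>Cat U. \<forall>B\<in>Cat U. \<forall>u\<in>Funs A B. \<forall>v\<in>Funs A B. \<forall>w\<in>Funs A B. \<forall>\<alpha>\<in>Ntrs u v. \<forall>\<beta>\<in>Ntrs v w.
        PN D (\<beta> \<bullet> \<alpha>) = PN D \<beta> \<bullet> PN D \<alpha>) \<and>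
     (\<forall>A\<in>Cat U. \<forall>B\<in>Cat U. \<forall>C\<in>Cat U. \<forall>u\<in>Funs A B. \<forall>v\<in>Funs A B. \<forall>\<alpha>\<in>Ntrs u v. \<forall>w\<in>Funs B C.
        PN D (lwhisker w \<alpha>) = rwhisker (PN D \<alpha>) (PF D w)) \<and>
     (\<forall>A\<in>Cat U. \<forall>B\<in>Cat U. \<forall>C\<in>Cat U. \<forall>u\<in>Funs B C. \<forall>v\<in>Funs B C. \<forall>\<alpha>\<in>Ntrs u v. \<forall>w\<in>Funs A B.
        PN D (rwhisker \<alpha> w) = lwhisker (PF D w) (PN D \<alpha>))"

definition lan :: "('a, 'o, 'm) prederiv \<Rightarrow> 'a sftor \<Rightarrow> ('o, 'm, 'o, 'm) ftor" where
  "lan D u = ladj (PF D u)"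
definition lan_unit :: "('a, 'o, 'm) prederiv \<Rightarrow> 'a sftor \<Rightarrow> ('o, 'm, 'o, 'm) ntrans" where
  "lan_unit D u = ladj_unit (PF D u)"
definition lan_counit :: "('a, 'o, 'm) prederiv \<Rightarrow> 'a sftor \<Rightarrow> ('o, 'm, 'o, 'm) ntrans" where
  "lan_counit D u = ladj_counit (PF D u)"

definition ran :: "('a, 'o, 'm) prederiv \<Rightarrow> 'a sftor \<Rightarrow> ('o, 'm, 'o, 'm) ftor" where
  "ran D u = radj (PF D u)"
definition ran_unit :: "('a, 'o, 'm) prederiv \<Rightarrow> 'a sftor \<Rightarrow> ('o, 'm, 'o, 'm) ntrans" where
  "ran_unit D u = radj_unit (PF D u)"
definition ran_counit :: "('a, 'o, 'm) prederiv \<Rightarrow> 'a sftor \<Rightarrow> ('o, 'm, 'o, 'm) ntrans" where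
  "ran_counit D u = radj_counit (PF D u)"

text \<open>
  The mates of \<open>\<alpha> : u p \<rightarrow> q v\<close>, where \<open>p : K \<rightarrow> A\<close>, \<open>v : K \<rightarrow> M\<close>, \<open>u : A \<rightarrow> B\<close>,
  \<open>q : M \<rightarrow> B\<close>.  By strictness, \<open>\<alpha>\<^sup>*\<close> has components \<open>p\<^sup>* u\<^sup>* Y \<rightarrow> v\<^sup>* q\<^sup>* Y\<close>.
\<close>

definition lmate ::
  "('a, 'o, 'm) prederiv \<Rightarrow> 'a sftor \<Rightarrow> 'a sftor \<Rightarrow> 'a sftor \<Rightarrow> 'a sftor \<Rightarrow> 'a sntrans \<Rightarrow> 'o \<Rightarrow> 'm" where
  "lmate D p v u q \<alpha> X =
     (let C = PD D (FCod v); Y = FO (lan D u) X in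
      Cmp C (NC (lan_counit D v) (FO (PF D q) Y))
        (Cmp C (FA (lan D v) (NC (PN D \<alpha>) Y))
               (FA (lan D v) (FA (PF D p) (NC (lan_unit D u) X)))))"

definition rmate ::
  "('a, 'o, 'm) prederiv \<Rightarrow> 'a sftor \<Rightarrow> 'a sftor \<Rightarrow> 'a sftor \<Rightarrow> 'a sftor \<Rightarrow> 'a sntrans \<Rightarrow> 'o \<Rightarrow> 'm" where
  "rmate D p v u q \<alpha> X =
     (let C = PD D (FCod p); Y = FO (ran D q) X in
      Cmp C (FA (ran D p) (FA (PF D v) (NC (ran_counit D q) X)))
        (Cmp C (FA (ran D p) (NC (PN D \<alpha>) Y))
               (NC (ran_unit D p) (FO (PF D u) Y))))"

definition exact ::
  "('a, 'o, 'm) prederiv \<Rightarrow> 'a sftor \<Rightarrow> 'a sftor \<Rightarrow> 'a sftor \<Rightarrow> 'a sftor \<Rightarrow> 'a sntrans \<Rightarrow> bool" where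
  "exact D p v u q \<alpha> \<longleftrightarrow>
     (\<forall>X\<in>Ob (PD D (FCod p)). is_iso (PD D (FCod v)) (lmate D p v u q \<alpha> X))"

definition der1 :: "'a code set set \<Rightarrow> ('a, 'o, 'm) prederiv \<Rightarrow> bool" where
  "der1 U D \<longleftrightarrow>
     (\<forall>I\<in>U. \<forall>A. (\<forall>i\<in>I. A i \<in> Cat U) \<longrightarrow>
        is_equivalence (mk_ftor (PD D (coprod I A)) (big_prod I (\<lambda>i. PD D (A i)))
          (\<lambda>X. \<lambda>i\<in>I. FO (PF D (inj_ftor I A i)) X)
          (\<lambda>f. \<lambda>i\<in>I. FA (PF D (inj_ftor I A i)) f)))"

definition der2 :: "'a code set set \<Rightarrow> ('a, 'o, 'm) prederiv \<Rightarrow> bool" where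
  "der2 U D \<longleftrightarrow>
     (\<forall>A\<in>Cat U. \<forall>f\<in>Ar (PD D A).
        is_iso (PD D A) f \<longleftrightarrow> (\<forall>a\<in>Funs one A. is_iso (PD D one) (FA (PF D a) f)))"

definition der3 :: "'a code set set \<Rightarrow> ('a, 'o, 'm) prederiv \<Rightarrow> bool" where
  "der3 U D \<longleftrightarrow>
     (\<forall>A\<in>Cat U. \<forall>B\<in>Cat U. \<forall>u\<in>Funs A B. has_left_adjoint (PF D u) \<and> has_right_adjoint (PF D u))"

text \<open>
  For \<open>b : 1 \<rightarrow> B\<close> the comma squares of \<open>u, b\<close> and of \<open>b, u\<close> have the projection
  \<open>\<pi>\<close> of the slice to the terminal category as one side, so their mates are
  \<open>\<pi>\<^sub>! p\<^sup>* X \<rightarrow> b\<^sup>* u\<^sub>! X\<close> and \<open>b\<^sup>* u\<^sub>* X \<rightarrow> \<pi>\<^sub>* q\<^sup>* X\<close>.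
\<close>

definition der4 :: "'a code set set \<Rightarrow> ('a, 'o, 'm) prederiv \<Rightarrow> bool" where
  "der4 U D \<longleftrightarrow>
     (\<forall>A\<in>Cat U. \<forall>B\<in>Cat U. \<forall>u\<in>Funs A B. \<forall>b\<in>Funs one B. \<forall>X\<in>Ob (PD D A).
        is_iso (PD D one) (lmate D (comma_pr1 u b) (comma_pr2 u b) u b (comma_nt u b) X) \<and>
        is_iso (PD D one) (rmate D (comma_pr1 b u) (comma_pr2 b u) b u (comma_nt b u) X))"

definition derivator :: "'a code set set \<Rightarrow> ('a, 'o, 'm) prederiv \<Rightarrow> bool" where
  "derivator U D \<longleftrightarrow> prederivator U D \<and> der1 U D \<and> der2 U D \<and> der3 U D \<and> der4 U D"

section \<open>Morphisms of derivators and modifications\<close>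

text \<open>
  \<open>PC F A : D(A) \<rightarrow> E(A)\<close> are the components of a pseudonatural transformation \<open>F : D \<rightarrow> E\<close>;
  for \<open>u : A \<rightarrow> B\<close> the structure isomorphism \<open>PI F u\<close> has components \<open>u\<^sup>* F\<^sub>B X \<rightarrow> F\<^sub>A u\<^sup>* X\<close>.
\<close>

record ('a, 'o1, 'm1, 'o2, 'm2) pnat =
  PC :: "'a scat \<Rightarrow> ('o1, 'm1, 'o2, 'm2) ftor"
  PI :: "'a sftor \<Rightarrow> ('o1, 'm1, 'o2, 'm2) ntrans"

definition pseudonatural ::
  "'a code set set \<Rightarrow> ('a, 'o1, 'm1) prederiv \<Rightarrow> ('a, 'o2, 'm2) prederiv \<Rightarrow>
   ('a, 'o1, 'm1, 'o2, 'm2) pnat \<Rightarrow> bool" where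
  "pseudonatural U D E F \<longleftrightarrow>
     (\<forall>A\<in>Cat U. PC F A \<in> Funs (PD D A) (PD E A)) \<and>
     (\<forall>A\<in>Cat U. \<forall>B\<in>Cat U. \<forall>u\<in>Funs A B.
        PI F u \<in> Ntrs (PF E u \<circ>\<^sub>F PC F B) (PC F A \<circ>\<^sub>F PF D u) \<and> is_nat_iso (PI F u)) \<and>
     (\<forall>A\<in>Cat U. PI F (idf A) = idn (PC F A)) \<and>
     (\<forall>A\<in>Cat U. \<forall>B\<in>Cat U. \<forall>C\<in>Cat U. \<forall>u\<in>Funs A B. \<forall>v\<in>Funs B C.
        PI F (v \<circ>\<^sub>F u) = rwhisker (PI F u) (PF D v) \<bullet> lwhisker (PF E u) (PI F v)) \<and>
     (\<forall>A\<in>Cat U. \<forall>B\<in>Cat U. \<forall>u\<in>Funs A B. \<forall>v\<in>Funs A B. \<forall>\<alpha>\<in>Ntrs u v.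
        PI F v \<bullet> rwhisker (PN E \<alpha>) (PC F B) = lwhisker (PC F A) (PN D \<alpha>) \<bullet> PI F u)"

definition modification ::
  "'a code set set \<Rightarrow> ('a, 'o1, 'm1) prederiv \<Rightarrow> ('a, 'o2, 'm2) prederiv \<Rightarrow>
   ('a, 'o1, 'm1, 'o2, 'm2) pnat \<Rightarrow> ('a, 'o1, 'm1, 'o2, 'm2) pnat \<Rightarrow>
   ('a scat \<Rightarrow> ('o1, 'm1, 'o2, 'm2) ntrans) \<Rightarrow> bool" where
  "modification U D E F G m \<longleftrightarrow>
     (\<forall>A\<in>Cat U. m A \<in> Ntrs (PC F A) (PC G A)) \<and>
     (\<forall>A\<in>Cat U. \<forall>B\<in>Cat U. \<forall>u\<in>Funs A B.
        PI G u \<bullet> lwhisker (PF E u) (m B) = rwhisker (m A) (PF D u) \<bullet> PI F u)"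

definition inv_modification ::
  "'a code set set \<Rightarrow> ('a, 'o1, 'm1) prederiv \<Rightarrow> ('a, 'o2, 'm2) prederiv \<Rightarrow>
   ('a, 'o1, 'm1, 'o2, 'm2) pnat \<Rightarrow> ('a, 'o1, 'm1, 'o2, 'm2) pnat \<Rightarrow>
   ('a scat \<Rightarrow> ('o1, 'm1, 'o2, 'm2) ntrans) \<Rightarrow> bool" where
  "inv_modification U D E F G m \<longleftrightarrow> modification U D E F G m \<and> (\<forall>A\<in>Cat U. is_nat_iso (m A))"

definition pid :: "('a, 'o, 'm) prederiv \<Rightarrow> ('a, 'o, 'm, 'o, 'm) pnat" where
  "pid D = \<lparr>PC = (\<lambda>A. idf (PD D A)), PI = (\<lambda>u. idn (PF D u))\<rparr>"

definition pcomp ::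
  "('a, 'o2, 'm2, 'o3, 'm3) pnat \<Rightarrow> ('a, 'o1, 'm1, 'o2, 'm2) pnat \<Rightarrow> ('a, 'o1, 'm1, 'o3, 'm3) pnat"
  (infixr "\<circ>\<^sub>P" 55) where
  "G \<circ>\<^sub>P F = \<lparr>PC = (\<lambda>A. PC G A \<circ>\<^sub>F PC F A),
     PI = (\<lambda>u. lwhisker (PC G (FDom u)) (PI F u) \<bullet> rwhisker (PI G u) (PC F (FCod u)))\<rparr>"

definition pprod ::
  "('a, 'o1, 'm1) prederiv \<Rightarrow> ('a, 'o2, 'm2) prederiv \<Rightarrow> ('a, 'o1 \<times> 'o2, 'm1 \<times> 'm2) prederiv"
  (infixr "\<times>\<^sub>P" 80) where
  "D1 \<times>\<^sub>P D2 = \<lparr>PD = (\<lambda>A. cprod (PD D1 A) (PD D2 A)),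
     PF = (\<lambda>u. fprod (PF D1 u) (PF D2 u)),
     PN = (\<lambda>\<alpha>. mk_nt (fprod (NSrc (PN D1 \<alpha>)) (NSrc (PN D2 \<alpha>))) (fprod (NTgt (PN D1 \<alpha>)) (NTgt (PN D2 \<alpha>)))
             (\<lambda>(X, Y). (NC (PN D1 \<alpha>) X, NC (PN D2 \<alpha>) Y)))\<rparr>"

definition punit :: "('a, unit, unit) prederiv" where
  "punit = \<lparr>PD = (\<lambda>_. unit_cat), PF = (\<lambda>_. idf unit_cat), PN = (\<lambda>_. idn (idf unit_cat))\<rparr>"

definition pbang :: "('a, 'o, 'm) prederiv \<Rightarrow> ('a, 'o, 'm, unit, unit) pnat" where
  "pbang D =
     (let T = (\<lambda>A. mk_ftor (PD D A) unit_cat (\<lambda>_. ()) (\<lambda>_. ()))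
      in \<lparr>PC = T, PI = (\<lambda>u. idn (T (FCod u)))\<rparr>)"

definition pfst ::
  "('a, 'o1, 'm1) prederiv \<Rightarrow> ('a, 'o2, 'm2) prederiv \<Rightarrow> ('a, 'o1 \<times> 'o2, 'm1 \<times> 'm2, 'o1, 'm1) pnat" where
  "pfst D1 D2 =
     (let P = (\<lambda>A. mk_ftor (cprod (PD D1 A) (PD D2 A)) (PD D1 A) fst fst)
      in \<lparr>PC = P, PI = (\<lambda>u. idn (PF D1 u \<circ>\<^sub>F P (FCod u)))\<rparr>)"

definition psnd ::
  "('a, 'o1, 'm1) prederiv \<Rightarrow> ('a, 'o2, 'm2) prederiv \<Rightarrow> ('a, 'o1 \<times> 'o2, 'm1 \<times> 'm2, 'o2, 'm2) pnat" where
  "psnd D1 D2 =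
     (let P = (\<lambda>A. mk_ftor (cprod (PD D1 A) (PD D2 A)) (PD D2 A) snd snd)
      in \<lparr>PC = P, PI = (\<lambda>u. idn (PF D2 u \<circ>\<^sub>F P (FCod u)))\<rparr>)"

definition ppair ::
  "('a, 'o, 'm, 'o1, 'm1) pnat \<Rightarrow> ('a, 'o, 'm, 'o2, 'm2) pnat \<Rightarrow>
   ('a, 'o, 'm, 'o1 \<times> 'o2, 'm1 \<times> 'm2) pnat" where
  "ppair F G = \<lparr>PC = (\<lambda>A. fpair (PC F A) (PC G A)),
     PI = (\<lambda>u. mk_nt (fpair (NSrc (PI F u)) (NSrc (PI G u))) (fpair (NTgt (PI F u)) (NTgt (PI G u)))
             (\<lambda>X. (NC (PI F u) X, NC (PI G u) X)))\<rparr>"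

section \<open>External products, cocontinuity and adjunctions of two variables\<close>

text \<open>
  Throughout, \<open>T : D1 \<times> D2 \<rightarrow> D3\<close>.  The external product of \<open>X \<in> D1(A)\<close> and \<open>Y \<in> D2(B)\<close>
  is \<open>T\<close> at \<open>A \<times> B\<close> applied to the restrictions of \<open>X\<close> and \<open>Y\<close> along the projections.
\<close>

definition ext ::
  "('a, 'o1, 'm1) prederiv \<Rightarrow> ('a, 'o2, 'm2) prederiv \<Rightarrow> ('a, 'o1 \<times> 'o2, 'm1 \<times> 'm2, 'o3, 'm3) pnat \<Rightarrow>
   'a scat \<Rightarrow> 'a scat \<Rightarrow> 'o1 \<Rightarrow> 'o2 \<Rightarrow> 'o3" where
  "ext D1 D2 T A B X Y =
     FO (PC T (A \<times>\<^sub>C B)) (FO (PF D1 (pr1 A B)) X, FO (PF D2 (pr2 A B)) Y)"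

definition ext_ar ::
  "('a, 'o1, 'm1) prederiv \<Rightarrow> ('a, 'o2, 'm2) prederiv \<Rightarrow> ('a, 'o1 \<times> 'o2, 'm1 \<times> 'm2, 'o3, 'm3) pnat \<Rightarrow>
   'a scat \<Rightarrow> 'a scat \<Rightarrow> 'm1 \<Rightarrow> 'm2 \<Rightarrow> 'm3" where
  "ext_ar D1 D2 T A B f g =
     FA (PC T (A \<times>\<^sub>C B)) (FA (PF D1 (pr1 A B)) f, FA (PF D2 (pr2 A B)) g)"

text \<open>
  For \<open>u : A \<rightarrow> A'\<close> and \<open>v : B \<rightarrow> B'\<close> the canonical isomorphism
  \<open>u\<^sup>* X \<otimes> v\<^sup>* Y \<rightarrow> (u \<times> v)\<^sup>* (X \<otimes> Y)\<close>, the inverse of a structure isomorphism of \<open>T\<close>.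
\<close>

definition ext_iso ::
  "('a, 'o1, 'm1) prederiv \<Rightarrow> ('a, 'o2, 'm2) prederiv \<Rightarrow> ('a, 'o3, 'm3) prederiv \<Rightarrow>
   ('a, 'o1 \<times> 'o2, 'm1 \<times> 'm2, 'o3, 'm3) pnat \<Rightarrow> 'a sftor \<Rightarrow> 'a sftor \<Rightarrow> 'o1 \<Rightarrow> 'o2 \<Rightarrow> 'm3" where
  "ext_iso D1 D2 D3 T u v X Y =
     inv_ar (PD D3 (FDom u \<times>\<^sub>C FDom v))
       (NC (PI T (u \<times>\<^sub>F v))
         (FO (PF D1 (pr1 (FCod u) (FCod v))) X, FO (PF D2 (pr2 (FCod u) (FCod v))) Y))"

text \<open>The canonical maps \<open>(u \<times> id)\<^sub>! (X \<otimes> Y) \<rightarrow> u\<^sub>! X \<otimes> Y\<close> and \<open>(id \<times> v)\<^sub>! (X \<otimes> Y) \<rightarrow> X \<otimes> v\<^sub>! Y\<close>.\<close>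

definition ext_lan1 ::
  "('a, 'o1, 'm1) prederiv \<Rightarrow> ('a, 'o2, 'm2) prederiv \<Rightarrow> ('a, 'o3, 'm3) prederiv \<Rightarrow>
   ('a, 'o1 \<times> 'o2, 'm1 \<times> 'm2, 'o3, 'm3) pnat \<Rightarrow> 'a sftor \<Rightarrow> 'a scat \<Rightarrow> 'o1 \<Rightarrow> 'o2 \<Rightarrow> 'm3" where
  "ext_lan1 D1 D2 D3 T u B X Y =
     (let w = u \<times>\<^sub>F idf B; C = PD D3 (FCod w); X' = FO (lan D1 u) X in
      Cmp C (NC (lan_counit D3 w) (ext D1 D2 T (FCod u) B X' Y))
        (Cmp C (FA (lan D3 w) (ext_iso D1 D2 D3 T u (idf B) X' Y))
               (FA (lan D3 w)
                 (ext_ar D1 D2 T (FDom u) B (NC (lan_unit D1 u) X) (Idn (PD D2 B) Y)))))"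

definition ext_lan2 ::
  "('a, 'o1, 'm1) prederiv \<Rightarrow> ('a, 'o2, 'm2) prederiv \<Rightarrow> ('a, 'o3, 'm3) prederiv \<Rightarrow>
   ('a, 'o1 \<times> 'o2, 'm1 \<times> 'm2, 'o3, 'm3) pnat \<Rightarrow> 'a scat \<Rightarrow> 'a sftor \<Rightarrow> 'o1 \<Rightarrow> 'o2 \<Rightarrow> 'm3" where
  "ext_lan2 D1 D2 D3 T A v X Y =
     (let w = idf A \<times>\<^sub>F v; C = PD D3 (FCod w); Y' = FO (lan D2 v) Y in
      Cmp C (NC (lan_counit D3 w) (ext D1 D2 T A (FCod v) X Y'))
        (Cmp C (FA (lan D3 w) (ext_iso D1 D2 D3 T (idf A) v X Y'))
               (FA (lan D3 w)
                 (ext_ar D1 D2 T A (FDom v) (Idn (PD D1 A) X) (NC (lan_unit D2 v) Y)))))"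

definition cocontinuous2 ::
  "'a code set set \<Rightarrow> ('a, 'o1, 'm1) prederiv \<Rightarrow> ('a, 'o2, 'm2) prederiv \<Rightarrow> ('a, 'o3, 'm3) prederiv \<Rightarrow>
   ('a, 'o1 \<times> 'o2, 'm1 \<times> 'm2, 'o3, 'm3) pnat \<Rightarrow> bool" where
  "cocontinuous2 U D1 D2 D3 T \<longleftrightarrow>
     (\<forall>A\<in>Cat U. \<forall>A'\<in>Cat U. \<forall>B\<in>Cat U. \<forall>u\<in>Funs A A'. \<forall>X\<in>Ob (PD D1 A). \<forall>Y\<in>Ob (PD D2 B).
        is_iso (PD D3 (A' \<times>\<^sub>C B)) (ext_lan1 D1 D2 D3 T u B X Y)) \<and>
     (\<forall>A\<in>Cat U. \<forall>B\<in>Cat U. \<forall>B'\<in>Cat U. \<forall>v\<in>Funs B B'. \<forall>X\<in>Ob (PD D1 A). \<forall>Y\<in>Ob (PD D2 B).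
        is_iso (PD D3 (A \<times>\<^sub>C B')) (ext_lan2 D1 D2 D3 T A v X Y))"

text \<open>The functors \<open>- \<otimes> Y : D1(A) \<rightarrow> D3(A \<times> B)\<close> and \<open>X \<otimes> - : D2(B) \<rightarrow> D3(A \<times> B)\<close>.\<close>

definition tens1 ::
  "('a, 'o1, 'm1) prederiv \<Rightarrow> ('a, 'o2, 'm2) prederiv \<Rightarrow> ('a, 'o3, 'm3) prederiv \<Rightarrow>
   ('a, 'o1 \<times> 'o2, 'm1 \<times> 'm2, 'o3, 'm3) pnat \<Rightarrow> 'a scat \<Rightarrow> 'a scat \<Rightarrow> 'o2 \<Rightarrow> ('o1, 'm1, 'o3, 'm3) ftor" where
  "tens1 D1 D2 D3 T A B Y = mk_ftor (PD D1 A) (PD D3 (A \<times>\<^sub>C B))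
     (\<lambda>X. ext D1 D2 T A B X Y) (\<lambda>f. ext_ar D1 D2 T A B f (Idn (PD D2 B) Y))"

definition tens2 ::
  "('a, 'o1, 'm1) prederiv \<Rightarrow> ('a, 'o2, 'm2) prederiv \<Rightarrow> ('a, 'o3, 'm3) prederiv \<Rightarrow>
   ('a, 'o1 \<times> 'o2, 'm1 \<times> 'm2, 'o3, 'm3) pnat \<Rightarrow> 'a scat \<Rightarrow> 'a scat \<Rightarrow> 'o1 \<Rightarrow> ('o2, 'm2, 'o3, 'm3) ftor" where
  "tens2 D1 D2 D3 T A B X = mk_ftor (PD D2 B) (PD D3 (A \<times>\<^sub>C B))
     (\<lambda>Y. ext D1 D2 T A B X Y) (\<lambda>g. ext_ar D1 D2 T A B (Idn (PD D1 A) X) g)"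

text \<open>
  Writing \<open>Y \<triangleright> -\<close> for the right adjoint of \<open>- \<otimes> Y\<close> and \<open>- \<triangleleft> X\<close> for that of \<open>X \<otimes> -\<close>, the
  canonical maps \<open>u\<^sup>* (Y \<triangleright> Z) \<rightarrow> Y \<triangleright> (u \<times> id)\<^sup>* Z\<close> and \<open>v\<^sup>* (Z \<triangleleft> X) \<rightarrow> (id \<times> v)\<^sup>* Z \<triangleleft> X\<close>
  for \<open>u : A \<rightarrow> A'\<close>, \<open>Z \<in> D3(A' \<times> B)\<close> and for \<open>v : B \<rightarrow> B'\<close>, \<open>Z \<in> D3(A \<times> B')\<close>: the mates
  of the isomorphisms \<open>u\<^sup>* X' \<otimes> Y \<cong> (u \<times> id)\<^sup>* (X' \<otimes> Y)\<close> and \<open>X \<otimes> v\<^sup>* Y' \<cong> (id \<times> v)\<^sup>* (X \<otimes> Y')\<close>.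
\<close>

definition rhom_map1 ::
  "('a, 'o1, 'm1) prederiv \<Rightarrow> ('a, 'o2, 'm2) prederiv \<Rightarrow> ('a, 'o3, 'm3) prederiv \<Rightarrow>
   ('a, 'o1 \<times> 'o2, 'm1 \<times> 'm2, 'o3, 'm3) pnat \<Rightarrow> 'a sftor \<Rightarrow> 'a scat \<Rightarrow> 'o2 \<Rightarrow> 'o3 \<Rightarrow> 'm1" where
  "rhom_map1 D1 D2 D3 T u B Y Z =
     (let F = tens1 D1 D2 D3 T (FDom u) B Y; F' = tens1 D1 D2 D3 T (FCod u) B Y;
          C = PD D1 (FDom u); W = FO (radj F') Z in
      Cmp C (FA (radj F) (FA (PF D3 (u \<times>\<^sub>F idf B)) (NC (radj_counit F') Z)))
        (Cmp C (FA (radj F) (ext_iso D1 D2 D3 T u (idf B) W Y))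
               (NC (radj_unit F) (FO (PF D1 u) W))))"

definition rhom_map2 ::
  "('a, 'o1, 'm1) prederiv \<Rightarrow> ('a, 'o2, 'm2) prederiv \<Rightarrow> ('a, 'o3, 'm3) prederiv \<Rightarrow>
   ('a, 'o1 \<times> 'o2, 'm1 \<times> 'm2, 'o3, 'm3) pnat \<Rightarrow> 'a scat \<Rightarrow> 'a sftor \<Rightarrow> 'o1 \<Rightarrow> 'o3 \<Rightarrow> 'm2" where
  "rhom_map2 D1 D2 D3 T A v X Z =
     (let F = tens2 D1 D2 D3 T A (FDom v) X; F' = tens2 D1 D2 D3 T A (FCod v) X;
          C = PD D2 (FDom v); W = FO (radj F') Z in
      Cmp C (FA (radj F) (FA (PF D3 (idf A \<times>\<^sub>F v)) (NC (radj_counit F') Z)))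
        (Cmp C (FA (radj F) (ext_iso D1 D2 D3 T (idf A) v X W))
               (NC (radj_unit F) (FO (PF D2 v) W))))"

text \<open>
  \<open>T\<close> is part of an adjunction of two variables if the external products have right adjoints
  in each variable and these are again morphisms of derivators, i.e. compatible with restriction
  in the variable they take values in.  (Functoriality in the respective parameter is automatic.)
\<close>

definition two_variable_left_adjoint ::
  "'a code set set \<Rightarrow> ('a, 'o1, 'm1) prederiv \<Rightarrow> ('a, 'o2, 'm2) prederiv \<Rightarrow> ('a, 'o3, 'm3) prederiv \<Rightarrow>
   ('a, 'o1 \<times> 'o2, 'm1 \<times> 'm2, 'o3, 'm3) pnat \<Rightarrow> bool" where
  "two_variable_left_adjoint U D1 D2 D3 T \<longleftrightarrow>
     (\<forall>A\<in>Cat U. \<forall>B\<in>Cat U. \<forall>Y\<in>Ob (PD D2 B). has_right_adjoint (tens1 D1 D2 D3 T A B Y)) \<and>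
     (\<forall>A\<in>Cat U. \<forall>B\<in>Cat U. \<forall>X\<in>Ob (PD D1 A). has_right_adjoint (tens2 D1 D2 D3 T A B X)) \<and>
     (\<forall>A\<in>Cat U. \<forall>A'\<in>Cat U. \<forall>B\<in>Cat U. \<forall>u\<in>Funs A A'.
        \<forall>Y\<in>Ob (PD D2 B). \<forall>Z\<in>Ob (PD D3 (A' \<times>\<^sub>C B)).
          is_iso (PD D1 A) (rhom_map1 D1 D2 D3 T u B Y Z)) \<and>
     (\<forall>A\<in>Cat U. \<forall>B\<in>Cat U. \<forall>B'\<in>Cat U. \<forall>v\<in>Funs B B'.
        \<forall>X\<in>Ob (PD D1 A). \<forall>Z\<in>Ob (PD D3 (A \<times>\<^sub>C B')).
          is_iso (PD D2 B) (rhom_map2 D1 D2 D3 T A v X Z))"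

section \<open>Monoidal derivators and modules\<close>

text \<open>
  For a multiplication \<open>mult : V \<times> V \<rightarrow> V\<close> and an action \<open>act : V \<times> D \<rightarrow> D\<close>, the two morphisms
  \<open>(V \<times> V) \<times> D \<rightarrow> D\<close> sending \<open>((X, Y), W)\<close> to \<open>(X \<otimes> Y) \<otimes> W\<close> and to \<open>X \<otimes> (Y \<otimes> W)\<close>.
\<close>

definition assoc_src ::
  "('a, 'o, 'm) prederiv \<Rightarrow> ('a, 'o \<times> 'o, 'm \<times> 'm, 'o, 'm) pnat \<Rightarrow>
   ('a, 'p, 'n) prederiv \<Rightarrow> ('a, 'o \<times> 'p, 'm \<times> 'n, 'p, 'n) pnat \<Rightarrow>
   ('a, ('o \<times> 'o) \<times> 'p, ('m \<times> 'm) \<times> 'n, 'p, 'n) pnat" where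
  "assoc_src V mult D act = act \<circ>\<^sub>P ppair (mult \<circ>\<^sub>P pfst (V \<times>\<^sub>P V) D) (psnd (V \<times>\<^sub>P V) D)"

definition assoc_tgt ::
  "('a, 'o, 'm) prederiv \<Rightarrow> ('a, 'p, 'n) prederiv \<Rightarrow> ('a, 'o \<times> 'p, 'm \<times> 'n, 'p, 'n) pnat \<Rightarrow>
   ('a, ('o \<times> 'o) \<times> 'p, ('m \<times> 'm) \<times> 'n, 'p, 'n) pnat" where
  "assoc_tgt V D act =
     act \<circ>\<^sub>P ppair (pfst V V \<circ>\<^sub>P pfst (V \<times>\<^sub>P V) D)
                 (act \<circ>\<^sub>P ppair (psnd V V \<circ>\<^sub>P pfst (V \<times>\<^sub>P V) D) (psnd (V \<times>\<^sub>P V) D))"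

definition const_on ::
  "('a, 'p, 'n) prederiv \<Rightarrow> ('a, unit, unit, 'o, 'm) pnat \<Rightarrow> ('a, 'p, 'n, 'o, 'm) pnat" where
  "const_on D S = S \<circ>\<^sub>P pbang D"

text \<open>
  The pentagon and triangle axioms, with \<open>\<alpha>\<close> and \<open>\<rho>\<close> the associator and right unitor of
  \<open>V\<close> and \<open>a\<close> and \<open>l\<close> the associativity and unit constraints of the action; for \<open>D = V\<close> they
  are the axioms of a pseudomonoid.
\<close>

definition pentagon ::
  "'a code set set \<Rightarrow>
   ('a, 'o, 'm) prederiv \<Rightarrow> ('a, 'o \<times> 'o, 'm \<times> 'm, 'o, 'm) pnat \<Rightarrow>
   ('a scat \<Rightarrow> (('o \<times> 'o) \<times> 'o, ('m \<times> 'm) \<times> 'm, 'o, 'm) ntrans) \<Rightarrow>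
   ('a, 'p, 'n) prederiv \<Rightarrow> ('a, 'o \<times> 'p, 'm \<times> 'n, 'p, 'n) pnat \<Rightarrow>
   ('a scat \<Rightarrow> (('o \<times> 'o) \<times> 'p, ('m \<times> 'm) \<times> 'n, 'p, 'n) ntrans) \<Rightarrow> bool" where
  "pentagon U V mult \<alpha> D act a \<longleftrightarrow>
     (\<forall>A\<in>Cat U. \<forall>X\<in>Ob (PD V A). \<forall>Y\<in>Ob (PD V A). \<forall>Z\<in>Ob (PD V A). \<forall>W\<in>Ob (PD D A).
        Cmp (PD D A) (NC (a A) ((X, Y), FO (PC act A) (Z, W)))
                     (NC (a A) ((FO (PC mult A) (X, Y), Z), W)) =
        Cmp (PD D A) (FA (PC act A) (Idn (PD V A) X, NC (a A) ((Y, Z), W)))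
          (Cmp (PD D A) (NC (a A) ((X, FO (PC mult A) (Y, Z)), W))
                        (FA (PC act A) (NC (\<alpha> A) ((X, Y), Z), Idn (PD D A) W))))"

definition triangle ::
  "'a code set set \<Rightarrow> ('a, 'o, 'm) prederiv \<Rightarrow> ('a, unit, unit, 'o, 'm) pnat \<Rightarrow>
   ('a scat \<Rightarrow> ('o, 'm, 'o, 'm) ntrans) \<Rightarrow>
   ('a, 'p, 'n) prederiv \<Rightarrow> ('a, 'o \<times> 'p, 'm \<times> 'n, 'p, 'n) pnat \<Rightarrow>
   ('a scat \<Rightarrow> (('o \<times> 'o) \<times> 'p, ('m \<times> 'm) \<times> 'n, 'p, 'n) ntrans) \<Rightarrow>
   ('a scat \<Rightarrow> ('p, 'n, 'p, 'n) ntrans) \<Rightarrow> bool" where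
  "triangle U V S \<rho> D act a l \<longleftrightarrow>
     (\<forall>A\<in>Cat U. \<forall>X\<in>Ob (PD V A). \<forall>W\<in>Ob (PD D A).
        Cmp (PD D A) (FA (PC act A) (Idn (PD V A) X, NC (l A) W))
                     (NC (a A) ((X, FO (PC S A) ()), W)) =
        FA (PC act A) (NC (\<rho> A) X, Idn (PD D A) W))"

record ('a, 'o, 'm) monoidal =
  MD :: "('a, 'o, 'm) prederiv"
  MMult :: "('a, 'o \<times> 'o, 'm \<times> 'm, 'o, 'm) pnat"
  MUnit :: "('a, unit, unit, 'o, 'm) pnat"
  MAssoc :: "'a scat \<Rightarrow> (('o \<times> 'o) \<times> 'o, ('m \<times> 'm) \<times> 'm, 'o, 'm) ntrans"
  MLeft :: "'a scat \<Rightarrow> ('o, 'm, 'o, 'm) ntrans"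
  MRight :: "'a scat \<Rightarrow> ('o, 'm, 'o, 'm) ntrans"

definition monoidal_derivator :: "'a code set set \<Rightarrow> ('a, 'o, 'm) monoidal \<Rightarrow> bool" where
  "monoidal_derivator U M \<longleftrightarrow>
     (let V = MD M; mult = MMult M; S = MUnit M in
      derivator U V \<and>
      pseudonatural U (V \<times>\<^sub>P V) V mult \<and>
      pseudonatural U punit V S \<and>
      inv_modification U ((V \<times>\<^sub>P V) \<times>\<^sub>P V) V (assoc_src V mult V mult) (assoc_tgt V V mult) (MAssoc M) \<and>
      inv_modification U V V (mult \<circ>\<^sub>P ppair (const_on V S) (pid V)) (pid V) (MLeft M) \<and>
      inv_modification U V V (mult \<circ>\<^sub>P ppair (pid V) (const_on V S)) (pid V) (MRight M) \<and>
      pentagon U V mult (MAssoc M) V mult (MAssoc M) \<and>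
      triangle U V S (MRight M) V mult (MAssoc M) (MLeft M) \<and>
      cocontinuous2 U V V V mult)"

record ('a, 'o, 'm, 'p, 'n) vmodule =
  VD :: "('a, 'p, 'n) prederiv"
  VAct :: "('a, 'o \<times> 'p, 'm \<times> 'n, 'p, 'n) pnat"
  VAssoc :: "'a scat \<Rightarrow> (('o \<times> 'o) \<times> 'p, ('m \<times> 'm) \<times> 'n, 'p, 'n) ntrans"
  VLeft :: "'a scat \<Rightarrow> ('p, 'n, 'p, 'n) ntrans"

definition is_module ::
  "'a code set set \<Rightarrow> ('a, 'o, 'm) monoidal \<Rightarrow> ('a, 'o, 'm, 'p, 'n) vmodule \<Rightarrow> bool" where
  "is_module U M N \<longleftrightarrow>
     (let V = MD M; mult = MMult M; S = MUnit M; D = VD N; act = VAct N in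
      derivator U D \<and>
      pseudonatural U (V \<times>\<^sub>P D) D act \<and>
      inv_modification U ((V \<times>\<^sub>P V) \<times>\<^sub>P D) D (assoc_src V mult D act) (assoc_tgt V D act) (VAssoc N) \<and>
      inv_modification U D D (act \<circ>\<^sub>P ppair (const_on D S) (pid D)) (pid D) (VLeft N) \<and>
      pentagon U V mult (MAssoc M) D act (VAssoc N) \<and>
      triangle U V S (MRight M) D act (VAssoc N) (VLeft N))"

definition cocontinuous_module ::
  "'a code set set \<Rightarrow> ('a, 'o, 'm) monoidal \<Rightarrow> ('a, 'o, 'm, 'p, 'n) vmodule \<Rightarrow> bool" where
  "cocontinuous_module U M N \<longleftrightarrow>
     is_module U M N \<and> cocontinuous2 U (MD M) (VD N) (VD N) (VAct N)"

definition enriched_derivator ::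
  "'a code set set \<Rightarrow> ('a, 'o, 'm) monoidal \<Rightarrow> ('a, 'o, 'm, 'p, 'n) vmodule \<Rightarrow> bool" where
  "enriched_derivator U M N \<longleftrightarrow>
     is_module U M N \<and> two_variable_left_adjoint U (MD M) (VD N) (VD N) (VAct N)"

end

theory Submission
  imports Defs
begin

text \<open>
  A square is exact at \<open>X\<close> iff, for a universal arrow \<open>X \<rightarrow> u\<^sup>* Y\<close>, the composite
  \<open>p\<^sup>* X \<rightarrow> p\<^sup>* u\<^sup>* Y \<rightarrow> v\<^sup>* q\<^sup>* Y\<close> is universal from \<open>p\<^sup>* X\<close> to \<open>v\<^sup>*\<close>; dually in terms of
  right adjoints, and the two conditions are equivalent. Pasting with the comma square of a point
  \<open>m\<close> of \<open>M\<close> tests the first condition, pasting with the comma square of a point \<open>a\<close> of \<open>A\<close> tests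
  the second one. So in every derivator the square is exact iff all the squares with \<open>A\<close> and \<open>M\<close>
  replaced by the terminal category, obtained from it by pasting at \<open>a\<close> and \<open>m\<close>, are exact.
  For such a square only objects \<open>Z\<close> of \<open>\<D>(1)\<close> matter, and \<open>Z \<cong> S \<otimes> Z\<close>. As \<open>- \<otimes> Z\<close> is a
  cocontinuous morphism \<open>\<V> \<rightarrow> \<D>\<close>, exactness at the unit \<open>S\<close> in \<open>\<V>\<close> gives exactness at \<open>Z\<close>.
  In the enriched case cocontinuity of \<open>- \<otimes> Z\<close> is one more instance of the equivalence of the two
  conditions, applied to the square with sides \<open>- \<otimes> Z\<close> and \<open>u\<^sup>*\<close>.
\<close>

section \<open>Universal arrows\<close>

text \<open>Cutting down to points on both sides is forced by the last step: tensoring with an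
  object Z of D(1) reaches only objects of the form X \<otimes> Z. A general object of D(A) is not
  of this form, but over the terminal category every object is, up to isomorphism. The cut at a
  point of M restricts the target of the left mate. At a point of A this device fails, since there A
  is where the argument of the left mate lives; but the right mate takes values in D(A), so it can
  be restricted to that point, and this is what the right Kan extensions are for. The chosen
  adjoints compose only up to isomorphism, so pasting their mates would bring in comparison
  isomorphisms at every step. Universal arrows carry no choice: pasting becomes substitution of one
  universal arrow into the next square, and the chosen adjoints reappear only where
  \<open>exact\<close>, Der4, cocontinuity and the two-variable adjunction are read off.\<close>

lemma ex1_unique: "\<exists>!x. P x \<Longrightarrow> P a \<Longrightarrow> P b \<Longrightarrow> a = b"
  by blast

section \<open>Calculus of arrows with explicit source and target, and inverses\<close>

lemma homI: "f \<in> Ar C \<Longrightarrow> Src C f = x \<Longrightarrow> Tgt C f = y \<Longrightarrow> f \<in> hom C x y"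
  by (simp add: hom_def)

lemma hom_Ar: "f \<in> hom C x y \<Longrightarrow> f \<in> Ar C"
  and hom_Src: "f \<in> hom C x y \<Longrightarrow> Src C f = x"
  by (simp_all add: hom_def)

lemma hom_Ob1: "category C \<Longrightarrow> f \<in> hom C x y \<Longrightarrow> x \<in> Ob C"
  and hom_Ob2: "category C \<Longrightarrow> f \<in> hom C x y \<Longrightarrow> y \<in> Ob C"
  by (auto simp: category_def hom_def)

lemma Cmp_hom: "category C \<Longrightarrow> f \<in> hom C x y \<Longrightarrow> g \<in> hom C y z \<Longrightarrow> Cmp C g f \<in> hom C x z"
  by (auto simp: category_def hom_def composable_def)

lemma Cmp_assoc:
  "category C \<Longrightarrow> f \<in> hom C x y \<Longrightarrow> g \<in> hom C y z \<Longrightarrow> h \<in> hom C z w \<Longrightarrow>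
    Cmp C (Cmp C h g) f = Cmp C h (Cmp C g f)"
  by (auto simp: category_def hom_def composable_def)

lemma Idn_hom: "category C \<Longrightarrow> x \<in> Ob C \<Longrightarrow> Idn C x \<in> hom C x x"
  by (auto simp: category_def hom_def)

lemma Cmp_Idn: "category C \<Longrightarrow> f \<in> hom C x y \<Longrightarrow> Cmp C f (Idn C x) = f"
  and Idn_Cmp: "category C \<Longrightarrow> f \<in> hom C x y \<Longrightarrow> Cmp C (Idn C y) f = f"
  by (auto simp: category_def hom_def)

lemma FO_Ob: "F \<in> Funs C D \<Longrightarrow> x \<in> Ob C \<Longrightarrow> FO F x \<in> Ob D"
  by (auto simp: Funs_def)

lemma FA_hom: "F \<in> Funs C D \<Longrightarrow> f \<in> hom C x y \<Longrightarrow> FA F f \<in> hom D (FO F x) (FO F y)"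
  by (auto simp: Funs_def hom_def)

lemma FA_Cmp:
  "F \<in> Funs C D \<Longrightarrow> f \<in> hom C x y \<Longrightarrow> g \<in> hom C y z \<Longrightarrow>
    FA F (Cmp C g f) = Cmp D (FA F g) (FA F f)"
  by (auto simp: Funs_def hom_def composable_def)

lemma FA_Idn: "F \<in> Funs C D \<Longrightarrow> x \<in> Ob C \<Longrightarrow> FA F (Idn C x) = Idn D (FO F x)"
  by (auto simp: Funs_def)

lemma Funs_FDom: "F \<in> Funs C D \<Longrightarrow> FDom F = C"
  and Funs_FCod: "F \<in> Funs C D \<Longrightarrow> FCod F = D"
  by (auto simp: Funs_def)

lemma NC_hom: "\<alpha> \<in> Ntrs F G \<Longrightarrow> F \<in> Funs C D \<Longrightarrow> x \<in> Ob C \<Longrightarrow> NC \<alpha> x \<in> hom D (FO F x) (FO G x)"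
  by (auto simp: Ntrs_def Funs_def)

lemma NC_nat:
  "\<alpha> \<in> Ntrs F G \<Longrightarrow> F \<in> Funs C D \<Longrightarrow> f \<in> hom C x y \<Longrightarrow>
    Cmp D (NC \<alpha> y) (FA F f) = Cmp D (FA G f) (NC \<alpha> x)"
  by (auto simp: Ntrs_def Funs_def hom_def)

lemma is_isoI:
  "f \<in> hom C x y \<Longrightarrow> g \<in> hom C y x \<Longrightarrow> Cmp C g f = Idn C x \<Longrightarrow> Cmp C f g = Idn C y \<Longrightarrow> is_iso C f"
  by (auto simp: is_iso_def is_inverse_def hom_def)

lemma is_inverse_unique:
  assumes C: "category C" and "is_inverse C f g" and "is_inverse C f h"
  shows "g = h"
proof -
  let ?x = "Src C f" and ?y = "Tgt C f"
  have f: "f \<in> hom C ?x ?y" and g: "g \<in> hom C ?y ?x" and h: "h \<in> hom C ?y ?x"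
    and e: "Cmp C g f = Idn C ?x" "Cmp C f h = Idn C ?y"
    using assms by (auto simp: is_inverse_def hom_def)
  have "g = Cmp C g (Cmp C f h)" using Cmp_Idn[OF C g] e by simp
  also have "\<dots> = Cmp C (Cmp C g f) h" using Cmp_assoc[OF C h f g] by simp
  also have "\<dots> = h" using Idn_Cmp[OF C h] e by simp
  finally show ?thesis .
qed

lemma inv_ar:
  assumes "category C" and "is_iso C f" and "f \<in> hom C x y"
  shows inv_ar_hom: "inv_ar C f \<in> hom C y x"
    and inv_ar_left: "Cmp C (inv_ar C f) f = Idn C x"
    and inv_ar_right: "Cmp C f (inv_ar C f) = Idn C y"
proof -
  obtain g where g: "is_inverse C f g" using assms(2) by (auto simp: is_iso_def)
  then have "inv_ar C f = g"
    unfolding inv_ar_def using is_inverse_unique[OF assms(1)] by blast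
  then have "is_inverse C f (inv_ar C f)" using g by simp
  then show "inv_ar C f \<in> hom C y x" "Cmp C (inv_ar C f) f = Idn C x"
    "Cmp C f (inv_ar C f) = Idn C y"
    using assms(3) by (auto simp: is_inverse_def hom_def)
qed

lemma is_iso_inv_ar:
  "category C \<Longrightarrow> is_iso C f \<Longrightarrow> f \<in> hom C x y \<Longrightarrow> is_iso C (inv_ar C f)"
  by (rule is_isoI[OF inv_ar_hom _ inv_ar_right inv_ar_left])

lemma is_iso_FA:
  assumes "category C" "F \<in> Funs C D" "f \<in> hom C x y" "is_iso C f"
  shows "is_iso D (FA F f)"
proof -
  note g = inv_ar[OF assms(1,4,3)]
  have x: "x \<in> Ob C" "y \<in> Ob C" using hom_Ob1[OF assms(1,3)] hom_Ob2[OF assms(1,3)] .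
  show ?thesis
    by (rule is_isoI[OF FA_hom[OF assms(2,3)] FA_hom[OF assms(2) g(1)]])
      (simp_all add: FA_Cmp[OF assms(2), symmetric, OF assms(3) g(1)] FA_Cmp[OF assms(2), symmetric, OF g(1) assms(3)]
        g FA_Idn[OF assms(2)] x)
qed

lemma Cmp_inv_cancel:
  assumes "category C" and "is_iso C k" and "k \<in> hom C y z" and "f \<in> hom C x y"
  shows "Cmp C (inv_ar C k) (Cmp C k f) = f"
  using Cmp_assoc[OF assms(1,4,3) inv_ar_hom[OF assms(1-3)]] inv_ar_left[OF assms(1-3)]
    Idn_Cmp[OF assms(1,4)] by simp

lemma Cmp_inv_cancel':
  assumes "category C" and "is_iso C k" and "k \<in> hom C y z" and "f \<in> hom C x z"
  shows "Cmp C k (Cmp C (inv_ar C k) f) = f"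
  using Cmp_assoc[OF assms(1,4) inv_ar_hom[OF assms(1-3)] assms(3)] inv_ar_right[OF assms(1-3)]
    Idn_Cmp[OF assms(1,4)] by simp

text \<open>Cutting the raw operations down to \<open>Ob C\<close> and \<open>Ar C\<close> changes
  no value that the functor laws look at, because sources, targets, identities and composites stay
  inside the category.\<close>

lemma mk_ftor_Funs:
  assumes "category C"
    and "\<And>x. x \<in> Ob C \<Longrightarrow> fo x \<in> Ob D"
    and "\<And>f x y. f \<in> hom C x y \<Longrightarrow> fa f \<in> hom D (fo x) (fo y)"
    and "\<And>x. x \<in> Ob C \<Longrightarrow> fa (Idn C x) = Idn D (fo x)"
    and "\<And>f g x y z. f \<in> hom C x y \<Longrightarrow> g \<in> hom C y z \<Longrightarrow> fa (Cmp C g f) = Cmp D (fa g) (fa f)"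
  shows "mk_ftor C D fo fa \<in> Funs C D"
proof -
  have ar: "fa f \<in> Ar D" "Src D (fa f) = fo (Src C f)" "Tgt D (fa f) = fo (Tgt C f)"
    "Src C f \<in> Ob C" "Tgt C f \<in> Ob C" if "f \<in> Ar C" for f
    using assms(3)[OF homI[OF that refl refl]] hom_Ob1[OF assms(1) homI[OF that refl refl]]
      hom_Ob2[OF assms(1) homI[OF that refl refl]] by (auto simp: hom_def)
  have idn: "Idn C x \<in> Ar C" if "x \<in> Ob C" for x
    using Idn_hom[OF assms(1) that] hom_Ar by fast
  have cmp: "Cmp C g f \<in> Ar C" "f \<in> Ar C" "g \<in> Ar C" "fa (Cmp C g f) = Cmp D (fa g) (fa f)"
    if "composable C g f" for g f
  proof -
    have fg: "f \<in> hom C (Src C f) (Tgt C f)" "g \<in> hom C (Tgt C f) (Tgt C g)"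
      using that by (auto simp: composable_def hom_def)
    show "Cmp C g f \<in> Ar C" "f \<in> Ar C" "g \<in> Ar C" "fa (Cmp C g f) = Cmp D (fa g) (fa f)"
      using Cmp_hom[OF assms(1) fg] fg assms(5)[OF fg] hom_Ar by fast+
  qed
  show ?thesis
    unfolding Funs_def mk_ftor_def using ar idn cmp assms(2,4) by simp
qed

lemma idf_Funs: "category C \<Longrightarrow> idf C \<in> Funs C C"
  unfolding idf_def by (rule mk_ftor_Funs) simp_all

lemma FO_idf: "x \<in> Ob C \<Longrightarrow> FO (idf C) x = x"
  and FA_idf: "f \<in> Ar C \<Longrightarrow> FA (idf C) f = f"
  by (simp_all add: idf_def mk_ftor_def)

lemma fcomp_Funs: "F \<in> Funs C D \<Longrightarrow> G \<in> Funs D E \<Longrightarrow> category C \<Longrightarrow> G \<circ>\<^sub>F F \<in> Funs C E"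
  unfolding fcomp_def Funs_FDom Funs_FCod
  by (rule mk_ftor_Funs) (simp_all add: FO_Ob FA_Idn FA_hom FA_Cmp[OF _ FA_hom FA_hom] FA_Cmp)

lemma FO_fcomp: "F \<in> Funs C D \<Longrightarrow> x \<in> Ob C \<Longrightarrow> FO (G \<circ>\<^sub>F F) x = FO G (FO F x)"
  and FA_fcomp: "F \<in> Funs C D \<Longrightarrow> f \<in> Ar C \<Longrightarrow> FA (G \<circ>\<^sub>F F) f = FA G (FA F f)"
  by (auto simp: fcomp_def mk_ftor_def Funs_def)

text \<open>An initial object of the comma category of \<open>x\<close> and \<open>G\<close>. A left
  adjoint of \<open>G\<close> amounts to a choice of one for every \<open>x\<close>.\<close>

definition universal :: "('o2, 'm2, 'o1, 'm1) ftor \<Rightarrow> 'o1 \<Rightarrow> 'o2 \<Rightarrow> 'm1 \<Rightarrow> bool" where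
  "universal G x y e \<longleftrightarrow>
     y \<in> Ob (FDom G) \<and> e \<in> hom (FCod G) x (FO G y) \<and>
     (\<forall>y'\<in>Ob (FDom G). \<forall>f\<in>hom (FCod G) x (FO G y').
        \<exists>!h. h \<in> hom (FDom G) y y' \<and> Cmp (FCod G) (FA G h) e = f)"

definition couniversal :: "('o1, 'm1, 'o2, 'm2) ftor \<Rightarrow> 'o2 \<Rightarrow> 'o1 \<Rightarrow> 'm2 \<Rightarrow> bool" where
  "couniversal F x y e \<longleftrightarrow>
     y \<in> Ob (FDom F) \<and> e \<in> hom (FCod F) (FO F y) x \<and>
     (\<forall>y'\<in>Ob (FDom F). \<forall>f\<in>hom (FCod F) (FO F y') x.
        \<exists>!h. h \<in> hom (FDom F) y' y \<and> Cmp (FCod F) e (FA F h) = f)"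

locale functor_between =
  fixes C :: "('o1, 'm1) cat" and D :: "('o2, 'm2) cat" and G :: "('o1, 'm1, 'o2, 'm2) ftor"
  assumes C: "category C" and D: "category D" and G: "G \<in> Funs C D"
begin

lemmas FDom = Funs_FDom[OF G] and FCod = Funs_FCod[OF G]

lemma universalI:
  assumes "y \<in> Ob C" "e \<in> hom D x (FO G y)"
    and "\<And>y' f. y' \<in> Ob C \<Longrightarrow> f \<in> hom D x (FO G y') \<Longrightarrow> \<exists>h\<in>hom C y y'. Cmp D (FA G h) e = f"
    and "\<And>y' h k. h \<in> hom C y y' \<Longrightarrow> k \<in> hom C y y' \<Longrightarrow> Cmp D (FA G h) e = Cmp D (FA G k) e \<Longrightarrow> h = k"
  shows "universal G x y e"
  unfolding universal_def FDom FCod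
proof (intro conjI ballI)
  fix y' f assume "y' \<in> Ob C" "f \<in> hom D x (FO G y')"
  then obtain h where "h \<in> hom C y y'" "Cmp D (FA G h) e = f" using assms(3) by blast
  then show "\<exists>!h. h \<in> hom C y y' \<and> Cmp D (FA G h) e = f"
    by (intro ex1I[of _ h], simp) (rule assms(4), auto)
qed (rule assms)+

lemma universal_Ob: "universal G x y e \<Longrightarrow> y \<in> Ob C"
  and universal_hom: "universal G x y e \<Longrightarrow> e \<in> hom D x (FO G y)"
  by (simp_all add: universal_def FDom FCod)

lemma universal_dom: "universal G x y e \<Longrightarrow> x \<in> Ob D"
  using universal_hom hom_Ob1[OF D] by blast

lemma universal_ex:
  assumes "universal G x y e" "y' \<in> Ob C" "f \<in> hom D x (FO G y')"
  obtains h where "h \<in> hom C y y'" "Cmp D (FA G h) e = f"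
proof -
  have "\<exists>!h. h \<in> hom C y y' \<and> Cmp D (FA G h) e = f"
    using assms by (simp add: universal_def FDom FCod)
  then show thesis using that by blast
qed

lemma universal_eq:
  assumes e: "universal G x y e" and h: "h \<in> hom C y y'" and k: "k \<in> hom C y y'"
    and eq: "Cmp D (FA G h) e = Cmp D (FA G k) e"
  shows "h = k"
proof -
  have "y' \<in> Ob C" using hom_Ob2[OF C h] .
  moreover have "Cmp D (FA G h) e \<in> hom D x (FO G y')"
    using Cmp_hom[OF D universal_hom[OF e] FA_hom[OF G h]] .
  ultimately have "\<exists>!l. l \<in> hom C y y' \<and> Cmp D (FA G l) e = Cmp D (FA G h) e"
    using e by (simp add: universal_def FDom FCod)
  then show ?thesis by (rule ex1_unique) (use h k eq in simp_all)
qed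

text \<open>Initial objects are isomorphic: factoring \<open>e\<close> through \<open>e'\<close>
  gives the inverse, because both composites agree with identities after a universal arrow.\<close>

lemma universal_iso:
  assumes e: "universal G x y e" and e': "universal G x y' e'"
    and h: "h \<in> hom C y y'" and eq: "Cmp D (FA G h) e = e'"
  shows "is_iso C h"
proof -
  note y = universal_Ob[OF e] and y' = universal_Ob[OF e']
    and E = universal_hom[OF e] and E' = universal_hom[OF e']
  obtain k where k: "k \<in> hom C y' y" and keq: "Cmp D (FA G k) e' = e"
    using universal_ex[OF e' y E] .
  have "Cmp D (FA G (Cmp C k h)) e = Cmp D (FA G (Idn C y)) e"
    using FA_Cmp[OF G h k] Cmp_assoc[OF D E FA_hom[OF G h] FA_hom[OF G k]] eq keq
      FA_Idn[OF G y] Idn_Cmp[OF D E] by simp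
  then have 1: "Cmp C k h = Idn C y"
    by (rule universal_eq[OF e Cmp_hom[OF C h k] Idn_hom[OF C y]])
  have "Cmp D (FA G (Cmp C h k)) e' = Cmp D (FA G (Idn C y')) e'"
    using FA_Cmp[OF G k h] Cmp_assoc[OF D E' FA_hom[OF G k] FA_hom[OF G h]] eq keq
      FA_Idn[OF G y'] Idn_Cmp[OF D E'] by simp
  then have 2: "Cmp C h k = Idn C y'"
    by (rule universal_eq[OF e' Cmp_hom[OF C k h] Idn_hom[OF C y']])
  show ?thesis by (rule is_isoI[OF h k 1 2])
qed

text \<open>The converse of \<open>universal_iso\<close>. Together they make invertibility of a
  comparison arrow \<open>h\<close> equivalent to universality of the arrow it produces from
  \<open>e\<close>, which is how every mate below is handled.\<close>

lemma universal_post_iso: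
  assumes e: "universal G x y e" and h: "h \<in> hom C y y'" and iso: "is_iso C h"
  shows "universal G x y' (Cmp D (FA G h) e)"
proof (rule universalI)
  note E = universal_hom[OF e] and Gh = FA_hom[OF G h] and i = inv_ar[OF C iso h]
  show "y' \<in> Ob C" using hom_Ob2[OF C h] .
  show "Cmp D (FA G h) e \<in> hom D x (FO G y')" using Cmp_hom[OF D E Gh] .
  show "\<exists>k\<in>hom C y' z. Cmp D (FA G k) (Cmp D (FA G h) e) = f"
    if z: "z \<in> Ob C" and f: "f \<in> hom D x (FO G z)" for z f
  proof -
    obtain k where k: "k \<in> hom C y z" and keq: "Cmp D (FA G k) e = f"
      using universal_ex[OF e z f] .
    have k': "Cmp C k (inv_ar C h) \<in> hom C y' z" using Cmp_hom[OF C i(1) k] .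
    have "Cmp D (FA G (Cmp C k (inv_ar C h))) (Cmp D (FA G h) e) =
        Cmp D (FA G (Cmp C (Cmp C k (inv_ar C h)) h)) e"
      using Cmp_assoc[OF D E Gh FA_hom[OF G k']] FA_Cmp[OF G h k'] by simp
    also have "Cmp C (Cmp C k (inv_ar C h)) h = k"
      using Cmp_assoc[OF C h i(1) k] i(2) Cmp_Idn[OF C k] by simp
    finally show ?thesis using k' keq by blast
  qed
  show "k = l" if k: "k \<in> hom C y' z" and l: "l \<in> hom C y' z"
    and eq: "Cmp D (FA G k) (Cmp D (FA G h) e) = Cmp D (FA G l) (Cmp D (FA G h) e)" for z k l
  proof -
    have "Cmp D (FA G (Cmp C k h)) e = Cmp D (FA G (Cmp C l h)) e"
      using eq Cmp_assoc[OF D E Gh FA_hom[OF G k]] Cmp_assoc[OF D E Gh FA_hom[OF G l]]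
        FA_Cmp[OF G h k] FA_Cmp[OF G h l] by simp
    then have "Cmp C k h = Cmp C l h"
      by (rule universal_eq[OF e Cmp_hom[OF C h k] Cmp_hom[OF C h l]])
    then have "Cmp C (Cmp C k h) (inv_ar C h) = Cmp C (Cmp C l h) (inv_ar C h)" by simp
    then show ?thesis
      using Cmp_assoc[OF C i(1) h k] Cmp_assoc[OF C i(1) h l] i(3) Cmp_Idn[OF C k] Cmp_Idn[OF C l]
      by simp
  qed
qed

text \<open>Composition with \<open>k\<close> is a bijection from the arrows out of \<open>x\<close>
  to those out of \<open>x'\<close>, and it commutes with composition on the other side.\<close>

lemma universal_pre_iso:
  assumes e: "universal G x y e" and k: "k \<in> hom D x' x" and iso: "is_iso D k"
  shows "universal G x' y (Cmp D e k)"
proof (rule universalI)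
  note E = universal_hom[OF e] and i = inv_ar[OF D iso k]
  show "y \<in> Ob C" using universal_Ob[OF e] .
  show "Cmp D e k \<in> hom D x' (FO G y)" using Cmp_hom[OF D k E] .
  show "\<exists>h\<in>hom C y z. Cmp D (FA G h) (Cmp D e k) = f"
    if z: "z \<in> Ob C" and f: "f \<in> hom D x' (FO G z)" for z f
  proof -
    obtain h where h: "h \<in> hom C y z" and eq: "Cmp D (FA G h) e = Cmp D f (inv_ar D k)"
      using universal_ex[OF e z Cmp_hom[OF D i(1) f]] .
    have "Cmp D (FA G h) (Cmp D e k) = Cmp D (Cmp D f (inv_ar D k)) k"
      using Cmp_assoc[OF D k E FA_hom[OF G h]] eq by simp
    also have "\<dots> = f" using Cmp_assoc[OF D k i(1) f] i(2) Cmp_Idn[OF D f] by simp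
    finally show ?thesis using h by blast
  qed
  show "h = l" if h: "h \<in> hom C y z" and l: "l \<in> hom C y z"
    and eq: "Cmp D (FA G h) (Cmp D e k) = Cmp D (FA G l) (Cmp D e k)" for z h l
  proof -
    note Gh = FA_hom[OF G h] and Gl = FA_hom[OF G l]
    have "Cmp D (Cmp D (Cmp D (FA G h) e) k) (inv_ar D k) = Cmp D (Cmp D (Cmp D (FA G l) e) k) (inv_ar D k)"
      using eq Cmp_assoc[OF D k E Gh] Cmp_assoc[OF D k E Gl] by simp
    then have "Cmp D (FA G h) e = Cmp D (FA G l) e"
      using Cmp_assoc[OF D i(1) k Cmp_hom[OF D E Gh]] Cmp_assoc[OF D i(1) k Cmp_hom[OF D E Gl]] i(3)
        Cmp_Idn[OF D Cmp_hom[OF D E Gh]] Cmp_Idn[OF D Cmp_hom[OF D E Gl]] by simp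
    then show ?thesis by (rule universal_eq[OF e h l])
  qed
qed

section \<open>Couniversal arrows, the dual notion\<close>

lemma couniversalI:
  assumes "y \<in> Ob C" "e \<in> hom D (FO G y) x"
    and "\<And>y' f. y' \<in> Ob C \<Longrightarrow> f \<in> hom D (FO G y') x \<Longrightarrow> \<exists>h\<in>hom C y' y. Cmp D e (FA G h) = f"
    and "\<And>y' h k. h \<in> hom C y' y \<Longrightarrow> k \<in> hom C y' y \<Longrightarrow> Cmp D e (FA G h) = Cmp D e (FA G k) \<Longrightarrow> h = k"
  shows "couniversal G x y e"
  unfolding couniversal_def FDom FCod
proof (intro conjI ballI)
  fix y' f assume "y' \<in> Ob C" "f \<in> hom D (FO G y') x"
  then obtain h where "h \<in> hom C y' y" "Cmp D e (FA G h) = f" using assms(3) by blast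
  then show "\<exists>!h. h \<in> hom C y' y \<and> Cmp D e (FA G h) = f"
    by (intro ex1I[of _ h], simp) (rule assms(4), auto)
qed (rule assms)+

lemma couniversal_Ob: "couniversal G x y e \<Longrightarrow> y \<in> Ob C"
  and couniversal_hom: "couniversal G x y e \<Longrightarrow> e \<in> hom D (FO G y) x"
  by (simp_all add: couniversal_def FDom FCod)

lemma couniversal_cod: "couniversal G x y e \<Longrightarrow> x \<in> Ob D"
  using couniversal_hom hom_Ob2[OF D] by blast

lemma couniversal_ex:
  assumes "couniversal G x y e" "y' \<in> Ob C" "f \<in> hom D (FO G y') x"
  obtains h where "h \<in> hom C y' y" "Cmp D e (FA G h) = f"
proof -
  have "\<exists>!h. h \<in> hom C y' y \<and> Cmp D e (FA G h) = f"
    using assms by (simp add: couniversal_def FDom FCod)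
  then show thesis using that by blast
qed

lemma couniversal_eq:
  assumes e: "couniversal G x y e" and h: "h \<in> hom C y' y" and k: "k \<in> hom C y' y"
    and eq: "Cmp D e (FA G h) = Cmp D e (FA G k)"
  shows "h = k"
proof -
  have "y' \<in> Ob C" using hom_Ob1[OF C h] .
  moreover have "Cmp D e (FA G h) \<in> hom D (FO G y') x"
    using Cmp_hom[OF D FA_hom[OF G h] couniversal_hom[OF e]] .
  ultimately have "\<exists>!l. l \<in> hom C y' y \<and> Cmp D e (FA G l) = Cmp D e (FA G h)"
    using e by (simp add: couniversal_def FDom FCod)
  then show ?thesis by (rule ex1_unique) (use h k eq in simp_all)
qed

lemma couniversal_iso:
  assumes e: "couniversal G x y e" and e': "couniversal G x y' e'"
    and h: "h \<in> hom C y' y" and eq: "Cmp D e (FA G h) = e'"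
  shows "is_iso C h"
proof -
  note y = couniversal_Ob[OF e] and y' = couniversal_Ob[OF e']
    and E = couniversal_hom[OF e] and E' = couniversal_hom[OF e']
  obtain k where k: "k \<in> hom C y y'" and keq: "Cmp D e' (FA G k) = e"
    using couniversal_ex[OF e' y E] .
  have "Cmp D e (FA G (Cmp C h k)) = Cmp D e (FA G (Idn C y))"
    using FA_Cmp[OF G k h] Cmp_assoc[OF D FA_hom[OF G k] FA_hom[OF G h] E] eq keq
      FA_Idn[OF G y] Cmp_Idn[OF D E] by simp
  then have 1: "Cmp C h k = Idn C y"
    by (rule couniversal_eq[OF e Cmp_hom[OF C k h] Idn_hom[OF C y]])
  have "Cmp D e' (FA G (Cmp C k h)) = Cmp D e' (FA G (Idn C y'))"
    using FA_Cmp[OF G h k] Cmp_assoc[OF D FA_hom[OF G h] FA_hom[OF G k] E'] eq keq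
      FA_Idn[OF G y'] Cmp_Idn[OF D E'] by simp
  then have 2: "Cmp C k h = Idn C y'"
    by (rule couniversal_eq[OF e' Cmp_hom[OF C h k] Idn_hom[OF C y']])
  show ?thesis by (rule is_isoI[OF h k 2 1])
qed

lemma couniversal_pre_iso:
  assumes e: "couniversal G x y e" and h: "h \<in> hom C y' y" and iso: "is_iso C h"
  shows "couniversal G x y' (Cmp D e (FA G h))"
proof (rule couniversalI)
  note E = couniversal_hom[OF e] and Gh = FA_hom[OF G h] and i = inv_ar[OF C iso h]
  show "y' \<in> Ob C" using hom_Ob1[OF C h] .
  show "Cmp D e (FA G h) \<in> hom D (FO G y') x" using Cmp_hom[OF D Gh E] .
  show "\<exists>k\<in>hom C z y'. Cmp D (Cmp D e (FA G h)) (FA G k) = f"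
    if z: "z \<in> Ob C" and f: "f \<in> hom D (FO G z) x" for z f
  proof -
    obtain k where k: "k \<in> hom C z y" and keq: "Cmp D e (FA G k) = f"
      using couniversal_ex[OF e z f] .
    have k': "Cmp C (inv_ar C h) k \<in> hom C z y'" using Cmp_hom[OF C k i(1)] .
    have "Cmp D (Cmp D e (FA G h)) (FA G (Cmp C (inv_ar C h) k)) =
        Cmp D e (FA G (Cmp C h (Cmp C (inv_ar C h) k)))"
      using Cmp_assoc[OF D FA_hom[OF G k'] Gh E] FA_Cmp[OF G k' h] by simp
    also have "Cmp C h (Cmp C (inv_ar C h) k) = k"
      using Cmp_inv_cancel'[OF C iso h k] .
    finally show ?thesis using k' keq by blast
  qed
  show "k = l" if k: "k \<in> hom C z y'" and l: "l \<in> hom C z y'"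
    and eq: "Cmp D (Cmp D e (FA G h)) (FA G k) = Cmp D (Cmp D e (FA G h)) (FA G l)" for z k l
  proof -
    have "Cmp D e (FA G (Cmp C h k)) = Cmp D e (FA G (Cmp C h l))"
      using eq Cmp_assoc[OF D FA_hom[OF G k] Gh E] Cmp_assoc[OF D FA_hom[OF G l] Gh E]
        FA_Cmp[OF G k h] FA_Cmp[OF G l h] by simp
    then have "Cmp C h k = Cmp C h l"
      by (rule couniversal_eq[OF e Cmp_hom[OF C k h] Cmp_hom[OF C l h]])
    then show ?thesis using Cmp_inv_cancel[OF C iso h k] Cmp_inv_cancel[OF C iso h l] by metis
  qed
qed

end

section \<open>Adjunctions as families of universal and couniversal arrows\<close>

locale adjoint_functors =
  fixes C :: "('o1, 'm1) cat" and D :: "('o2, 'm2) cat"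
    and F :: "('o1, 'm1, 'o2, 'm2) ftor" and G :: "('o2, 'm2, 'o1, 'm1) ftor" and \<eta> \<epsilon>
  assumes C: "category C" and D: "category D" and F: "F \<in> Funs C D" and G: "G \<in> Funs D C"
    and adj: "adjunction F G \<eta> \<epsilon>"
begin

sublocale F: functor_between C D F by unfold_locales (rule C D F)+
sublocale G: functor_between D C G by unfold_locales (rule C D G)+

lemma unit: "x \<in> Ob C \<Longrightarrow> NC \<eta> x \<in> hom C x (FO G (FO F x))"
  using adj NC_hom[OF _ idf_Funs[OF C], of \<eta> "G \<circ>\<^sub>F F" x]
  by (simp add: adjunction_def F.FDom F.FCod FO_idf FO_fcomp[OF F])

lemma counit: "y \<in> Ob D \<Longrightarrow> NC \<epsilon> y \<in> hom D (FO F (FO G y)) y"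
  using adj NC_hom[OF _ fcomp_Funs[OF G F D], of \<epsilon> "idf D" y]
  by (simp add: adjunction_def F.FDom F.FCod FO_idf FO_fcomp[OF G])

lemma unit_nat: "f \<in> hom C x y \<Longrightarrow> Cmp C (NC \<eta> y) f = Cmp C (FA G (FA F f)) (NC \<eta> x)"
  using adj NC_nat[OF _ idf_Funs[OF C], of \<eta> "G \<circ>\<^sub>F F" f x y]
  by (simp add: adjunction_def F.FDom F.FCod FA_idf FA_fcomp[OF F] hom_Ar)

lemma counit_nat: "f \<in> hom D x y \<Longrightarrow> Cmp D (NC \<epsilon> y) (FA F (FA G f)) = Cmp D f (NC \<epsilon> x)"
  using adj NC_nat[OF _ fcomp_Funs[OF G F D], of \<epsilon> "idf D" f x y]
  by (simp add: adjunction_def F.FDom F.FCod FA_idf FA_fcomp[OF G] hom_Ar)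

lemma triangle_F: "x \<in> Ob C \<Longrightarrow> Cmp D (NC \<epsilon> (FO F x)) (FA F (NC \<eta> x)) = Idn D (FO F x)"
  and triangle_G: "y \<in> Ob D \<Longrightarrow> Cmp C (FA G (NC \<epsilon> y)) (NC \<eta> (FO G y)) = Idn C (FO G y)"
  using adj by (simp_all add: adjunction_def F.FDom F.FCod)

text \<open>Half of the bijection between arrows \<open>F x\<close> to \<open>y\<close> and arrows
  \<open>x\<close> to \<open>G y\<close>: naturality of the unit moves \<open>f\<close> to the
  outside, and a triangle identity removes the rest.\<close>

lemma transpose_left:
  assumes y: "y \<in> Ob D" and f: "f \<in> hom C x (FO G y)"
  shows "Cmp C (FA G (Cmp D (NC \<epsilon> y) (FA F f))) (NC \<eta> x) = f"
proof -
  have x: "x \<in> Ob C" using hom_Ob1[OF C f] .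
  have Ff: "FA F f \<in> hom D (FO F x) (FO F (FO G y))" using FA_hom[OF F f] .
  have "Cmp C (FA G (Cmp D (NC \<epsilon> y) (FA F f))) (NC \<eta> x) =
      Cmp C (FA G (NC \<epsilon> y)) (Cmp C (FA G (FA F f)) (NC \<eta> x))"
    using FA_Cmp[OF G Ff counit[OF y]]
      Cmp_assoc[OF C unit[OF x] FA_hom[OF G Ff] FA_hom[OF G counit[OF y]]] by simp
  also have "\<dots> = Cmp C (Cmp C (FA G (NC \<epsilon> y)) (NC \<eta> (FO G y))) f"
    using unit_nat[OF f] Cmp_assoc[OF C f unit FA_hom[OF G counit[OF y]]] FO_Ob[OF G y] by simp
  also have "\<dots> = f" using triangle_G[OF y] Idn_Cmp[OF C f] by simp
  finally show ?thesis .
qed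

lemma transpose_right:
  assumes x: "x \<in> Ob C" and g: "g \<in> hom D (FO F x) y"
  shows "Cmp D (NC \<epsilon> y) (FA F (Cmp C (FA G g) (NC \<eta> x))) = g"
proof -
  have y: "y \<in> Ob D" using hom_Ob2[OF D g] .
  have Gg: "FA G g \<in> hom C (FO G (FO F x)) (FO G y)" using FA_hom[OF G g] .
  have "Cmp D (NC \<epsilon> y) (FA F (Cmp C (FA G g) (NC \<eta> x))) =
      Cmp D (Cmp D (NC \<epsilon> y) (FA F (FA G g))) (FA F (NC \<eta> x))"
    using FA_Cmp[OF F unit[OF x] Gg]
      Cmp_assoc[OF D FA_hom[OF F unit[OF x]] FA_hom[OF F Gg] counit[OF y]] by simp
  also have "\<dots> = Cmp D g (Cmp D (NC \<epsilon> (FO F x)) (FA F (NC \<eta> x)))"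
    using counit_nat[OF g] Cmp_assoc[OF D FA_hom[OF F unit[OF x]] counit g] FO_Ob[OF F x] by simp
  also have "\<dots> = g" using triangle_F[OF x] Cmp_Idn[OF D g] by simp
  finally show ?thesis .
qed

lemma unit_universal: "x \<in> Ob C \<Longrightarrow> universal G x (FO F x) (NC \<eta> x)"
proof (rule G.universalI)
  assume x: "x \<in> Ob C"
  show "FO F x \<in> Ob D" "NC \<eta> x \<in> hom C x (FO G (FO F x))" using FO_Ob[OF F x] unit[OF x] .
  show "\<exists>h\<in>hom D (FO F x) y. Cmp C (FA G h) (NC \<eta> x) = f"
    if "y \<in> Ob D" "f \<in> hom C x (FO G y)" for y f
    using transpose_left[OF that] Cmp_hom[OF D FA_hom[OF F that(2)] counit[OF that(1)]] by blast
  show "h = k" if "h \<in> hom D (FO F x) y" "k \<in> hom D (FO F x) y"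
    "Cmp C (FA G h) (NC \<eta> x) = Cmp C (FA G k) (NC \<eta> x)" for y h k
    using transpose_right[OF x that(1)] transpose_right[OF x that(2)] that(3) by metis
qed

lemma counit_couniversal: "y \<in> Ob D \<Longrightarrow> couniversal F y (FO G y) (NC \<epsilon> y)"
proof (rule F.couniversalI)
  assume y: "y \<in> Ob D"
  show "FO G y \<in> Ob C" "NC \<epsilon> y \<in> hom D (FO F (FO G y)) y" using FO_Ob[OF G y] counit[OF y] .
  show "\<exists>h\<in>hom C x (FO G y). Cmp D (NC \<epsilon> y) (FA F h) = f"
    if "x \<in> Ob C" "f \<in> hom D (FO F x) y" for x f
    using transpose_right[OF that] Cmp_hom[OF C unit[OF that(1)] FA_hom[OF G that(2)]] by blast
  show "h = k" if "h \<in> hom C x (FO G y)" "k \<in> hom C x (FO G y)"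
    "Cmp D (NC \<epsilon> y) (FA F h) = Cmp D (NC \<epsilon> y) (FA F k)" for x h k
    using transpose_left[OF y that(1)] transpose_left[OF y that(2)] that(3) by metis
qed

text \<open>The bridge between mates and universal arrows. The transpose of \<open>e\<close> is the
  comparison from the unit at \<open>x\<close> to \<open>e\<close>, so it is invertible exactly when
  \<open>e\<close> is as universal as the unit.\<close>

lemma is_iso_transpose_left:
  assumes y: "y \<in> Ob D" and e: "e \<in> hom C x (FO G y)"
  shows "is_iso D (Cmp D (NC \<epsilon> y) (FA F e)) \<longleftrightarrow> universal G x y e"
proof -
  have h: "Cmp D (NC \<epsilon> y) (FA F e) \<in> hom D (FO F x) y"
    using Cmp_hom[OF D FA_hom[OF F e] counit[OF y]] .
  note u = unit_universal[OF hom_Ob1[OF C e]]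
  show ?thesis
    using G.universal_iso[OF u _ h transpose_left[OF y e]]
      G.universal_post_iso[OF u h] transpose_left[OF y e] by auto
qed

lemma is_iso_transpose_right:
  assumes x: "x \<in> Ob C" and e: "e \<in> hom D (FO F x) y"
  shows "is_iso C (Cmp C (FA G e) (NC \<eta> x)) \<longleftrightarrow> couniversal F y x e"
proof -
  have h: "Cmp C (FA G e) (NC \<eta> x) \<in> hom C x (FO G y)"
    using Cmp_hom[OF C unit[OF x] FA_hom[OF G e]] .
  note u = counit_couniversal[OF hom_Ob2[OF D e]]
  show ?thesis
    using F.couniversal_iso[OF u _ h transpose_right[OF x e]]
      F.couniversal_pre_iso[OF u h] transpose_right[OF x e] by auto
qed

end

lemma ladj_adjunction:
  assumes "has_left_adjoint G"
  shows "adjunction (ladj G) G (ladj_unit G) (ladj_counit G)"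
proof -
  obtain F \<eta> \<epsilon> where "adjunction F G \<eta> \<epsilon>" using assms by (auto simp: has_left_adjoint_def)
  then have "(\<lambda>(F, \<eta>, \<epsilon>). adjunction F G \<eta> \<epsilon>) (F, \<eta>, \<epsilon>)" by simp
  from someI[where P = "\<lambda>(F, \<eta>, \<epsilon>). adjunction F G \<eta> \<epsilon>", OF this] show ?thesis
    by (simp add: ladj_def ladj_unit_def ladj_counit_def ladj_data_def case_prod_unfold)
qed

lemma radj_adjunction:
  assumes "has_right_adjoint F"
  shows "adjunction F (radj F) (radj_unit F) (radj_counit F)"
proof -
  obtain G \<eta> \<epsilon> where "adjunction F G \<eta> \<epsilon>" using assms by (auto simp: has_right_adjoint_def)
  then have "(\<lambda>(G, \<eta>, \<epsilon>). adjunction F G \<eta> \<epsilon>) (G, \<eta>, \<epsilon>)" by simp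
  from someI[where P = "\<lambda>(G, \<eta>, \<epsilon>). adjunction F G \<eta> \<epsilon>", OF this] show ?thesis
    by (simp add: radj_def radj_unit_def radj_counit_def radj_data_def case_prod_unfold)
qed

lemma adjoint_functors_ladj:
  assumes "functor_between D C G" "has_left_adjoint G"
  shows "adjoint_functors C D (ladj G) G (ladj_unit G) (ladj_counit G)"
proof -
  interpret G: functor_between D C G by fact
  note a = ladj_adjunction[OF assms(2)]
  have "FDom (ladj G) = C" "FCod (ladj G) = D"
    using a G.G by (auto simp: adjunction_def Funs_def)
  then show ?thesis
    by unfold_locales (use a G.C G.D in \<open>simp_all add: adjunction_def\<close>)
qed

lemma adjoint_functors_radj:
  assumes "functor_between C D F" "has_right_adjoint F"
  shows "adjoint_functors C D F (radj F) (radj_unit F) (radj_counit F)"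
proof -
  interpret F: functor_between C D F by fact
  note a = radj_adjunction[OF assms(2)]
  show ?thesis
    by unfold_locales (use a F.C F.D F.G F.FDom F.FCod in \<open>simp_all add: adjunction_def\<close>)
qed

section \<open>Exact squares of categories\<close>

text \<open>
  If \<open>U\<close> and \<open>W\<close> have left adjoints \<open>U\<^sub>!\<close> and \<open>W\<^sub>!\<close>, the first condition says that the mate
  \<open>W\<^sub>! P X \<rightarrow> Q U\<^sub>! X\<close> of \<open>a : P U \<rightarrow> W Q\<close> is invertible, without a choice of adjoints; if \<open>P\<close> and
  \<open>Q\<close> have right adjoints, the second one does the same for the mate \<open>U Q\<^sub>* X \<rightarrow> P\<^sub>* W X\<close>.
\<close>

definition lan_exact_at where
  "lan_exact_at P W Q U a X \<longleftrightarrow>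
     (\<forall>Y e. universal U X Y e \<longrightarrow> universal W (FO P X) (FO Q Y) (Cmp (FCod P) (a Y) (FA P e)))"

definition ran_exact_at where
  "ran_exact_at P W Q U a X \<longleftrightarrow>
     (\<forall>Y e. couniversal Q X Y e \<longrightarrow> couniversal P (FO W X) (FO U Y) (Cmp (FCod P) (FA W e) (a Y)))"

definition lan_exact where "lan_exact P W Q U a \<longleftrightarrow> (\<forall>X\<in>Ob (FDom P). lan_exact_at P W Q U a X)"
definition ran_exact where "ran_exact P W Q U a \<longleftrightarrow> (\<forall>X\<in>Ob (FDom W). ran_exact_at P W Q U a X)"

lemma lan_exact_universal:
  "lan_exact P W Q U a \<Longrightarrow> X \<in> Ob (FDom P) \<Longrightarrow> universal U X Y e \<Longrightarrow>
    universal W (FO P X) (FO Q Y) (Cmp (FCod P) (a Y) (FA P e))"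
  by (simp add: lan_exact_def lan_exact_at_def)

lemma ran_exact_couniversal:
  "ran_exact P W Q U a \<Longrightarrow> X \<in> Ob (FDom W) \<Longrightarrow> couniversal Q X Y e \<Longrightarrow>
    couniversal P (FO W X) (FO U Y) (Cmp (FCod P) (FA W e) (a Y))"
  by (simp add: ran_exact_def ran_exact_at_def)

text \<open>A square of small categories gives an instance with \<open>U\<close>, \<open>P\<close>,
  \<open>W\<close>, \<open>Q\<close> the restrictions along u, p, v, q. The four categories have
  unrelated types because the same notion is used for squares with two sides of the form - \<otimes>
  Z, leading from values of V to values of D.\<close>

locale lax_square =
  fixes A :: "('o1, 'm1) cat" and B :: "('o2, 'm2) cat"
    and K :: "('o3, 'm3) cat" and M :: "('o4, 'm4) cat"
    and U :: "('o2, 'm2, 'o1, 'm1) ftor" and P :: "('o1, 'm1, 'o3, 'm3) ftor"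
    and W :: "('o4, 'm4, 'o3, 'm3) ftor" and Q :: "('o2, 'm2, 'o4, 'm4) ftor"
    and a :: "'o2 \<Rightarrow> 'm3"
  assumes A: "category A" and B: "category B" and K: "category K" and M: "category M"
    and U: "U \<in> Funs B A" and P: "P \<in> Funs A K" and W: "W \<in> Funs M K" and Q: "Q \<in> Funs B M"
    and hom: "\<And>Y. Y \<in> Ob B \<Longrightarrow> a Y \<in> hom K (FO P (FO U Y)) (FO W (FO Q Y))"
    and nat: "\<And>Y Y' f. f \<in> hom B Y Y' \<Longrightarrow>
      Cmp K (a Y') (FA P (FA U f)) = Cmp K (FA W (FA Q f)) (a Y)"
begin

sublocale U: functor_between B A U by unfold_locales (rule A B U)+
sublocale P: functor_between A K P by unfold_locales (rule A K P)+
sublocale W: functor_between M K W by unfold_locales (rule M K W)+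
sublocale Q: functor_between B M Q by unfold_locales (rule B M Q)+

lemma lan_exact_atD:
  "lan_exact_at P W Q U a X \<Longrightarrow> universal U X Y e \<Longrightarrow> universal W (FO P X) (FO Q Y) (Cmp K (a Y) (FA P e))"
  by (simp add: lan_exact_at_def P.FCod)

lemma ran_exact_atD:
  "ran_exact_at P W Q U a X \<Longrightarrow> couniversal Q X Y e \<Longrightarrow> couniversal P (FO W X) (FO U Y) (Cmp K (FA W e) (a Y))"
  by (simp add: ran_exact_at_def P.FCod)

lemma lan_exactD:
  "lan_exact P W Q U a \<Longrightarrow> universal U X Y e \<Longrightarrow> universal W (FO P X) (FO Q Y) (Cmp K (a Y) (FA P e))"
  using lan_exact_atD U.universal_dom by (simp add: lan_exact_def P.FDom)

lemma ran_exactD: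
  "ran_exact P W Q U a \<Longrightarrow> couniversal Q X Y e \<Longrightarrow> couniversal P (FO W X) (FO U Y) (Cmp K (FA W e) (a Y))"
  using ran_exact_atD Q.couniversal_cod by (simp add: ran_exact_def W.FDom)

lemma lan_exactI:
  assumes "\<And>X Y e. universal U X Y e \<Longrightarrow> universal W (FO P X) (FO Q Y) (Cmp K (a Y) (FA P e))"
  shows "lan_exact P W Q U a"
  using assms by (simp add: lan_exact_def lan_exact_at_def P.FCod)

lemma ran_exactI:
  assumes "\<And>X Y e. couniversal Q X Y e \<Longrightarrow> couniversal P (FO W X) (FO U Y) (Cmp K (FA W e) (a Y))"
  shows "ran_exact P W Q U a"
  using assms by (simp add: ran_exact_def ran_exact_at_def P.FCod)

text \<open>Any other universal arrow at \<open>X\<close> differs from \<open>e\<close> by an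
  isomorphism \<open>h\<close>, and naturality of \<open>a\<close> turns this into composition with
  the isomorphism \<open>FA W (FA Q h)\<close>.\<close>

lemma lan_exact_atI:
  assumes e: "universal U X Y e" and E: "universal W (FO P X) (FO Q Y) (Cmp K (a Y) (FA P e))"
  shows "lan_exact_at P W Q U a X"
  unfolding lan_exact_at_def P.FCod
proof (intro allI impI)
  fix Y' e' assume e': "universal U X Y' e'"
  note y = U.universal_Ob[OF e] and y' = U.universal_Ob[OF e']
    and eh = U.universal_hom[OF e]
  obtain h where h: "h \<in> hom B Y Y'" and eq: "Cmp A (FA U h) e = e'"
    using U.universal_ex[OF e y' U.universal_hom[OF e']] .
  have iso: "is_iso M (FA Q h)"
    using is_iso_FA[OF B Q h U.universal_iso[OF e e' h eq]] .
  have "Cmp K (a Y') (FA P e') = Cmp K (Cmp K (a Y') (FA P (FA U h))) (FA P e)"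
    using FA_Cmp[OF P eh FA_hom[OF U h]] eq
      Cmp_assoc[OF K FA_hom[OF P eh] FA_hom[OF P FA_hom[OF U h]] hom[OF y']] by simp
  also have "\<dots> = Cmp K (FA W (FA Q h)) (Cmp K (a Y) (FA P e))"
    using nat[OF h] Cmp_assoc[OF K FA_hom[OF P eh] hom[OF y] FA_hom[OF W FA_hom[OF Q h]]] by simp
  finally show "universal W (FO P X) (FO Q Y') (Cmp K (a Y') (FA P e'))"
    using W.universal_post_iso[OF E FA_hom[OF Q h] iso] by simp
qed

lemma ran_exact_atI:
  assumes e: "couniversal Q X Y e" and E: "couniversal P (FO W X) (FO U Y) (Cmp K (FA W e) (a Y))"
  shows "ran_exact_at P W Q U a X"
  unfolding ran_exact_at_def P.FCod
proof (intro allI impI)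
  fix Y' e' assume e': "couniversal Q X Y' e'"
  note y = Q.couniversal_Ob[OF e] and y' = Q.couniversal_Ob[OF e']
    and eh = Q.couniversal_hom[OF e]
  obtain h where h: "h \<in> hom B Y' Y" and eq: "Cmp M e (FA Q h) = e'"
    using Q.couniversal_ex[OF e y' Q.couniversal_hom[OF e']] .
  have iso: "is_iso A (FA U h)"
    using is_iso_FA[OF B U h Q.couniversal_iso[OF e e' h eq]] .
  have "Cmp K (FA W e') (a Y') = Cmp K (FA W e) (Cmp K (FA W (FA Q h)) (a Y'))"
    using FA_Cmp[OF W FA_hom[OF Q h] eh] eq
      Cmp_assoc[OF K hom[OF y'] FA_hom[OF W FA_hom[OF Q h]] FA_hom[OF W eh]] by simp
  also have "\<dots> = Cmp K (Cmp K (FA W e) (a Y)) (FA P (FA U h))"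
    using nat[OF h] Cmp_assoc[OF K FA_hom[OF P FA_hom[OF U h]] hom[OF y] FA_hom[OF W eh]] by simp
  finally show "couniversal P (FO W X) (FO U Y') (Cmp K (FA W e') (a Y'))"
    using P.couniversal_pre_iso[OF E FA_hom[OF U h] iso] by simp
qed

text \<open>A universal arrow at \<open>X'\<close> is pulled back along \<open>k\<close>, tested at
  \<open>X\<close>, and the test is undone with the inverse of \<open>FA P k\<close>. This is the
  passage from S \<otimes> Z to Z at the end.\<close>

lemma lan_exact_at_iso:
  assumes X: "lan_exact_at P W Q U a X" and k: "k \<in> hom A X X'" and iso: "is_iso A k"
  shows "lan_exact_at P W Q U a X'"
  unfolding lan_exact_at_def P.FCod
proof (intro allI impI)
  fix Y e assume e: "universal U X' Y e"
  note y = U.universal_Ob[OF e] and eh = U.universal_hom[OF e] and i = inv_ar[OF A iso k]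
  note Pe = FA_hom[OF P eh] and Pk = FA_hom[OF P k] and Pi = FA_hom[OF P i(1)]
  have 1: "universal W (FO P X) (FO Q Y) (Cmp K (a Y) (FA P (Cmp A e k)))"
    using lan_exact_atD[OF X U.universal_pre_iso[OF e k iso]] .
  have "universal W (FO P X') (FO Q Y) (Cmp K (Cmp K (a Y) (FA P (Cmp A e k))) (FA P (inv_ar A k)))"
    using W.universal_pre_iso[OF 1 Pi is_iso_FA[OF A P i(1) is_iso_inv_ar[OF A iso k]]] .
  also have "Cmp K (Cmp K (a Y) (FA P (Cmp A e k))) (FA P (inv_ar A k)) =
      Cmp K (a Y) (FA P (Cmp A (Cmp A e k) (inv_ar A k)))"
    using FA_Cmp[OF P i(1) Cmp_hom[OF A k eh]]
      Cmp_assoc[OF K Pi FA_hom[OF P Cmp_hom[OF A k eh]] hom[OF y]] by simp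
  also have "Cmp A (Cmp A e k) (inv_ar A k) = e"
    using Cmp_assoc[OF A i(1) k eh] i(3) Cmp_Idn[OF A eh] by simp
  finally show "universal W (FO P X') (FO Q Y) (Cmp K (a Y) (FA P e))" .
qed

text \<open>Commutativity of a square of hom-sets. From \<open>hom B Y Y'\<close> one goes to
  \<open>hom A T (FO U Y')\<close> by composing with \<open>e\<close> and to
  \<open>hom M (FO Q Y) X\<close> by composing with \<open>d\<close>. From these two one goes on to
  \<open>hom K (FO P T) (FO W X)\<close> by composing with the candidate couniversal arrow and with
  the candidate universal arrow.\<close>

lemma mate_transpose:
  assumes e: "e \<in> hom A T (FO U Y)" and h: "h \<in> hom B Y Y'" and d: "d \<in> hom M (FO Q Y') X"
  shows "Cmp K (Cmp K (FA W d) (a Y')) (FA P (Cmp A (FA U h) e)) =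
    Cmp K (FA W (Cmp M d (FA Q h))) (Cmp K (a Y) (FA P e))"
proof -
  note Uh = FA_hom[OF U h] and Qh = FA_hom[OF Q h]
  note Pe = FA_hom[OF P e] and PUh = FA_hom[OF P Uh] and WQh = FA_hom[OF W Qh] and Wd = FA_hom[OF W d]
  note aY = hom[OF hom_Ob1[OF B h]] and aY' = hom[OF hom_Ob2[OF B h]]
  have "Cmp K (Cmp K (FA W d) (a Y')) (FA P (Cmp A (FA U h) e)) =
      Cmp K (FA W d) (Cmp K (Cmp K (a Y') (FA P (FA U h))) (FA P e))"
    using FA_Cmp[OF P e Uh] Cmp_assoc[OF K Cmp_hom[OF K Pe PUh] aY' Wd] Cmp_assoc[OF K Pe PUh aY']
    by simp
  also have "\<dots> = Cmp K (FA W d) (Cmp K (FA W (FA Q h)) (Cmp K (a Y) (FA P e)))"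
    using nat[OF h] Cmp_assoc[OF K Pe aY WQh] by simp
  also have "\<dots> = Cmp K (FA W (Cmp M d (FA Q h))) (Cmp K (a Y) (FA P e))"
    using FA_Cmp[OF W Qh d] Cmp_assoc[OF K Cmp_hom[OF K Pe aY] WQh Wd] by simp
  finally show ?thesis .
qed

text \<open>In the hom-set square of \<open>mate_transpose\<close> the two maps out of
  \<open>hom B Y Y'\<close> are bijections when \<open>e\<close> is universal and \<open>d\<close>
  couniversal. So the remaining two maps are bijective together, one expressing universality, the
  other couniversality. The hypothesis \<open>ex\<close> supplies an \<open>e\<close> for each test
  object \<open>T\<close>.\<close>

lemma lan_exact_imp_ran_exact:
  assumes lan_exact: "lan_exact P W Q U a" and ex: "\<And>T. T \<in> Ob A \<Longrightarrow> \<exists>Y e. universal U T Y e"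
  shows "ran_exact P W Q U a"
proof (rule ran_exactI)
  fix X Y' d assume d: "couniversal Q X Y' d"
  note y' = Q.couniversal_Ob[OF d] and dh = Q.couniversal_hom[OF d]
  show "couniversal P (FO W X) (FO U Y') (Cmp K (FA W d) (a Y'))"
  proof (rule P.couniversalI)
    show "FO U Y' \<in> Ob A" using FO_Ob[OF U y'] .
    show "Cmp K (FA W d) (a Y') \<in> hom K (FO P (FO U Y')) (FO W X)"
      using Cmp_hom[OF K hom[OF y'] FA_hom[OF W dh]] .
  next
    fix T f assume T: "T \<in> Ob A" and f: "f \<in> hom K (FO P T) (FO W X)"
    \<comment> \<open>Surjectivity: \<open>f\<close> is pulled back to \<open>g\<close> in
      \<open>M\<close>, then to \<open>h\<close> in \<open>B\<close>, and pushed forward to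
      \<open>A\<close>.\<close>
    obtain Y e where e: "universal U T Y e" using ex[OF T] by blast
    note eh = U.universal_hom[OF e] and E = lan_exactD[OF lan_exact e]
    obtain g where g: "g \<in> hom M (FO Q Y) X" and geq: "Cmp K (FA W g) (Cmp K (a Y) (FA P e)) = f"
      using W.universal_ex[OF E Q.couniversal_cod[OF d] f] .
    obtain h where h: "h \<in> hom B Y Y'" and heq: "Cmp M d (FA Q h) = g"
      using Q.couniversal_ex[OF d U.universal_Ob[OF e] g] .
    show "\<exists>h\<in>hom A T (FO U Y'). Cmp K (Cmp K (FA W d) (a Y')) (FA P h) = f"
      using mate_transpose[OF eh h dh] geq heq Cmp_hom[OF A eh FA_hom[OF U h]] by auto
  next
    fix T h k assume h: "h \<in> hom A T (FO U Y')" and k: "k \<in> hom A T (FO U Y')"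
      and eq: "Cmp K (Cmp K (FA W d) (a Y')) (FA P h) = Cmp K (Cmp K (FA W d) (a Y')) (FA P k)"
    obtain Y e where e: "universal U T Y e" using ex[OF hom_Ob1[OF A h]] by blast
    note eh = U.universal_hom[OF e] and E = lan_exactD[OF lan_exact e]
    obtain h' where h': "h' \<in> hom B Y Y'" and heq: "Cmp A (FA U h') e = h"
      using U.universal_ex[OF e y' h] .
    obtain k' where k': "k' \<in> hom B Y Y'" and keq: "Cmp A (FA U k') e = k"
      using U.universal_ex[OF e y' k] .
    have "Cmp M d (FA Q h') = Cmp M d (FA Q k')"
      by (rule W.universal_eq[OF E Cmp_hom[OF M FA_hom[OF Q h'] dh] Cmp_hom[OF M FA_hom[OF Q k'] dh]])
        (simp only: mate_transpose[OF eh h' dh, symmetric] mate_transpose[OF eh k' dh, symmetric] heq keq eq)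
    then have "h' = k'" by (rule Q.couniversal_eq[OF d h' k'])
    then show "h = k" using heq keq by simp
  qed
qed

text \<open>The same hom-set square read the other way. Now the couniversal arrow \<open>d\<close>
  has to be found for each test object \<open>X\<close> of \<open>M\<close>.\<close>

lemma ran_exact_imp_lan_exact:
  assumes ran_exact: "ran_exact P W Q U a" and ex: "\<And>X. X \<in> Ob M \<Longrightarrow> \<exists>Y d. couniversal Q X Y d"
  shows "lan_exact P W Q U a"
proof (rule lan_exactI)
  fix T Y e assume e: "universal U T Y e"
  note y = U.universal_Ob[OF e] and eh = U.universal_hom[OF e]
  show "universal W (FO P T) (FO Q Y) (Cmp K (a Y) (FA P e))"
  proof (rule W.universalI)
    show "FO Q Y \<in> Ob M" using FO_Ob[OF Q y] .
    show "Cmp K (a Y) (FA P e) \<in> hom K (FO P T) (FO W (FO Q Y))"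
      using Cmp_hom[OF K FA_hom[OF P eh] hom[OF y]] .
  next
    fix X f assume X: "X \<in> Ob M" and f: "f \<in> hom K (FO P T) (FO W X)"
    obtain Y' d where d: "couniversal Q X Y' d" using ex[OF X] by blast
    note dh = Q.couniversal_hom[OF d] and E = ran_exactD[OF ran_exact d]
    obtain g where g: "g \<in> hom A T (FO U Y')" and geq: "Cmp K (Cmp K (FA W d) (a Y')) (FA P g) = f"
      using P.couniversal_ex[OF E U.universal_dom[OF e] f] .
    obtain h where h: "h \<in> hom B Y Y'" and heq: "Cmp A (FA U h) e = g"
      using U.universal_ex[OF e Q.couniversal_Ob[OF d] g] .
    show "\<exists>h\<in>hom M (FO Q Y) X. Cmp K (FA W h) (Cmp K (a Y) (FA P e)) = f"
      using mate_transpose[OF eh h dh] geq heq Cmp_hom[OF M FA_hom[OF Q h] dh] by auto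
  next
    fix X h k assume h: "h \<in> hom M (FO Q Y) X" and k: "k \<in> hom M (FO Q Y) X"
      and eq: "Cmp K (FA W h) (Cmp K (a Y) (FA P e)) = Cmp K (FA W k) (Cmp K (a Y) (FA P e))"
    obtain Y' d where d: "couniversal Q X Y' d" using ex[OF hom_Ob2[OF M h]] by blast
    note dh = Q.couniversal_hom[OF d] and E = ran_exactD[OF ran_exact d]
    obtain h' where h': "h' \<in> hom B Y Y'" and heq: "Cmp M d (FA Q h') = h"
      using Q.couniversal_ex[OF d y h] .
    obtain k' where k': "k' \<in> hom B Y Y'" and keq: "Cmp M d (FA Q k') = k"
      using Q.couniversal_ex[OF d y k] .
    have "Cmp A (FA U h') e = Cmp A (FA U k') e"
      by (rule P.couniversal_eq[OF E Cmp_hom[OF A eh FA_hom[OF U h']] Cmp_hom[OF A eh FA_hom[OF U k']]])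
        (simp only: mate_transpose[OF eh h' dh] mate_transpose[OF eh k' dh] heq keq eq)
    then have "h' = k'" by (rule U.universal_eq[OF e h' k'])
    then show "h = k" using heq keq by simp
  qed
qed

end

section \<open>Pasting of squares and cancellation\<close>

text \<open>The universal arrow that the first square produces for \<open>W\<close> is what the
  second square takes as input; only bracketing is left.\<close>

lemma lan_exact_paste:
  assumes 1: "lax_square A B K M U P W Q a" and 2: "lax_square K M K' M' W P' W' Q' c"
    and l1: "lan_exact P W Q U a" and l2: "lan_exact P' W' Q' W c"
  shows "lan_exact (P' \<circ>\<^sub>F P) W' (Q' \<circ>\<^sub>F Q) U (\<lambda>Y. Cmp K' (c (FO Q Y)) (FA P' (a Y)))"
  unfolding lan_exact_def lan_exact_at_def
proof (intro ballI allI impI)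
  interpret s: lax_square A B K M U P W Q a by fact
  interpret t: lax_square K M K' M' W P' W' Q' c by fact
  fix X Y e assume e: "universal U X Y e"
  note y = s.U.universal_Ob[OF e] and x = s.U.universal_dom[OF e] and eh = s.U.universal_hom[OF e]
  have "universal W' (FO P' (FO P X)) (FO Q' (FO Q Y)) (Cmp K' (c (FO Q Y)) (FA P' (Cmp K (a Y) (FA P e))))"
    using t.lan_exactD[OF l2 s.lan_exactD[OF l1 e]] .
  also have "Cmp K' (c (FO Q Y)) (FA P' (Cmp K (a Y) (FA P e))) =
      Cmp K' (Cmp K' (c (FO Q Y)) (FA P' (a Y))) (FA P' (FA P e))"
    using FA_Cmp[OF t.P FA_hom[OF s.P eh] s.hom[OF y]]
      Cmp_assoc[OF t.K FA_hom[OF t.P FA_hom[OF s.P eh]] FA_hom[OF t.P s.hom[OF y]] t.hom[OF FO_Ob[OF s.Q y]]]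
    by simp
  finally show "universal W' (FO (P' \<circ>\<^sub>F P) X) (FO (Q' \<circ>\<^sub>F Q) Y)
      (Cmp (FCod (P' \<circ>\<^sub>F P)) (Cmp K' (c (FO Q Y)) (FA P' (a Y))) (FA (P' \<circ>\<^sub>F P) e))"
    by (simp add: Funs_FCod[OF fcomp_Funs[OF s.P t.P s.A]] FO_fcomp[OF s.P x]
      FA_fcomp[OF s.P hom_Ar[OF eh]] FO_fcomp[OF s.Q y])
qed

text \<open>Let \<open>h\<close> compare a universal arrow \<open>n\<close> at \<open>P X\<close>
  with the arrow under test. Its image under \<open>Q' i\<close> compares two universal arrows, one
  obtained from \<open>n\<close> through the inner square and one from the pasted square, hence is
  invertible. By \<open>cons\<close> these images detect invertibility of \<open>h\<close>.\<close>

lemma lan_exact_unpaste: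
  fixes K' :: "'i \<Rightarrow> ('o, 'm) cat" and M' :: "'i \<Rightarrow> ('p, 'n) cat"
  assumes 1: "lax_square A B K M U P W Q a"
    and 2: "\<And>i. i \<in> I \<Longrightarrow> lax_square K M (K' i) (M' i) W (P' i) (W' i) (Q' i) (c i)"
    and l2: "\<And>i. i \<in> I \<Longrightarrow> lan_exact (P' i) (W' i) (Q' i) W (c i)"
    and l: "\<And>i. i \<in> I \<Longrightarrow>
      lan_exact (P' i \<circ>\<^sub>F P) (W' i) (Q' i \<circ>\<^sub>F Q) U (\<lambda>Y. Cmp (K' i) (c i (FO Q Y)) (FA (P' i) (a Y)))"
    and ex: "\<And>T. T \<in> Ob K \<Longrightarrow> \<exists>Y e. universal W T Y e"
    and cons: "\<And>f. f \<in> Ar M \<Longrightarrow> (\<And>i. i \<in> I \<Longrightarrow> is_iso (M' i) (FA (Q' i) f)) \<Longrightarrow> is_iso M f"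
  shows "lan_exact P W Q U a"
proof -
  interpret s: lax_square A B K M U P W Q a by fact
  show ?thesis
  proof (rule s.lan_exactI)
    fix X Y e assume e: "universal U X Y e"
    note y = s.U.universal_Ob[OF e] and x = s.U.universal_dom[OF e] and eh = s.U.universal_hom[OF e]
    let ?E = "Cmp K (a Y) (FA P e)"
    have Eh: "?E \<in> hom K (FO P X) (FO W (FO Q Y))"
      using Cmp_hom[OF s.K FA_hom[OF s.P eh] s.hom[OF y]] .
    obtain N n where n: "universal W (FO P X) N n" using ex[OF FO_Ob[OF s.P x]] by blast
    note nh = s.W.universal_hom[OF n]
    obtain h where h: "h \<in> hom M N (FO Q Y)" and heq: "Cmp K (FA W h) n = ?E"
      using s.W.universal_ex[OF n FO_Ob[OF s.Q y] Eh] .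
    have "is_iso M h"
    proof (rule cons)
      show "h \<in> Ar M" using hom_Ar[OF h] .
      fix i assume i: "i \<in> I"
      interpret t: lax_square K M "K' i" "M' i" W "P' i" "W' i" "Q' i" "c i" using 2[OF i] .
      have u1: "universal (W' i) (FO (P' i) (FO P X)) (FO (Q' i) N) (Cmp (K' i) (c i N) (FA (P' i) n))"
        using t.lan_exactD[OF l2[OF i] n] .
      have u2: "universal (W' i) (FO (P' i) (FO P X)) (FO (Q' i) (FO Q Y))
          (Cmp (K' i) (Cmp (K' i) (c i (FO Q Y)) (FA (P' i) (a Y))) (FA (P' i) (FA P e)))"
        using lan_exact_universal[OF l[OF i] _ e] x
        by (simp add: Funs_FCod[OF fcomp_Funs[OF s.P t.P s.A]] Funs_FDom[OF fcomp_Funs[OF s.P t.P s.A]]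
          FO_fcomp[OF s.P x] FA_fcomp[OF s.P hom_Ar[OF eh]] FO_fcomp[OF s.Q y])
      have "Cmp (K' i) (FA (W' i) (FA (Q' i) h)) (Cmp (K' i) (c i N) (FA (P' i) n)) =
          Cmp (K' i) (Cmp (K' i) (c i (FO Q Y)) (FA (P' i) (FA W h))) (FA (P' i) n)"
        using t.nat[OF h] Cmp_assoc[OF t.K FA_hom[OF t.P nh] t.hom[OF hom_Ob1[OF s.M h]]
            FA_hom[OF t.W FA_hom[OF t.Q h]]] by simp
      also have "\<dots> = Cmp (K' i) (c i (FO Q Y)) (FA (P' i) ?E)"
        using FA_Cmp[OF t.P nh FA_hom[OF s.W h]] heq
          Cmp_assoc[OF t.K FA_hom[OF t.P nh] FA_hom[OF t.P FA_hom[OF s.W h]] t.hom[OF FO_Ob[OF s.Q y]]]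
        by simp
      also have "\<dots> = Cmp (K' i) (Cmp (K' i) (c i (FO Q Y)) (FA (P' i) (a Y))) (FA (P' i) (FA P e))"
        using FA_Cmp[OF t.P FA_hom[OF s.P eh] s.hom[OF y]]
          Cmp_assoc[OF t.K FA_hom[OF t.P FA_hom[OF s.P eh]] FA_hom[OF t.P s.hom[OF y]]
            t.hom[OF FO_Ob[OF s.Q y]]] by simp
      finally show "is_iso (M' i) (FA (Q' i) h)"
        by (rule t.W.universal_iso[OF u1 u2 FA_hom[OF t.Q h]])
    qed
    then show "universal W (FO P X) (FO Q Y) ?E"
      using s.W.universal_post_iso[OF n h] heq by simp
  qed
qed

text \<open>The shared edge is now \<open>P\<close>, not \<open>W\<close>: the right-hand condition
  produces couniversal arrows for \<open>P\<close>, which the second square consumes.\<close>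

lemma ran_exact_paste:
  assumes 1: "lax_square A B K M U P W Q a" and 2: "lax_square A' A K' K U' P' W' P c"
    and l1: "ran_exact P W Q U a" and l2: "ran_exact P' W' P U' c"
  shows "ran_exact P' (W' \<circ>\<^sub>F W) Q (U' \<circ>\<^sub>F U) (\<lambda>Y. Cmp K' (FA W' (a Y)) (c (FO U Y)))"
  unfolding ran_exact_def ran_exact_at_def
proof (intro ballI allI impI)
  interpret s: lax_square A B K M U P W Q a by fact
  interpret t: lax_square A' A K' K U' P' W' P c by fact
  fix X Y e assume e: "couniversal Q X Y e"
  note y = s.Q.couniversal_Ob[OF e] and x = s.Q.couniversal_cod[OF e] and eh = s.Q.couniversal_hom[OF e]
  have "couniversal P' (FO W' (FO W X)) (FO U' (FO U Y)) (Cmp K' (FA W' (Cmp K (FA W e) (a Y))) (c (FO U Y)))"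
    using t.ran_exactD[OF l2 s.ran_exactD[OF l1 e]] .
  also have "Cmp K' (FA W' (Cmp K (FA W e) (a Y))) (c (FO U Y)) =
      Cmp K' (FA W' (FA W e)) (Cmp K' (FA W' (a Y)) (c (FO U Y)))"
    using FA_Cmp[OF t.W s.hom[OF y] FA_hom[OF s.W eh]]
      Cmp_assoc[OF t.K t.hom[OF FO_Ob[OF s.U y]] FA_hom[OF t.W s.hom[OF y]] FA_hom[OF t.W FA_hom[OF s.W eh]]]
    by simp
  finally show "couniversal P' (FO (W' \<circ>\<^sub>F W) X) (FO (U' \<circ>\<^sub>F U) Y)
      (Cmp (FCod P') (FA (W' \<circ>\<^sub>F W) e) (Cmp K' (FA W' (a Y)) (c (FO U Y))))"
    by (simp add: t.P.FCod FO_fcomp[OF s.W x] FA_fcomp[OF s.W hom_Ar[OF eh]] FO_fcomp[OF s.U y])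
qed

text \<open>Here the comparison arrow lies in \<open>A\<close>, the target of the right mate, so it
  is the functors \<open>U' i\<close> that have to detect isomorphisms.\<close>

lemma ran_exact_unpaste:
  fixes K' :: "'i \<Rightarrow> ('o, 'm) cat" and A' :: "'i \<Rightarrow> ('p, 'n) cat"
  assumes 1: "lax_square A B K M U P W Q a"
    and 2: "\<And>i. i \<in> I \<Longrightarrow> lax_square (A' i) A (K' i) K (U' i) (P' i) (W' i) P (c i)"
    and l2: "\<And>i. i \<in> I \<Longrightarrow> ran_exact (P' i) (W' i) P (U' i) (c i)"
    and l: "\<And>i. i \<in> I \<Longrightarrow>
      ran_exact (P' i) (W' i \<circ>\<^sub>F W) Q (U' i \<circ>\<^sub>F U) (\<lambda>Y. Cmp (K' i) (FA (W' i) (a Y)) (c i (FO U Y)))"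
    and ex: "\<And>T. T \<in> Ob K \<Longrightarrow> \<exists>Y e. couniversal P T Y e"
    and cons: "\<And>f. f \<in> Ar A \<Longrightarrow> (\<And>i. i \<in> I \<Longrightarrow> is_iso (A' i) (FA (U' i) f)) \<Longrightarrow> is_iso A f"
  shows "ran_exact P W Q U a"
proof -
  interpret s: lax_square A B K M U P W Q a by fact
  show ?thesis
  proof (rule s.ran_exactI)
    fix X Y e assume e: "couniversal Q X Y e"
    note y = s.Q.couniversal_Ob[OF e] and x = s.Q.couniversal_cod[OF e] and eh = s.Q.couniversal_hom[OF e]
    let ?E = "Cmp K (FA W e) (a Y)"
    have Eh: "?E \<in> hom K (FO P (FO U Y)) (FO W X)"
      using Cmp_hom[OF s.K s.hom[OF y] FA_hom[OF s.W eh]] .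
    obtain N n where n: "couniversal P (FO W X) N n" using ex[OF FO_Ob[OF s.W x]] by blast
    note nh = s.P.couniversal_hom[OF n]
    obtain h where h: "h \<in> hom A (FO U Y) N" and heq: "Cmp K n (FA P h) = ?E"
      using s.P.couniversal_ex[OF n FO_Ob[OF s.U y] Eh] .
    have "is_iso A h"
    proof (rule cons)
      show "h \<in> Ar A" using hom_Ar[OF h] .
      fix i assume i: "i \<in> I"
      interpret t: lax_square "A' i" A "K' i" K "U' i" "P' i" "W' i" P "c i" using 2[OF i] .
      have u1: "couniversal (P' i) (FO (W' i) (FO W X)) (FO (U' i) N) (Cmp (K' i) (FA (W' i) n) (c i N))"
        using t.ran_exactD[OF l2[OF i] n] .
      have u2: "couniversal (P' i) (FO (W' i) (FO W X)) (FO (U' i) (FO U Y))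
          (Cmp (K' i) (FA (W' i) (FA W e)) (Cmp (K' i) (FA (W' i) (a Y)) (c i (FO U Y))))"
        using ran_exact_couniversal[OF l[OF i] _ e] x
        by (simp add: t.P.FCod Funs_FDom[OF fcomp_Funs[OF s.W t.W s.M]]
          FO_fcomp[OF s.W x] FA_fcomp[OF s.W hom_Ar[OF eh]] FO_fcomp[OF s.U y])
      have "Cmp (K' i) (Cmp (K' i) (FA (W' i) n) (c i N)) (FA (P' i) (FA (U' i) h)) =
          Cmp (K' i) (FA (W' i) n) (Cmp (K' i) (FA (W' i) (FA P h)) (c i (FO U Y)))"
        using t.nat[OF h] Cmp_assoc[OF t.K FA_hom[OF t.P FA_hom[OF t.U h]] t.hom[OF hom_Ob2[OF s.A h]]
            FA_hom[OF t.W nh]] by simp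
      also have "\<dots> = Cmp (K' i) (FA (W' i) ?E) (c i (FO U Y))"
        using FA_Cmp[OF t.W FA_hom[OF s.P h] nh] heq
          Cmp_assoc[OF t.K t.hom[OF FO_Ob[OF s.U y]] FA_hom[OF t.W FA_hom[OF s.P h]] FA_hom[OF t.W nh]]
        by simp
      also have "\<dots> = Cmp (K' i) (FA (W' i) (FA W e)) (Cmp (K' i) (FA (W' i) (a Y)) (c i (FO U Y)))"
        using FA_Cmp[OF t.W s.hom[OF y] FA_hom[OF s.W eh]]
          Cmp_assoc[OF t.K t.hom[OF FO_Ob[OF s.U y]] FA_hom[OF t.W s.hom[OF y]]
            FA_hom[OF t.W FA_hom[OF s.W eh]]] by simp
      finally show "is_iso (A' i) (FA (U' i) h)"
        by (rule t.P.couniversal_iso[OF u1 u2 FA_hom[OF t.U h]])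
    qed
    then show "couniversal P (FO W X) (FO U Y) ?E"
      using s.P.couniversal_pre_iso[OF n h] heq by simp
  qed
qed

text \<open>\<open>R\<close>, \<open>S\<close> and \<open>R'\<close>, \<open>S'\<close> are mutually
  inverse isomorphisms of categories that match \<open>W\<close> with \<open>W'\<close>, so each
  factorization problem for \<open>W'\<close> is carried back and solved by \<open>e\<close>. The
  use is the passage between \<open>A \<times>\<^sub>C one\<close> and \<open>A\<close>, which are
  isomorphic but not equal.\<close>

lemma universal_transport:
  assumes W: "functor_between D C W" and W': "functor_between D' C' W'"
    and R: "functor_between C C' R" and S: "functor_between C' C S"
    and R': "functor_between D D' R'" and S': "functor_between D' D S'"
    and SR: "S \<circ>\<^sub>F R = idf C" and RS: "R \<circ>\<^sub>F S = idf C'" and RS': "R' \<circ>\<^sub>F S' = idf D'"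
    and SR': "S' \<circ>\<^sub>F R' = idf D"
    and RW: "R \<circ>\<^sub>F W = W' \<circ>\<^sub>F R'" and SW: "S \<circ>\<^sub>F W' = W \<circ>\<^sub>F S'"
    and e: "universal W x y e"
  shows "universal W' (FO R x) (FO R' y) (FA R e)"
proof -
  interpret W: functor_between D C W by fact
  interpret W': functor_between D' C' W' by fact
  interpret R: functor_between C C' R by fact
  interpret S: functor_between C' C S by fact
  interpret R': functor_between D D' R' by fact
  interpret S': functor_between D' D S' by fact
  note y = W.universal_Ob[OF e] and eh = W.universal_hom[OF e] and x = W.universal_dom[OF e]
  have SRo: "FO S (FO R z) = z" if "z \<in> Ob C" for z
    using SR FO_fcomp[OF R.G that, of S] FO_idf[OF that] by simp
  have SRa: "FA S (FA R f) = f" if "f \<in> Ar C" for f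
    using SR FA_fcomp[OF R.G that, of S] FA_idf[OF that] by simp
  have RSa: "FA R (FA S f) = f" if "f \<in> Ar C'" for f
    using RS FA_fcomp[OF S.G that, of R] FA_idf[OF that] by simp
  have RSo': "FO R' (FO S' z) = z" if "z \<in> Ob D'" for z
    using RS' FO_fcomp[OF S'.G that, of R'] FO_idf[OF that] by simp
  have RSa': "FA R' (FA S' f) = f" if "f \<in> Ar D'" for f
    using RS' FA_fcomp[OF S'.G that, of R'] FA_idf[OF that] by simp
  have SRo': "FO S' (FO R' z) = z" if "z \<in> Ob D" for z
    using SR' FO_fcomp[OF R'.G that, of S'] FO_idf[OF that] by simp
  have RWo: "FO R (FO W z) = FO W' (FO R' z)" if "z \<in> Ob D" for z
    using RW FO_fcomp[OF W.G that, of R] FO_fcomp[OF R'.G that, of W'] by simp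
  have RWa: "FA R (FA W f) = FA W' (FA R' f)" if "f \<in> Ar D" for f
    using RW FA_fcomp[OF W.G that, of R] FA_fcomp[OF R'.G that, of W'] by simp
  have SWo: "FO S (FO W' z) = FO W (FO S' z)" if "z \<in> Ob D'" for z
    using SW FO_fcomp[OF W'.G that, of S] FO_fcomp[OF S'.G that, of W] by simp
  have SWa: "FA S (FA W' f) = FA W (FA S' f)" if "f \<in> Ar D'" for f
    using SW FA_fcomp[OF W'.G that, of S] FA_fcomp[OF S'.G that, of W] by simp
  have Re: "FA R e \<in> hom C' (FO R x) (FO W' (FO R' y))"
    using FA_hom[OF R.G eh] RWo[OF y] by simp
  show ?thesis
  proof (rule W'.universalI[OF FO_Ob[OF R'.G y] Re])
    fix z f assume z: "z \<in> Ob D'" and f: "f \<in> hom C' (FO R x) (FO W' z)"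
    have "FA S f \<in> hom C x (FO W (FO S' z))"
      using FA_hom[OF S.G f] SRo[OF x] SWo[OF z] by simp
    then obtain h where h: "h \<in> hom D y (FO S' z)" and eq: "Cmp C (FA W h) e = FA S f"
      using W.universal_ex[OF e FO_Ob[OF S'.G z]] by blast
    have "Cmp C' (FA W' (FA R' h)) (FA R e) = FA R (Cmp C (FA W h) e)"
      using FA_Cmp[OF R.G eh FA_hom[OF W.G h]] RWa[OF hom_Ar[OF h]] by simp
    also have "\<dots> = f" using eq RSa[OF hom_Ar[OF f]] by simp
    finally show "\<exists>h\<in>hom D' (FO R' y) z. Cmp C' (FA W' h) (FA R e) = f"
      using FA_hom[OF R'.G h] RSo'[OF z] by auto
  next
    fix z h k assume h: "h \<in> hom D' (FO R' y) z" and k: "k \<in> hom D' (FO R' y) z"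
      and eq: "Cmp C' (FA W' h) (FA R e) = Cmp C' (FA W' k) (FA R e)"
    have *: "FA S' l \<in> hom D y (FO S' z)" "Cmp C (FA W (FA S' l)) e = FA S (Cmp C' (FA W' l) (FA R e))"
      if l: "l \<in> hom D' (FO R' y) z" for l
      using FA_hom[OF S'.G l] SRo'[OF y] FA_Cmp[OF S.G Re FA_hom[OF W'.G l]]
        SWa[OF hom_Ar[OF l]] SRa[OF hom_Ar[OF eh]] by simp_all
    have "FA S' h = FA S' k"
      by (rule W.universal_eq[OF e *(1)[OF h] *(1)[OF k]]) (simp only: *(2)[OF h] *(2)[OF k] eq)
    then show "h = k" using RSa'[OF hom_Ar[OF h]] RSa'[OF hom_Ar[OF k]] by metis
  qed
qed

section \<open>Small categories and comma categories\<close>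

lemma mk_cat_simps:
  "Ob (mk_cat X F s t i c) = X" "Ar (mk_cat X F s t i c) = F"
  "f \<in> F \<Longrightarrow> Src (mk_cat X F s t i c) f = s f" "f \<in> F \<Longrightarrow> Tgt (mk_cat X F s t i c) f = t f"
  "x \<in> X \<Longrightarrow> Idn (mk_cat X F s t i c) x = i x"
  by (simp_all add: mk_cat_def)

lemma hom_mk_cat: "f \<in> hom (mk_cat X F s t i c) x y \<longleftrightarrow> f \<in> F \<and> s f = x \<and> t f = y"
  by (auto simp: hom_def mk_cat_def)

lemma Cmp_mk_cat:
  "f \<in> F \<Longrightarrow> g \<in> F \<Longrightarrow> s g = t f \<Longrightarrow> Cmp (mk_cat X F s t i c) g f = c g f"
  by (simp add: mk_cat_def)

lemma category_mk_cat:
  assumes "\<And>f. f \<in> F \<Longrightarrow> s f \<in> X" and "\<And>f. f \<in> F \<Longrightarrow> t f \<in> X"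
    and "\<And>x. x \<in> X \<Longrightarrow> i x \<in> F" and "\<And>x. x \<in> X \<Longrightarrow> s (i x) = x" and "\<And>x. x \<in> X \<Longrightarrow> t (i x) = x"
    and "\<And>g f. f \<in> F \<Longrightarrow> g \<in> F \<Longrightarrow> s g = t f \<Longrightarrow> c g f \<in> F"
    and "\<And>g f. f \<in> F \<Longrightarrow> g \<in> F \<Longrightarrow> s g = t f \<Longrightarrow> s (c g f) = s f"
    and "\<And>g f. f \<in> F \<Longrightarrow> g \<in> F \<Longrightarrow> s g = t f \<Longrightarrow> t (c g f) = t g"
    and "\<And>f. f \<in> F \<Longrightarrow> c f (i (s f)) = f" and "\<And>f. f \<in> F \<Longrightarrow> c (i (t f)) f = f"
    and "\<And>h g f. f \<in> F \<Longrightarrow> g \<in> F \<Longrightarrow> h \<in> F \<Longrightarrow> s g = t f \<Longrightarrow> s h = t g \<Longrightarrow> c h (c g f) = c (c h g) f"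
  shows "category (mk_cat X F s t i c)"
  unfolding category_def composable_def mk_cat_def using assms by (auto simp: PiE_iff)

text \<open>Both operations are extensional, so agreement on the domain is equality of records.
  Equal composites of functors can therefore be rewritten inside \<open>PF\<close> and
  \<open>PI\<close>.\<close>

lemma ftor_eqI:
  assumes "F \<in> Funs C D" "G \<in> Funs C D"
    and "\<And>x. x \<in> Ob C \<Longrightarrow> FO F x = FO G x" "\<And>f. f \<in> Ar C \<Longrightarrow> FA F f = FA G f"
  shows "F = G"
proof -
  have ext: "FO H \<in> extensional (Ob C)" "FA H \<in> extensional (Ar C)" if "H \<in> Funs C D" for H
    using that by (simp_all add: Funs_def PiE_iff)
  have "FO F = FO G" by (rule extensionalityI[OF ext(1) ext(1)]) (rule assms)+
  moreover have "FA F = FA G" by (rule extensionalityI[OF ext(2) ext(2)]) (rule assms)+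
  moreover have "FDom F = FDom G" "FCod F = FCod G"
    using assms(1,2) by (simp_all add: Funs_FDom Funs_FCod)
  ultimately show ?thesis by (cases F; cases G) simp
qed

lemma Ntrs_eqI:
  assumes "\<alpha> \<in> Ntrs F G" "\<beta> \<in> Ntrs F G" "F \<in> Funs C D"
    and "\<And>x. x \<in> Ob C \<Longrightarrow> NC \<alpha> x = NC \<beta> x"
  shows "\<alpha> = \<beta>"
proof -
  have ext: "NC \<gamma> \<in> extensional (Ob (FDom F))" if "\<gamma> \<in> Ntrs F G" for \<gamma>
    using that unfolding Ntrs_def by blast
  have "NC \<alpha> = NC \<beta>"
  proof (rule extensionalityI[of _ "Ob C"])
    show "NC \<alpha> \<in> extensional (Ob C)" "NC \<beta> \<in> extensional (Ob C)"
      using ext[OF assms(1)] ext[OF assms(2)] Funs_FDom[OF assms(3)] by simp_all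
  qed (rule assms(4))
  moreover have "NSrc \<alpha> = NSrc \<beta>" "NTgt \<alpha> = NTgt \<beta>"
    using assms(1,2) by (simp_all add: Ntrs_def)
  ultimately show ?thesis by (cases \<alpha>; cases \<beta>) simp
qed

lemma fcomp_assoc:
  "F \<in> Funs C D \<Longrightarrow> G \<in> Funs D E \<Longrightarrow> (H \<circ>\<^sub>F G) \<circ>\<^sub>F F = H \<circ>\<^sub>F (G \<circ>\<^sub>F F)"
  by (simp add: fcomp_def mk_ftor_def fun_eq_iff restrict_def Funs_def PiE_iff)

lemma fcomp_idf: "F \<in> Funs C D \<Longrightarrow> F \<circ>\<^sub>F idf C = F"
  and idf_fcomp: "F \<in> Funs C D \<Longrightarrow> idf D \<circ>\<^sub>F F = F"
  by (cases F; simp add: fcomp_def idf_def mk_ftor_def Funs_def PiE_iff restrict_def fun_eq_iff extensional_def)+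

section \<open>Natural transformations, vertical composition and whiskering\<close>

lemma mk_nt_Ntrs:
  assumes F: "F \<in> Funs C D" and G: "G \<in> Funs C D" and C: "category C"
    and hom: "\<And>x. x \<in> Ob C \<Longrightarrow> c x \<in> hom D (FO F x) (FO G x)"
    and nat: "\<And>f x y. f \<in> hom C x y \<Longrightarrow> Cmp D (c y) (FA F f) = Cmp D (FA G f) (c x)"
  shows "mk_nt F G c \<in> Ntrs F G"
proof -
  have "Src C f \<in> Ob C" "Tgt C f \<in> Ob C"
    "Cmp D (c (Tgt C f)) (FA F f) = Cmp D (FA G f) (c (Src C f))" if "f \<in> Ar C" for f
    using hom_Ob1[OF C homI[OF that refl refl]] hom_Ob2[OF C homI[OF that refl refl]]
      nat[OF homI[OF that refl refl]] by simp_all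
  then show ?thesis
    using hom by (simp add: Ntrs_def mk_nt_def Funs_FDom[OF F] Funs_FDom[OF G] Funs_FCod[OF F] Funs_FCod[OF G])
qed

lemma NC_mk_nt: "F \<in> Funs C D \<Longrightarrow> x \<in> Ob C \<Longrightarrow> NC (mk_nt F G c) x = c x"
  by (simp add: mk_nt_def Funs_FDom)

lemma NSrc: "\<alpha> \<in> Ntrs F G \<Longrightarrow> NSrc \<alpha> = F" and NTgt: "\<alpha> \<in> Ntrs F G \<Longrightarrow> NTgt \<alpha> = G"
  by (simp_all add: Ntrs_def)

lemma vcomp_Ntrs:
  assumes C: "category C" and D: "category D"
    and F: "F \<in> Funs C D" and G: "G \<in> Funs C D" and H: "H \<in> Funs C D"
    and \<alpha>: "\<alpha> \<in> Ntrs F G" and \<beta>: "\<beta> \<in> Ntrs G H"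
  shows "\<beta> \<bullet> \<alpha> \<in> Ntrs F H"
  unfolding vcomp_def NSrc[OF \<alpha>] NTgt[OF \<beta>] Funs_FCod[OF F]
proof (rule mk_nt_Ntrs[OF F H C])
  show "Cmp D (NC \<beta> x) (NC \<alpha> x) \<in> hom D (FO F x) (FO H x)" if "x \<in> Ob C" for x
    using Cmp_hom[OF D NC_hom[OF \<alpha> F that] NC_hom[OF \<beta> G that]] .
next
  fix f x y assume f: "f \<in> hom C x y"
  note x = hom_Ob1[OF C f] and y = hom_Ob2[OF C f]
  note ax = NC_hom[OF \<alpha> F x] and ay = NC_hom[OF \<alpha> F y] and bx = NC_hom[OF \<beta> G x] and "by" = NC_hom[OF \<beta> G y]
  have "Cmp D (Cmp D (NC \<beta> y) (NC \<alpha> y)) (FA F f) = Cmp D (NC \<beta> y) (Cmp D (FA G f) (NC \<alpha> x))"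
    using Cmp_assoc[OF D FA_hom[OF F f] ay "by"] NC_nat[OF \<alpha> F f] by simp
  also have "\<dots> = Cmp D (Cmp D (FA H f) (NC \<beta> x)) (NC \<alpha> x)"
    using Cmp_assoc[OF D ax FA_hom[OF G f] "by"] NC_nat[OF \<beta> G f] by simp
  also have "\<dots> = Cmp D (FA H f) (Cmp D (NC \<beta> x) (NC \<alpha> x))"
    using Cmp_assoc[OF D ax bx FA_hom[OF H f]] .
  finally show "Cmp D (Cmp D (NC \<beta> y) (NC \<alpha> y)) (FA F f) = Cmp D (FA H f) (Cmp D (NC \<beta> x) (NC \<alpha> x))" .
qed

lemma NC_vcomp:
  "\<alpha> \<in> Ntrs F G \<Longrightarrow> F \<in> Funs C D \<Longrightarrow> x \<in> Ob C \<Longrightarrow> NC (\<beta> \<bullet> \<alpha>) x = Cmp D (NC \<beta> x) (NC \<alpha> x)"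
  unfolding vcomp_def by (simp add: NSrc NC_mk_nt Funs_FCod)

lemma lwhisker_Ntrs:
  assumes C: "category C" and F: "F \<in> Funs C D" and G: "G \<in> Funs C D" and H: "H \<in> Funs D E"
    and \<alpha>: "\<alpha> \<in> Ntrs F G"
  shows "lwhisker H \<alpha> \<in> Ntrs (H \<circ>\<^sub>F F) (H \<circ>\<^sub>F G)"
  unfolding lwhisker_def NSrc[OF \<alpha>] NTgt[OF \<alpha>]
proof (rule mk_nt_Ntrs[OF fcomp_Funs[OF F H C] fcomp_Funs[OF G H C] C])
  show "FA H (NC \<alpha> x) \<in> hom E (FO (H \<circ>\<^sub>F F) x) (FO (H \<circ>\<^sub>F G) x)" if "x \<in> Ob C" for x
    using FA_hom[OF H NC_hom[OF \<alpha> F that]] by (simp add: FO_fcomp[OF F that] FO_fcomp[OF G that])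
  show "Cmp E (FA H (NC \<alpha> y)) (FA (H \<circ>\<^sub>F F) f) = Cmp E (FA (H \<circ>\<^sub>F G) f) (FA H (NC \<alpha> x))"
    if f: "f \<in> hom C x y" for f x y
    using FA_Cmp[OF H FA_hom[OF F f] NC_hom[OF \<alpha> F hom_Ob2[OF C f]]]
      FA_Cmp[OF H NC_hom[OF \<alpha> F hom_Ob1[OF C f]] FA_hom[OF G f]] NC_nat[OF \<alpha> F f]
    by (simp add: FA_fcomp[OF F hom_Ar[OF f]] FA_fcomp[OF G hom_Ar[OF f]])
qed

lemma NC_lwhisker: "\<alpha> \<in> Ntrs F G \<Longrightarrow> F \<in> Funs C D \<Longrightarrow> x \<in> Ob C \<Longrightarrow> NC (lwhisker H \<alpha>) x = FA H (NC \<alpha> x)"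
  by (simp add: lwhisker_def NSrc mk_nt_def fcomp_def mk_ftor_def Funs_FDom)

lemma rwhisker_Ntrs:
  assumes B: "category B" and F: "F \<in> Funs C D" and G: "G \<in> Funs C D" and H: "H \<in> Funs B C"
    and \<alpha>: "\<alpha> \<in> Ntrs F G"
  shows "rwhisker \<alpha> H \<in> Ntrs (F \<circ>\<^sub>F H) (G \<circ>\<^sub>F H)"
  unfolding rwhisker_def NSrc[OF \<alpha>] NTgt[OF \<alpha>]
proof (rule mk_nt_Ntrs[OF fcomp_Funs[OF H F B] fcomp_Funs[OF H G B] B])
  show "NC \<alpha> (FO H x) \<in> hom D (FO (F \<circ>\<^sub>F H) x) (FO (G \<circ>\<^sub>F H) x)" if "x \<in> Ob B" for x
    using NC_hom[OF \<alpha> F FO_Ob[OF H that]] by (simp add: FO_fcomp[OF H that])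
  show "Cmp D (NC \<alpha> (FO H y)) (FA (F \<circ>\<^sub>F H) f) = Cmp D (FA (G \<circ>\<^sub>F H) f) (NC \<alpha> (FO H x))"
    if f: "f \<in> hom B x y" for f x y
    using NC_nat[OF \<alpha> F FA_hom[OF H f]] by (simp add: FA_fcomp[OF H hom_Ar[OF f]])
qed

lemma NC_rwhisker: "H \<in> Funs B C \<Longrightarrow> x \<in> Ob B \<Longrightarrow> NC (rwhisker \<alpha> H) x = NC \<alpha> (FO H x)"
  by (simp add: rwhisker_def mk_nt_def fcomp_def mk_ftor_def Funs_FDom)

lemma NC_idn: "F \<in> Funs C D \<Longrightarrow> x \<in> Ob C \<Longrightarrow> NC (idn F) x = Idn D (FO F x)"
  by (simp add: idn_def mk_nt_def Funs_FDom Funs_FCod)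

section \<open>Smallness of the terminal category and of products\<close>

context
  fixes U :: "'a code set set"
  assumes U: "universe U"
begin

lemma universe_finite: "finite X \<Longrightarrow> X \<in> U"
  and universe_subset: "X \<in> U \<Longrightarrow> Y \<subseteq> X \<Longrightarrow> Y \<in> U"
  and universe_UN: "I \<in> U \<Longrightarrow> (\<And>i. i \<in> I \<Longrightarrow> F i \<in> U) \<Longrightarrow> (\<Union>i\<in>I. F i) \<in> U"
  using U by (auto simp: universe_def)

text \<open>A set of pairs is a union over \<open>X\<close> of unions over \<open>Y\<close> of
  singletons, so two uses of closure under unions suffice.\<close>

lemma universe_Pr:
  assumes "X \<in> U" and "Y \<in> U"
  shows "{Pr x y | x y. x \<in> X \<and> y \<in> Y} \<in> U"
proof -
  have "{Pr x y | x y. x \<in> X \<and> y \<in> Y} = (\<Union>x\<in>X. \<Union>y\<in>Y. {Pr x y})" by auto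
  also have "\<dots> \<in> U" by (intro universe_UN assms universe_finite) simp
  finally show ?thesis .
qed

lemma one_Cat: "one \<in> Cat U"
  unfolding Cat_def one_def
  by (auto intro!: category_mk_cat universe_finite simp: mk_cat_simps)

lemma sprod_Cat:
  assumes A: "A \<in> Cat U" and B: "B \<in> Cat U"
  shows "A \<times>\<^sub>C B \<in> Cat U"
proof -
  have a: "category A" and b: "category B" using assms by (auto simp: Cat_def)
  have [simp]: "Src A f \<in> Ob A" "Tgt A f \<in> Ob A" "Cmp A f (Idn A (Src A f)) = f"
    "Cmp A (Idn A (Tgt A f)) f = f" if "f \<in> Ar A" for f
    using that a by (auto simp: category_def)
  have [simp]: "Src B f \<in> Ob B" "Tgt B f \<in> Ob B" "Cmp B f (Idn B (Src B f)) = f"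
    "Cmp B (Idn B (Tgt B f)) f = f" if "f \<in> Ar B" for f
    using that b by (auto simp: category_def)
  have [simp]: "Idn A x \<in> Ar A" "Src A (Idn A x) = x" "Tgt A (Idn A x) = x" if "x \<in> Ob A" for x
    using that a by (auto simp: category_def)
  have [simp]: "Idn B x \<in> Ar B" "Src B (Idn B x) = x" "Tgt B (Idn B x) = x" if "x \<in> Ob B" for x
    using that b by (auto simp: category_def)
  have [simp]: "Cmp A g f \<in> Ar A" "Src A (Cmp A g f) = Src A f" "Tgt A (Cmp A g f) = Tgt A g"
    if "f \<in> Ar A" "g \<in> Ar A" "Src A g = Tgt A f" for g f
    using that a by (auto simp: category_def composable_def)
  have [simp]: "Cmp B g f \<in> Ar B" "Src B (Cmp B g f) = Src B f" "Tgt B (Cmp B g f) = Tgt B g"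
    if "f \<in> Ar B" "g \<in> Ar B" "Src B g = Tgt B f" for g f
    using that b by (auto simp: category_def composable_def)
  have "Cmp A h (Cmp A g f) = Cmp A (Cmp A h g) f"
    if "f \<in> Ar A" "g \<in> Ar A" "h \<in> Ar A" "Src A g = Tgt A f" "Src A h = Tgt A g" for h g f
    using that a by (auto simp: category_def composable_def)
  moreover have "Cmp B h (Cmp B g f) = Cmp B (Cmp B h g) f"
    if "f \<in> Ar B" "g \<in> Ar B" "h \<in> Ar B" "Src B g = Tgt B f" "Src B h = Tgt B g" for h g f
    using that b by (auto simp: category_def composable_def)
  ultimately have "category (A \<times>\<^sub>C B)"
    unfolding sprod_def by (intro category_mk_cat) auto
  moreover have "Ob (A \<times>\<^sub>C B) \<in> U" "Ar (A \<times>\<^sub>C B) \<in> U"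
    using assms by (auto simp: sprod_def mk_cat_simps Cat_def intro!: universe_Pr)
  ultimately show ?thesis by (simp add: Cat_def)
qed

end

lemma Cat_category: "A \<in> Cat U \<Longrightarrow> category A"
  by (simp add: Cat_def)

section \<open>Comma categories\<close>

locale cospan =
  fixes A B C :: "'a scat" and u w :: "'a sftor"
  assumes A: "category A" and B: "category B" and C: "category C"
    and u: "u \<in> Funs A B" and w: "w \<in> Funs C B"
begin

lemma comma_ob_iff:
  "Pr (Pr a c) f \<in> comma_ob u w \<longleftrightarrow> a \<in> Ob A \<and> c \<in> Ob C \<and> f \<in> hom B (FO u a) (FO w c)"
  by (auto simp: comma_ob_def Funs_FDom[OF u] Funs_FDom[OF w] Funs_FCod[OF u])

lemma comma_obE:
  assumes "x \<in> comma_ob u w"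
  obtains a c f where "x = Pr (Pr a c) f" "a \<in> Ob A" "c \<in> Ob C" "f \<in> hom B (FO u a) (FO w c)"
  using assms by (auto simp: comma_ob_def Funs_FDom[OF u] Funs_FDom[OF w] Funs_FCod[OF u])

lemma comma_ar_iff:
  "Pr (Pr (Pr (Pr a c) f) (Pr (Pr a' c') f')) (Pr g h) \<in> comma_ar u w \<longleftrightarrow>
     Pr (Pr a c) f \<in> comma_ob u w \<and> Pr (Pr a' c') f' \<in> comma_ob u w \<and>
     g \<in> hom A a a' \<and> h \<in> hom C c c' \<and> Cmp B f' (FA u g) = Cmp B (FA w h) f"
  by (auto simp: comma_ar_def Funs_FDom[OF u] Funs_FDom[OF w] Funs_FCod[OF u])

lemma comma_arE:
  assumes "k \<in> comma_ar u w"
  obtains a c f a' c' f' g h where "k = Pr (Pr (Pr (Pr a c) f) (Pr (Pr a' c') f')) (Pr g h)"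
    "a \<in> Ob A" "c \<in> Ob C" "f \<in> hom B (FO u a) (FO w c)"
    "a' \<in> Ob A" "c' \<in> Ob C" "f' \<in> hom B (FO u a') (FO w c')"
    "g \<in> hom A a a'" "h \<in> hom C c c'" "Cmp B f' (FA u g) = Cmp B (FA w h) f"
  using assms by (auto simp: comma_ar_def comma_ob_def Funs_FDom[OF u] Funs_FDom[OF w] Funs_FCod[OF u])

text \<open>Two commuting squares with a common edge \<open>f'\<close>, placed side by side.\<close>

lemma comma_ar_Cmp:
  assumes k: "Pr (Pr (Pr (Pr a c) f) (Pr (Pr a' c') f')) (Pr g h) \<in> comma_ar u w"
    and l: "Pr (Pr (Pr (Pr a' c') f') (Pr (Pr a'' c'') f'')) (Pr g' h') \<in> comma_ar u w"
  shows "Pr (Pr (Pr (Pr a c) f) (Pr (Pr a'' c'') f'')) (Pr (Cmp A g' g) (Cmp C h' h)) \<in> comma_ar u w"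
proof -
  have f: "f \<in> hom B (FO u a) (FO w c)" "f' \<in> hom B (FO u a') (FO w c')" "f'' \<in> hom B (FO u a'') (FO w c'')"
    and g: "g \<in> hom A a a'" "h \<in> hom C c c'" "g' \<in> hom A a' a''" "h' \<in> hom C c' c''"
    and e: "Cmp B f' (FA u g) = Cmp B (FA w h) f" "Cmp B f'' (FA u g') = Cmp B (FA w h') f'"
    using k l by (simp_all add: comma_ar_iff comma_ob_iff)
  note ug = FA_hom[OF u g(1)] FA_hom[OF u g(3)] and wh = FA_hom[OF w g(2)] FA_hom[OF w g(4)]
  have "Cmp B f'' (FA u (Cmp A g' g)) = Cmp B (Cmp B (FA w h') f') (FA u g)"
    using FA_Cmp[OF u g(1,3)] Cmp_assoc[OF B ug f(3)] e(2) by simp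
  also have "\<dots> = Cmp B (FA w (Cmp C h' h)) f"
    using FA_Cmp[OF w g(2,4)] Cmp_assoc[OF B ug(1) f(2) wh(2)] Cmp_assoc[OF B f(1) wh] e(1) by simp
  finally show ?thesis
    using k l Cmp_hom[OF A g(1,3)] Cmp_hom[OF C g(2,4)] by (simp add: comma_ar_iff)
qed

lemma category_comma: "category (comma u w)"
  unfolding comma_def Funs_FDom[OF u] Funs_FDom[OF w]
proof (rule category_mk_cat, goal_cases)
  case (1 f) then show ?case by (elim comma_arE) (simp add: comma_ob_iff)
next
  case (2 f) then show ?case by (elim comma_arE) (simp add: comma_ob_iff)
next
  case (3 x)
  then show ?case
    by (elim comma_obE) (simp add: comma_ar_iff comma_ob_iff Idn_hom A C FA_Idn[OF u] FA_Idn[OF w] Cmp_Idn[OF B] Idn_Cmp[OF B])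
next
  case (6 g f)
  obtain a c x a' c' x' k h where f: "f = Pr (Pr (Pr (Pr a c) x) (Pr (Pr a' c') x')) (Pr k h)"
    using 6(1) by (rule comma_arE)
  obtain b d y b' d' y' l m where g: "g = Pr (Pr (Pr (Pr b d) y) (Pr (Pr b' d') y')) (Pr l m)"
    using 6(2) by (rule comma_arE)
  have "b = a'" "d = c'" "y = x'" using 6(3) f g by simp_all
  then show ?case using comma_ar_Cmp 6(1,2) f g by simp
next
  case (9 f) then show ?case by (elim comma_arE) (simp add: Cmp_Idn[OF A] Cmp_Idn[OF C])
next
  case (10 f) then show ?case by (elim comma_arE) (simp add: Idn_Cmp[OF A] Idn_Cmp[OF C])
next
  case (11 h g f) then show ?case
    by (elim comma_arE) (auto simp: Cmp_assoc[OF A] Cmp_assoc[OF C])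
qed simp_all

lemma hom_comma:
  "k \<in> hom (comma u w) x y \<longleftrightarrow> k \<in> comma_ar u w \<and> cfst (cfst k) = x \<and> csnd (cfst k) = y"
  by (simp add: comma_def hom_mk_cat)

lemma Ob_comma: "Ob (comma u w) = comma_ob u w"
  and Idn_comma: "x \<in> comma_ob u w \<Longrightarrow>
    Idn (comma u w) x = Pr (Pr x x) (Pr (Idn A (cfst (cfst x))) (Idn C (csnd (cfst x))))"
  by (simp_all add: comma_def mk_cat_simps Funs_FDom[OF u] Funs_FDom[OF w])

lemma Cmp_comma:
  "k \<in> hom (comma u w) x y \<Longrightarrow> l \<in> hom (comma u w) y z \<Longrightarrow>
    Cmp (comma u w) l k = Pr (Pr x z) (Pr (Cmp A (cfst (csnd l)) (cfst (csnd k))) (Cmp C (csnd (csnd l)) (csnd (csnd k))))"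
  unfolding hom_comma by (auto simp: comma_def Cmp_mk_cat Funs_FDom[OF u] Funs_FDom[OF w])

lemma comma_pr1_Funs: "comma_pr1 u w \<in> Funs (comma u w) A"
  unfolding comma_pr1_def Funs_FDom[OF u]
  by (rule mk_ftor_Funs[OF category_comma])
    (auto simp: Ob_comma hom_comma Idn_comma Cmp_comma[unfolded hom_comma] elim!: comma_obE comma_arE)

lemma comma_pr2_Funs: "comma_pr2 u w \<in> Funs (comma u w) C"
  unfolding comma_pr2_def Funs_FDom[OF w]
  by (rule mk_ftor_Funs[OF category_comma])
    (auto simp: Ob_comma hom_comma Idn_comma Cmp_comma[unfolded hom_comma] elim!: comma_obE comma_arE)

text \<open>The component at an object \<open>Pr (Pr a c) f\<close> is \<open>f\<close> itself, and
  naturality is the commutation condition in \<open>comma_ar\<close>.\<close>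

lemma comma_nt_Ntrs: "comma_nt u w \<in> Ntrs (u \<circ>\<^sub>F comma_pr1 u w) (w \<circ>\<^sub>F comma_pr2 u w)"
  unfolding comma_nt_def
proof (rule mk_nt_Ntrs[OF fcomp_Funs[OF comma_pr1_Funs u category_comma]
      fcomp_Funs[OF comma_pr2_Funs w category_comma] category_comma])
  fix x assume x: "x \<in> Ob (comma u w)"
  then show "csnd x \<in> hom B (FO (u \<circ>\<^sub>F comma_pr1 u w) x) (FO (w \<circ>\<^sub>F comma_pr2 u w) x)"
    using FO_fcomp[OF comma_pr1_Funs x, of u] FO_fcomp[OF comma_pr2_Funs x, of w] unfolding Ob_comma
    by (elim comma_obE) (simp add: comma_pr1_def comma_pr2_def mk_ftor_def Ob_comma comma_ob_iff)
next
  fix k x y assume k: "k \<in> hom (comma u w) x y"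
  have "FA (u \<circ>\<^sub>F comma_pr1 u w) k = FA u (cfst (csnd k))"
    "FA (w \<circ>\<^sub>F comma_pr2 u w) k = FA w (csnd (csnd k))"
    using FA_fcomp[OF comma_pr1_Funs hom_Ar[OF k], of u] FA_fcomp[OF comma_pr2_Funs hom_Ar[OF k], of w] hom_Ar[OF k]
    by (simp_all add: comma_pr1_def comma_pr2_def mk_ftor_def)
  then show "Cmp B (csnd y) (FA (u \<circ>\<^sub>F comma_pr1 u w) k) = Cmp B (FA (w \<circ>\<^sub>F comma_pr2 u w) k) (csnd x)"
    using k unfolding hom_comma by (auto elim!: comma_arE)
qed

end

text \<open>Objects and arrows lie in iterated sets of pairs over small sets, and a subset of a
  small set is small.\<close>

lemma comma_Cat:
  assumes U: "universe U" and A: "A \<in> Cat U" and B: "B \<in> Cat U" and C: "C \<in> Cat U"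
    and u: "u \<in> Funs A B" and w: "w \<in> Funs C B"
  shows "comma u w \<in> Cat U"
proof -
  interpret cospan A B C u w
    by unfold_locales (use assms in \<open>auto simp: Cat_def\<close>)
  have ob: "comma_ob u w \<in> U"
  proof (rule universe_subset[OF U])
    show "{Pr p f | p f. p \<in> {Pr a c | a c. a \<in> Ob A \<and> c \<in> Ob C} \<and> f \<in> Ar B} \<in> U"
      using assms by (intro universe_Pr[OF U]) (auto simp: Cat_def)
    show "comma_ob u w \<subseteq> {Pr p f | p f. p \<in> {Pr a c | a c. a \<in> Ob A \<and> c \<in> Ob C} \<and> f \<in> Ar B}"
      by (auto elim!: comma_obE dest: hom_Ar)
  qed
  have "comma_ar u w \<in> U"
  proof (rule universe_subset[OF U])
    show "{Pr p f | p f. p \<in> {Pr x y | x y. x \<in> comma_ob u w \<and> y \<in> comma_ob u w} \<and>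
        f \<in> {Pr g h | g h. g \<in> Ar A \<and> h \<in> Ar C}} \<in> U" (is "?X \<in> U")
      using assms ob by (intro universe_Pr[OF U]) (auto simp: Cat_def)
    show "comma_ar u w \<subseteq> ?X"
      by (auto elim!: comma_arE simp: comma_ob_iff dest: hom_Ar)
  qed
  then show ?thesis
    using ob category_comma by (simp add: Cat_def comma_def mk_cat_simps)
qed

section \<open>Exactness in a derivator is tested on points\<close>

context lax_square
begin

lemma lan_exact_at_iff:
  "universal U X Y e \<Longrightarrow> lan_exact_at P W Q U a X \<longleftrightarrow> universal W (FO P X) (FO Q Y) (Cmp K (a Y) (FA P e))"
  using lan_exact_atI lan_exact_atD by blast

lemma ran_exact_at_iff:
  "couniversal Q X Y e \<Longrightarrow> ran_exact_at P W Q U a X \<longleftrightarrow> couniversal P (FO W X) (FO U Y) (Cmp K (FA W e) (a Y))"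
  using ran_exact_atI ran_exact_atD by blast

text \<open>The left side has the shape shared by \<open>lmate\<close> and \<open>ext_lan1\<close>,
  with \<open>F\<close> applied to the two factors separately. By functoriality of \<open>F\<close>
  it is the transpose of the arrow tested in \<open>lan_exact_at\<close>.\<close>

lemma is_iso_left_mate:
  assumes adj: "adjoint_functors K M F W \<eta> \<epsilon>" and e: "universal U X Y e"
  shows "is_iso M (Cmp M (NC \<epsilon> (FO Q Y)) (Cmp M (FA F (a Y)) (FA F (FA P e)))) \<longleftrightarrow>
    lan_exact_at P W Q U a X"
proof -
  interpret F: adjoint_functors K M F W \<eta> \<epsilon> by fact
  note y = U.universal_Ob[OF e] and Pe = FA_hom[OF P U.universal_hom[OF e]]
  show ?thesis
    using F.is_iso_transpose_left[OF FO_Ob[OF Q y] Cmp_hom[OF K Pe hom[OF y]]] lan_exact_at_iff[OF e]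
      FA_Cmp[OF F.F Pe hom[OF y]] by simp
qed

text \<open>The left side has the shape shared by \<open>rmate\<close> and
  \<open>rhom_map1\<close>.\<close>

lemma is_iso_right_mate:
  assumes adj: "adjoint_functors A K P G \<eta> \<epsilon>" and e: "couniversal Q X Y e"
  shows "is_iso A (Cmp A (FA G (FA W e)) (Cmp A (FA G (a Y)) (NC \<eta> (FO U Y)))) \<longleftrightarrow>
    ran_exact_at P W Q U a X"
proof -
  interpret G: adjoint_functors A K P G \<eta> \<epsilon> by fact
  note y = Q.couniversal_Ob[OF e] and We = FA_hom[OF W Q.couniversal_hom[OF e]]
  have "Cmp A (FA G (FA W e)) (Cmp A (FA G (a Y)) (NC \<eta> (FO U Y))) =
      Cmp A (FA G (Cmp K (FA W e) (a Y))) (NC \<eta> (FO U Y))"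
    using FA_Cmp[OF G.G hom[OF y] We]
      Cmp_assoc[OF A G.unit[OF FO_Ob[OF U y]] FA_hom[OF G.G hom[OF y]] FA_hom[OF G.G We]] by simp
  then show ?thesis
    using G.is_iso_transpose_right[OF FO_Ob[OF U y] Cmp_hom[OF K hom[OF y] We]] ran_exact_at_iff[OF e]
    by simp
qed

end

lemma lan_exact_cong:
  assumes "\<And>Y. Y \<in> Ob (FDom U) \<Longrightarrow> a Y = b Y"
  shows "lan_exact P W Q U a = lan_exact P W Q U b"
  using assms by (auto simp: lan_exact_def lan_exact_at_def universal_def)

lemma ran_exact_cong:
  assumes "\<And>Y. Y \<in> Ob (FDom Q) \<Longrightarrow> a Y = b Y"
  shows "ran_exact P W Q U a = ran_exact P W Q U b"
  using assms by (auto simp: ran_exact_def ran_exact_at_def couniversal_def)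

abbreviation lan_exact_in where
  "lan_exact_in D p v u q \<alpha> \<equiv> lan_exact (PF D p) (PF D v) (PF D q) (PF D u) (NC (PN D \<alpha>))"

abbreviation ran_exact_in where
  "ran_exact_in D p v u q \<alpha> \<equiv> ran_exact (PF D p) (PF D v) (PF D q) (PF D u) (NC (PN D \<alpha>))"

locale small_square =
  fixes U :: "'a code set set" and K A M B :: "'a scat" and p v u q :: "'a sftor" and \<alpha> :: "'a sntrans"
  assumes U: "universe U"
    and K: "K \<in> Cat U" and A: "A \<in> Cat U" and M: "M \<in> Cat U" and B: "B \<in> Cat U"
    and p: "p \<in> Funs K A" and v: "v \<in> Funs K M" and u: "u \<in> Funs A B" and q: "q \<in> Funs M B"
    and \<alpha>: "\<alpha> \<in> Ntrs (u \<circ>\<^sub>F p) (q \<circ>\<^sub>F v)"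
begin

lemmas category = K[THEN Cat_category] A[THEN Cat_category] M[THEN Cat_category] B[THEN Cat_category]
lemmas up = fcomp_Funs[OF p u category(1)] and qv = fcomp_Funs[OF v q category(1)]

end

section \<open>The axioms of a derivator in terms of universal arrows\<close>

locale in_universe =
  fixes U :: "'a code set set" and D :: "('a, 'o, 'm) prederiv"
  assumes U: "universe U" and derivator: "derivator U D"
begin

lemma prederivator: "prederivator U D" and der2: "der2 U D" and der3: "der3 U D" and der4: "der4 U D"
  using derivator by (simp_all add: derivator_def)

lemma PD_category: "A \<in> Cat U \<Longrightarrow> category (PD D A)"
  using prederivator unfolding prederivator_def by (elim conjE) blast

lemma PF_Funs: "A \<in> Cat U \<Longrightarrow> B \<in> Cat U \<Longrightarrow> u \<in> Funs A B \<Longrightarrow> PF D u \<in> Funs (PD D B) (PD D A)"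
  using prederivator unfolding prederivator_def by (elim conjE) blast

lemma PN_Ntrs: "A \<in> Cat U \<Longrightarrow> B \<in> Cat U \<Longrightarrow> u \<in> Funs A B \<Longrightarrow> v \<in> Funs A B \<Longrightarrow> \<alpha> \<in> Ntrs u v \<Longrightarrow>
    PN D \<alpha> \<in> Ntrs (PF D u) (PF D v)"
  using prederivator unfolding prederivator_def by (elim conjE) blast

lemma PF_idf: "A \<in> Cat U \<Longrightarrow> PF D (idf A) = idf (PD D A)"
  using prederivator unfolding prederivator_def by (elim conjE) blast

lemma PF_fcomp: "A \<in> Cat U \<Longrightarrow> B \<in> Cat U \<Longrightarrow> C \<in> Cat U \<Longrightarrow> u \<in> Funs A B \<Longrightarrow> w \<in> Funs B C \<Longrightarrow>
    PF D (w \<circ>\<^sub>F u) = PF D u \<circ>\<^sub>F PF D w"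
  using prederivator unfolding prederivator_def by (elim conjE) blast

lemma PN_idn: "A \<in> Cat U \<Longrightarrow> B \<in> Cat U \<Longrightarrow> u \<in> Funs A B \<Longrightarrow> PN D (idn u) = idn (PF D u)"
  using prederivator unfolding prederivator_def by (elim conjE) blast

lemma PN_vcomp: "A \<in> Cat U \<Longrightarrow> B \<in> Cat U \<Longrightarrow> u \<in> Funs A B \<Longrightarrow> v \<in> Funs A B \<Longrightarrow> x \<in> Funs A B \<Longrightarrow>
    \<alpha> \<in> Ntrs u v \<Longrightarrow> \<beta> \<in> Ntrs v x \<Longrightarrow> PN D (\<beta> \<bullet> \<alpha>) = PN D \<beta> \<bullet> PN D \<alpha>"
  using prederivator unfolding prederivator_def by (elim conjE) meson

lemma PN_lwhisker: "A \<in> Cat U \<Longrightarrow> B \<in> Cat U \<Longrightarrow> C \<in> Cat U \<Longrightarrow> u \<in> Funs A B \<Longrightarrow> v \<in> Funs A B \<Longrightarrow>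
    \<alpha> \<in> Ntrs u v \<Longrightarrow> w \<in> Funs B C \<Longrightarrow> PN D (lwhisker w \<alpha>) = rwhisker (PN D \<alpha>) (PF D w)"
  using prederivator unfolding prederivator_def by (elim conjE) meson

lemma PN_rwhisker: "A \<in> Cat U \<Longrightarrow> B \<in> Cat U \<Longrightarrow> C \<in> Cat U \<Longrightarrow> s \<in> Funs B C \<Longrightarrow> t \<in> Funs B C \<Longrightarrow>
    \<beta> \<in> Ntrs s t \<Longrightarrow> u \<in> Funs A B \<Longrightarrow> PN D (rwhisker \<beta> u) = lwhisker (PF D u) (PN D \<beta>)"
  using prederivator unfolding prederivator_def by (elim conjE) meson

lemma functor_between:
  "A \<in> Cat U \<Longrightarrow> B \<in> Cat U \<Longrightarrow> u \<in> Funs A B \<Longrightarrow> functor_between (PD D B) (PD D A) (PF D u)"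
  by unfold_locales (simp_all add: PD_category PF_Funs)

lemma lan_adjoint:
  "A \<in> Cat U \<Longrightarrow> B \<in> Cat U \<Longrightarrow> u \<in> Funs A B \<Longrightarrow>
    adjoint_functors (PD D A) (PD D B) (lan D u) (PF D u) (lan_unit D u) (lan_counit D u)"
  unfolding lan_def lan_unit_def lan_counit_def
  using adjoint_functors_ladj[OF functor_between] der3 by (simp add: der3_def)

lemma ran_adjoint:
  "A \<in> Cat U \<Longrightarrow> B \<in> Cat U \<Longrightarrow> u \<in> Funs A B \<Longrightarrow>
    adjoint_functors (PD D B) (PD D A) (PF D u) (ran D u) (ran_unit D u) (ran_counit D u)"
  unfolding ran_def ran_unit_def ran_counit_def
  using adjoint_functors_radj[OF functor_between] der3 by (simp add: der3_def)

lemma universal_exists: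
  "A \<in> Cat U \<Longrightarrow> B \<in> Cat U \<Longrightarrow> u \<in> Funs A B \<Longrightarrow> X \<in> Ob (PD D A) \<Longrightarrow> \<exists>Y e. universal (PF D u) X Y e"
  using adjoint_functors.unit_universal[OF lan_adjoint] by blast

lemma couniversal_exists:
  "A \<in> Cat U \<Longrightarrow> B \<in> Cat U \<Longrightarrow> u \<in> Funs A B \<Longrightarrow> X \<in> Ob (PD D A) \<Longrightarrow> \<exists>Y e. couniversal (PF D u) X Y e"
  using adjoint_functors.counit_couniversal[OF ran_adjoint] by blast

text \<open>Strictness of the prederivator is what gives the components of
  \<open>PN D \<alpha>\<close> the required source and target without any comparison
  isomorphism.\<close>

lemma lax_square:
  assumes "small_square U K A M B p v u q \<alpha>"
  shows "lax_square (PD D A) (PD D B) (PD D K) (PD D M) (PF D u) (PF D p) (PF D v) (PF D q) (NC (PN D \<alpha>))"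
proof -
  interpret s: small_square U K A M B p v u q \<alpha> by fact
  note F = PF_Funs[OF s.A s.B s.u] PF_Funs[OF s.K s.A s.p] PF_Funs[OF s.K s.M s.v] PF_Funs[OF s.M s.B s.q]
    PF_Funs[OF s.K s.B s.up] PF_Funs[OF s.K s.B s.qv]
  note \<alpha> = PN_Ntrs[OF s.K s.B s.up s.qv s.\<alpha>]
  have up: "PF D (u \<circ>\<^sub>F p) = PF D p \<circ>\<^sub>F PF D u" and qv: "PF D (q \<circ>\<^sub>F v) = PF D v \<circ>\<^sub>F PF D q"
    by (rule PF_fcomp[OF s.K s.A s.B s.p s.u] PF_fcomp[OF s.K s.M s.B s.v s.q])+
  show ?thesis
  proof
    show "NC (PN D \<alpha>) Y \<in> hom (PD D K) (FO (PF D p) (FO (PF D u) Y)) (FO (PF D v) (FO (PF D q) Y))"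
      if "Y \<in> Ob (PD D B)" for Y
      using NC_hom[OF \<alpha> F(5) that] by (simp add: up qv FO_fcomp[OF F(1) that] FO_fcomp[OF F(4) that])
    show "Cmp (PD D K) (NC (PN D \<alpha>) Y') (FA (PF D p) (FA (PF D u) f)) =
        Cmp (PD D K) (FA (PF D v) (FA (PF D q) f)) (NC (PN D \<alpha>) Y)"
      if "f \<in> hom (PD D B) Y Y'" for f Y Y'
      using NC_nat[OF \<alpha> F(5) that]
      by (simp add: up qv FA_fcomp[OF F(1) hom_Ar[OF that]] FA_fcomp[OF F(4) hom_Ar[OF that]])
  qed (simp_all add: PD_category s.A s.B s.K s.M F)
qed

lemma exact_iff_lan_exact_in:
  assumes "small_square U K A M B p v u q \<alpha>"
  shows "exact D p v u q \<alpha> \<longleftrightarrow> lan_exact_in D p v u q \<alpha>"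
proof -
  interpret s: small_square U K A M B p v u q \<alpha> by fact
  interpret l: lax_square "PD D A" "PD D B" "PD D K" "PD D M" "PF D u" "PF D p" "PF D v" "PF D q" "NC (PN D \<alpha>)"
    using lax_square[OF assms] .
  interpret u: adjoint_functors "PD D A" "PD D B" "lan D u" "PF D u" "lan_unit D u" "lan_counit D u"
    using lan_adjoint[OF s.A s.B s.u] .
  show ?thesis
    unfolding exact_def lan_exact_def lmate_def Let_def Funs_FCod[OF s.p] Funs_FCod[OF s.v] l.P.FDom
    using l.is_iso_left_mate[OF lan_adjoint[OF s.K s.M s.v] u.unit_universal] by simp
qed

text \<open>The entry point for the half of Der4 about right Kan extensions.\<close>

lemma is_iso_rmate_imp_ran_exact_in:
  assumes "small_square U K A M B p v u q \<alpha>"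
    and iso: "\<And>X. X \<in> Ob (PD D M) \<Longrightarrow> is_iso (PD D A) (rmate D p v u q \<alpha> X)"
  shows "ran_exact_in D p v u q \<alpha>"
proof -
  interpret s: small_square U K A M B p v u q \<alpha> by fact
  interpret l: lax_square "PD D A" "PD D B" "PD D K" "PD D M" "PF D u" "PF D p" "PF D v" "PF D q" "NC (PN D \<alpha>)"
    using lax_square[OF assms(1)] .
  interpret q: adjoint_functors "PD D B" "PD D M" "PF D q" "ran D q" "ran_unit D q" "ran_counit D q"
    using ran_adjoint[OF s.M s.B s.q] .
  show ?thesis
    using iso unfolding ran_exact_def rmate_def Let_def Funs_FCod[OF s.p] l.W.FDom
    using l.is_iso_right_mate[OF ran_adjoint[OF s.K s.A s.p] q.counit_couniversal] by simp
qed

text \<open>Der3 provides a universal arrow for restriction along \<open>u\<close> and a couniversal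
  one for restriction along \<open>q\<close> at every object, which is what the two implications
  between the conditions ask for.\<close>

lemma lan_exact_in_iff_ran_exact_in:
  assumes "small_square U K A M B p v u q \<alpha>"
  shows "lan_exact_in D p v u q \<alpha> \<longleftrightarrow> ran_exact_in D p v u q \<alpha>"
proof -
  interpret s: small_square U K A M B p v u q \<alpha> by fact
  interpret l: lax_square "PD D A" "PD D B" "PD D K" "PD D M" "PF D u" "PF D p" "PF D v" "PF D q" "NC (PN D \<alpha>)"
    using lax_square[OF assms(1)] .
  show ?thesis
    using l.lan_exact_imp_ran_exact universal_exists[OF s.A s.B s.u] l.ran_exact_imp_lan_exact couniversal_exists[OF s.M s.B s.q]
    by blast
qed

text \<open>Der2, in the form of the hypothesis \<open>cons\<close> of the cancellation
  lemmas.\<close>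

lemma is_iso_pointwise:
  assumes "A \<in> Cat U" and "f \<in> Ar (PD D A)"
    and "\<And>a. a \<in> Funs one A \<Longrightarrow> is_iso (PD D one) (FA (PF D a) f)"
  shows "is_iso (PD D A) f"
  using der2 assms unfolding der2_def by blast

end

text \<open>The square \<alpha> with the comma square of \<open>v\<close> and \<open>m\<close>
  attached on the side of \<open>M\<close>. Writing p1, p2 for the comma projections, it is the
  composite u p p1 -> q v p1 -> q m p2.\<close>

definition paste_right :: "'a sftor \<Rightarrow> 'a sftor \<Rightarrow> 'a sntrans \<Rightarrow> 'a sftor \<Rightarrow> 'a sntrans" where
  "paste_right v q \<alpha> m = lwhisker q (comma_nt v m) \<bullet> rwhisker \<alpha> (comma_pr1 v m)"

text \<open>The square \<alpha> with the comma square of \<open>a\<close> and \<open>p\<close>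
  attached on the side of \<open>A\<close>: the composite u a p1 -> u p p2 -> q v p2.\<close>

definition paste_left :: "'a sftor \<Rightarrow> 'a sftor \<Rightarrow> 'a sntrans \<Rightarrow> 'a sftor \<Rightarrow> 'a sntrans" where
  "paste_left p u \<alpha> a = rwhisker \<alpha> (comma_pr2 a p) \<bullet> lwhisker u (comma_nt a p)"

context small_square
begin

lemma one: "one \<in> Cat U"
  using one_Cat[OF U] .

context
  fixes m :: "'a sftor" assumes m: "m \<in> Funs one M"
begin

interpretation c: cospan K M one v m
  by unfold_locales (simp_all add: v m category Cat_category[OF one])

lemma comma_right: "comma v m \<in> Cat U"
  using comma_Cat[OF U K M one v m] .

lemma right_comma_square: "small_square U (comma v m) K one M (comma_pr1 v m) (comma_pr2 v m) v m (comma_nt v m)"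
  by unfold_locales
    (simp_all add: U K M one v m comma_right c.comma_pr1_Funs c.comma_pr2_Funs c.comma_nt_Ntrs)

lemma paste_right_parts:
  shows "rwhisker \<alpha> (comma_pr1 v m) \<in> Ntrs (u \<circ>\<^sub>F p \<circ>\<^sub>F comma_pr1 v m) (q \<circ>\<^sub>F v \<circ>\<^sub>F comma_pr1 v m)"
    and "lwhisker q (comma_nt v m) \<in> Ntrs (q \<circ>\<^sub>F v \<circ>\<^sub>F comma_pr1 v m) ((q \<circ>\<^sub>F m) \<circ>\<^sub>F comma_pr2 v m)"
  using rwhisker_Ntrs[OF c.category_comma up qv c.comma_pr1_Funs \<alpha>]
    lwhisker_Ntrs[OF c.category_comma fcomp_Funs[OF c.comma_pr1_Funs v c.category_comma]
      fcomp_Funs[OF c.comma_pr2_Funs m c.category_comma] q c.comma_nt_Ntrs]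
  by (simp_all add: fcomp_assoc[OF c.comma_pr1_Funs p] fcomp_assoc[OF c.comma_pr1_Funs v]
      fcomp_assoc[OF c.comma_pr2_Funs m])

lemmas right_Funs =
  fcomp_Funs[OF fcomp_Funs[OF c.comma_pr1_Funs p c.category_comma] u c.category_comma]
  fcomp_Funs[OF fcomp_Funs[OF c.comma_pr1_Funs v c.category_comma] q c.category_comma]
  fcomp_Funs[OF c.comma_pr2_Funs fcomp_Funs[OF m q Cat_category[OF one]] c.category_comma]

lemma paste_right_square:
  "small_square U (comma v m) A one B (p \<circ>\<^sub>F comma_pr1 v m) (comma_pr2 v m) u (q \<circ>\<^sub>F m) (paste_right v q \<alpha> m)"
proof
  show "paste_right v q \<alpha> m \<in> Ntrs (u \<circ>\<^sub>F p \<circ>\<^sub>F comma_pr1 v m) ((q \<circ>\<^sub>F m) \<circ>\<^sub>F comma_pr2 v m)"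
    unfolding paste_right_def
    using vcomp_Ntrs[OF c.category_comma category(4) right_Funs paste_right_parts] .
qed (simp_all add: U A B one comma_right u c.comma_pr2_Funs fcomp_Funs[OF c.comma_pr1_Funs p c.category_comma]
    fcomp_Funs[OF m q Cat_category[OF one]])

text \<open>A prederivator turns left whiskering by \<open>q\<close> into evaluation at the
  restriction of \<open>Y\<close> along \<open>q\<close>, and right whiskering by a projection into
  application of its restriction functor. The outcome is the 2-cell that
  \<open>lan_exact_paste\<close> produces.\<close>

lemma PN_paste_right:
  assumes "in_universe U D" and Y: "Y \<in> Ob (PD D B)"
  shows "NC (PN D (paste_right v q \<alpha> m)) Y =
    Cmp (PD D (comma v m)) (NC (PN D (comma_nt v m)) (FO (PF D q) Y)) (FA (PF D (comma_pr1 v m)) (NC (PN D \<alpha>) Y))"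
proof -
  interpret in_universe U D by fact
  note 1 = PN_Ntrs[OF comma_right B right_Funs(1,2) paste_right_parts(1)]
  have "NC (PN D (paste_right v q \<alpha> m)) Y =
      Cmp (PD D (comma v m)) (NC (PN D (lwhisker q (comma_nt v m))) Y) (NC (PN D (rwhisker \<alpha> (comma_pr1 v m))) Y)"
    unfolding paste_right_def PN_vcomp[OF comma_right B right_Funs paste_right_parts]
    using NC_vcomp[OF 1 PF_Funs[OF comma_right B right_Funs(1)] Y] .
  also have "NC (PN D (lwhisker q (comma_nt v m))) Y = NC (PN D (comma_nt v m)) (FO (PF D q) Y)"
    unfolding PN_lwhisker[OF comma_right M B fcomp_Funs[OF c.comma_pr1_Funs v c.category_comma]
      fcomp_Funs[OF c.comma_pr2_Funs m c.category_comma] c.comma_nt_Ntrs q]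
    using NC_rwhisker[OF PF_Funs[OF M B q] Y] .
  also have "NC (PN D (rwhisker \<alpha> (comma_pr1 v m))) Y = FA (PF D (comma_pr1 v m)) (NC (PN D \<alpha>) Y)"
    unfolding PN_rwhisker[OF comma_right K B up qv \<alpha> c.comma_pr1_Funs]
    using NC_lwhisker[OF PN_Ntrs[OF K B up qv \<alpha>] PF_Funs[OF K B up] Y] .
  finally show ?thesis .
qed

end

context
  fixes a :: "'a sftor" assumes a: "a \<in> Funs one A"
begin

interpretation c: cospan one A K a p
  by unfold_locales (simp_all add: p a category Cat_category[OF one])

lemma comma_left: "comma a p \<in> Cat U"
  using comma_Cat[OF U one A K a p] .

lemma left_comma_square: "small_square U (comma a p) one K A (comma_pr1 a p) (comma_pr2 a p) a p (comma_nt a p)"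
  by unfold_locales
    (simp_all add: U K A one p a comma_left c.comma_pr1_Funs c.comma_pr2_Funs c.comma_nt_Ntrs)

lemma paste_left_parts:
  shows "lwhisker u (comma_nt a p) \<in> Ntrs ((u \<circ>\<^sub>F a) \<circ>\<^sub>F comma_pr1 a p) (u \<circ>\<^sub>F p \<circ>\<^sub>F comma_pr2 a p)"
    and "rwhisker \<alpha> (comma_pr2 a p) \<in> Ntrs (u \<circ>\<^sub>F p \<circ>\<^sub>F comma_pr2 a p) (q \<circ>\<^sub>F v \<circ>\<^sub>F comma_pr2 a p)"
  using rwhisker_Ntrs[OF c.category_comma up qv c.comma_pr2_Funs \<alpha>]
    lwhisker_Ntrs[OF c.category_comma fcomp_Funs[OF c.comma_pr1_Funs a c.category_comma]
      fcomp_Funs[OF c.comma_pr2_Funs p c.category_comma] u c.comma_nt_Ntrs]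
  by (simp_all add: fcomp_assoc[OF c.comma_pr1_Funs a] fcomp_assoc[OF c.comma_pr2_Funs v]
      fcomp_assoc[OF c.comma_pr2_Funs p])

lemmas left_Funs =
  fcomp_Funs[OF c.comma_pr1_Funs fcomp_Funs[OF a u Cat_category[OF one]] c.category_comma]
  fcomp_Funs[OF fcomp_Funs[OF c.comma_pr2_Funs p c.category_comma] u c.category_comma]
  fcomp_Funs[OF fcomp_Funs[OF c.comma_pr2_Funs v c.category_comma] q c.category_comma]

lemma paste_left_square:
  "small_square U (comma a p) one M B (comma_pr1 a p) (v \<circ>\<^sub>F comma_pr2 a p) (u \<circ>\<^sub>F a) q (paste_left p u \<alpha> a)"
proof
  show "paste_left p u \<alpha> a \<in> Ntrs ((u \<circ>\<^sub>F a) \<circ>\<^sub>F comma_pr1 a p) (q \<circ>\<^sub>F v \<circ>\<^sub>F comma_pr2 a p)"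
    unfolding paste_left_def
    using vcomp_Ntrs[OF c.category_comma category(4) left_Funs paste_left_parts] .
qed (simp_all add: U M B one comma_left q c.comma_pr1_Funs fcomp_Funs[OF c.comma_pr2_Funs v c.category_comma]
    fcomp_Funs[OF a u Cat_category[OF one]])

lemma PN_paste_left:
  assumes "in_universe U D" and Y: "Y \<in> Ob (PD D B)"
  shows "NC (PN D (paste_left p u \<alpha> a)) Y =
    Cmp (PD D (comma a p)) (FA (PF D (comma_pr2 a p)) (NC (PN D \<alpha>) Y)) (NC (PN D (comma_nt a p)) (FO (PF D u) Y))"
proof -
  interpret in_universe U D by fact
  note 1 = PN_Ntrs[OF comma_left B left_Funs(1,2) paste_left_parts(1)]
  have "NC (PN D (paste_left p u \<alpha> a)) Y =
      Cmp (PD D (comma a p)) (NC (PN D (rwhisker \<alpha> (comma_pr2 a p))) Y) (NC (PN D (lwhisker u (comma_nt a p))) Y)"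
    unfolding paste_left_def PN_vcomp[OF comma_left B left_Funs paste_left_parts]
    using NC_vcomp[OF 1 PF_Funs[OF comma_left B left_Funs(1)] Y] .
  also have "NC (PN D (lwhisker u (comma_nt a p))) Y = NC (PN D (comma_nt a p)) (FO (PF D u) Y)"
    unfolding PN_lwhisker[OF comma_left A B fcomp_Funs[OF c.comma_pr1_Funs a c.category_comma]
      fcomp_Funs[OF c.comma_pr2_Funs p c.category_comma] c.comma_nt_Ntrs u]
    using NC_rwhisker[OF PF_Funs[OF A B u] Y] .
  also have "NC (PN D (rwhisker \<alpha> (comma_pr2 a p))) Y = FA (PF D (comma_pr2 a p)) (NC (PN D \<alpha>) Y)"
    unfolding PN_rwhisker[OF comma_left K B up qv \<alpha> c.comma_pr2_Funs]
    using NC_lwhisker[OF PN_Ntrs[OF K B up qv \<alpha>] PF_Funs[OF K B up] Y] .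
  finally show ?thesis .
qed

end

text \<open>The comma squares of \<open>v\<close> and the points of \<open>M\<close> are exact by
  Der4, which gives one direction by pasting. Restrictions along these points jointly detect
  isomorphisms by Der2, which gives the other by cancellation.\<close>

lemma lan_exact_in_iff_right:
  assumes "in_universe U D"
  shows "lan_exact_in D p v u q \<alpha> \<longleftrightarrow>
    (\<forall>m\<in>Funs one M. lan_exact_in D (p \<circ>\<^sub>F comma_pr1 v m) (comma_pr2 v m) u (q \<circ>\<^sub>F m) (paste_right v q \<alpha> m))"
proof -
  interpret in_universe U D by fact
  have sq: "small_square U K A M B p v u q \<alpha>" by unfold_locales
  have comma: "lan_exact_in D (comma_pr1 v m) (comma_pr2 v m) v m (comma_nt v m)" if m: "m \<in> Funs one M" for m
    using der4 K M v m unfolding exact_iff_lan_exact_in[OF right_comma_square[OF m], symmetric] exact_def der4_def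
    by (simp add: Funs_FCod[OF small_square.p[OF right_comma_square[OF m]]]
      Funs_FCod[OF small_square.v[OF right_comma_square[OF m]]])
  have paste: "lan_exact (PF D (comma_pr1 v m) \<circ>\<^sub>F PF D p) (PF D (comma_pr2 v m)) (PF D m \<circ>\<^sub>F PF D q) (PF D u)
      (\<lambda>Y. Cmp (PD D (comma v m)) (NC (PN D (comma_nt v m)) (FO (PF D q) Y)) (FA (PF D (comma_pr1 v m)) (NC (PN D \<alpha>) Y))) \<longleftrightarrow>
      lan_exact_in D (p \<circ>\<^sub>F comma_pr1 v m) (comma_pr2 v m) u (q \<circ>\<^sub>F m) (paste_right v q \<alpha> m)"
    if m: "m \<in> Funs one M" for m
  proof -
    interpret c: small_square U "comma v m" K one M "comma_pr1 v m" "comma_pr2 v m" v m "comma_nt v m"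
      using right_comma_square[OF m] .
    show ?thesis
      unfolding PF_fcomp[OF c.K K A c.p p] PF_fcomp[OF c.M M B m q]
      by (rule lan_exact_cong)
        (simp add: PN_paste_right[OF m assms] Funs_FDom[OF PF_Funs[OF A B u]])
  qed
  show ?thesis
  proof
    assume "lan_exact_in D p v u q \<alpha>"
    then show "\<forall>m\<in>Funs one M. lan_exact_in D (p \<circ>\<^sub>F comma_pr1 v m) (comma_pr2 v m) u (q \<circ>\<^sub>F m) (paste_right v q \<alpha> m)"
      using lan_exact_paste[OF lax_square[OF sq] lax_square[OF right_comma_square] _ comma] paste by blast
  next
    assume r: "\<forall>m\<in>Funs one M. lan_exact_in D (p \<circ>\<^sub>F comma_pr1 v m) (comma_pr2 v m) u (q \<circ>\<^sub>F m) (paste_right v q \<alpha> m)"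
    show "lan_exact_in D p v u q \<alpha>"
      by (rule lan_exact_unpaste[where I = "Funs one M", OF lax_square[OF sq] lax_square[OF right_comma_square] comma])
        (use r paste universal_exists[OF K M v] is_iso_pointwise[OF M] in auto)
  qed
qed

text \<open>The cut at points of \<open>A\<close> goes through right mates, because these have their
  values over \<open>A\<close>, where Der2 applies.\<close>

lemma ran_exact_in_iff_left:
  assumes "in_universe U D"
  shows "ran_exact_in D p v u q \<alpha> \<longleftrightarrow>
    (\<forall>a\<in>Funs one A. ran_exact_in D (comma_pr1 a p) (v \<circ>\<^sub>F comma_pr2 a p) (u \<circ>\<^sub>F a) q (paste_left p u \<alpha> a))"
proof -
  interpret in_universe U D by fact
  have sq: "small_square U K A M B p v u q \<alpha>" by unfold_locales
  have comma: "ran_exact_in D (comma_pr1 a p) (comma_pr2 a p) a p (comma_nt a p)" if a: "a \<in> Funs one A" for a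
    by (rule is_iso_rmate_imp_ran_exact_in[OF left_comma_square[OF a]])
      (use der4 K A p a in \<open>auto simp: der4_def\<close>)
  have paste: "ran_exact (PF D (comma_pr1 a p)) (PF D (comma_pr2 a p) \<circ>\<^sub>F PF D v) (PF D q) (PF D a \<circ>\<^sub>F PF D u)
      (\<lambda>Y. Cmp (PD D (comma a p)) (FA (PF D (comma_pr2 a p)) (NC (PN D \<alpha>) Y)) (NC (PN D (comma_nt a p)) (FO (PF D u) Y))) \<longleftrightarrow>
      ran_exact_in D (comma_pr1 a p) (v \<circ>\<^sub>F comma_pr2 a p) (u \<circ>\<^sub>F a) q (paste_left p u \<alpha> a)"
    if a: "a \<in> Funs one A" for a
  proof -
    interpret c: small_square U "comma a p" one K A "comma_pr1 a p" "comma_pr2 a p" a p "comma_nt a p"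
      using left_comma_square[OF a] .
    show ?thesis
      unfolding PF_fcomp[OF c.K K M c.v v] PF_fcomp[OF c.A A B a u]
      by (rule ran_exact_cong)
        (simp add: PN_paste_left[OF a assms] Funs_FDom[OF PF_Funs[OF M B q]])
  qed
  show ?thesis
  proof
    assume "ran_exact_in D p v u q \<alpha>"
    then show "\<forall>a\<in>Funs one A. ran_exact_in D (comma_pr1 a p) (v \<circ>\<^sub>F comma_pr2 a p) (u \<circ>\<^sub>F a) q (paste_left p u \<alpha> a)"
      using ran_exact_paste[OF lax_square[OF sq] lax_square[OF left_comma_square] _ comma] paste by blast
  next
    assume r: "\<forall>a\<in>Funs one A. ran_exact_in D (comma_pr1 a p) (v \<circ>\<^sub>F comma_pr2 a p) (u \<circ>\<^sub>F a) q (paste_left p u \<alpha> a)"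
    show "ran_exact_in D p v u q \<alpha>"
      by (rule ran_exact_unpaste[where I = "Funs one A", OF lax_square[OF sq] lax_square[OF left_comma_square] comma])
        (use r paste couniversal_exists[OF K A p] is_iso_pointwise[OF A] in auto)
  qed
qed

end

context in_universe
begin

text \<open>After the cut at \<open>m\<close> the square is turned into its right-hand condition,
  cut at \<open>a\<close>, and turned back. The squares that remain involve only objects over the
  terminal category.\<close>

lemma lan_exact_in_iff_points:
  assumes sq: "small_square U K A M B p v u q \<alpha>"
  shows "lan_exact_in D p v u q \<alpha> \<longleftrightarrow> (\<forall>m\<in>Funs one M. \<forall>a\<in>Funs one A.
    lan_exact_in D (comma_pr1 a (p \<circ>\<^sub>F comma_pr1 v m)) (comma_pr2 v m \<circ>\<^sub>F comma_pr2 a (p \<circ>\<^sub>F comma_pr1 v m))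
      (u \<circ>\<^sub>F a) (q \<circ>\<^sub>F m) (paste_left (p \<circ>\<^sub>F comma_pr1 v m) u (paste_right v q \<alpha> m) a))"
proof -
  have D: "in_universe U D" by unfold_locales
  have "lan_exact_in D (p \<circ>\<^sub>F comma_pr1 v m) (comma_pr2 v m) u (q \<circ>\<^sub>F m) (paste_right v q \<alpha> m) \<longleftrightarrow>
    (\<forall>a\<in>Funs one A. lan_exact_in D (comma_pr1 a (p \<circ>\<^sub>F comma_pr1 v m)) (comma_pr2 v m \<circ>\<^sub>F comma_pr2 a (p \<circ>\<^sub>F comma_pr1 v m))
      (u \<circ>\<^sub>F a) (q \<circ>\<^sub>F m) (paste_left (p \<circ>\<^sub>F comma_pr1 v m) u (paste_right v q \<alpha> m) a))"
    if m: "m \<in> Funs one M" for m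
  proof -
    note r = small_square.paste_right_square[OF sq m]
    show ?thesis
      using lan_exact_in_iff_ran_exact_in[OF r] small_square.ran_exact_in_iff_left[OF r D]
        lan_exact_in_iff_ran_exact_in[OF small_square.paste_left_square[OF r]] by simp
  qed
  then show ?thesis using small_square.lan_exact_in_iff_right[OF sq D] by simp
qed

end

section \<open>Morphisms out of a product of two derivators\<close>

lemma hom_cprod: "(f, g) \<in> hom (cprod C D) (x, y) (x', y') \<longleftrightarrow> f \<in> hom C x x' \<and> g \<in> hom D y y'"
  by (auto simp: cprod_def mk_cat_def hom_def)

lemma Ob_cprod: "Ob (cprod C D) = Ob C \<times> Ob D"
  by (simp add: cprod_def mk_cat_simps)

lemma Idn_cprod: "x \<in> Ob C \<Longrightarrow> y \<in> Ob D \<Longrightarrow> Idn (cprod C D) (x, y) = (Idn C x, Idn D y)"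
  by (simp add: cprod_def mk_cat_simps)

lemma Cmp_cprod:
  "f \<in> hom C x x' \<Longrightarrow> f' \<in> hom C x' x'' \<Longrightarrow> g \<in> hom D y y' \<Longrightarrow> g' \<in> hom D y' y'' \<Longrightarrow>
    Cmp (cprod C D) (f', g') (f, g) = (Cmp C f' f, Cmp D g' g)"
  by (simp add: cprod_def Cmp_mk_cat hom_def)

lemma category_cprod:
  assumes C: "category C" and D: "category D"
  shows "category (cprod C D)"
  unfolding cprod_def
proof (rule category_mk_cat, goal_cases)
  case 11 then show ?case using C D by (auto simp: category_def composable_def)
qed (use C D in \<open>auto simp: category_def composable_def\<close>)

lemma fprod_Funs:
  assumes F: "F \<in> Funs C C'" and G: "G \<in> Funs D D'" and C: "category C" and D: "category D"
  shows "fprod F G \<in> Funs (cprod C D) (cprod C' D')"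
  unfolding fprod_def Funs_FDom[OF F] Funs_FDom[OF G] Funs_FCod[OF F] Funs_FCod[OF G]
  by (rule mk_ftor_Funs[OF category_cprod[OF C D]])
    (auto simp: Ob_cprod hom_cprod Idn_cprod FO_Ob[OF F] FO_Ob[OF G] FA_Idn[OF F] FA_Idn[OF G]
      Cmp_cprod FA_Cmp[OF F] FA_Cmp[OF G] Cmp_cprod[OF FA_hom[OF F] FA_hom[OF F] FA_hom[OF G] FA_hom[OF G]]
      intro: FA_hom[OF F] FA_hom[OF G])

lemma FO_fprod: "F \<in> Funs C C' \<Longrightarrow> G \<in> Funs D D' \<Longrightarrow> x \<in> Ob C \<Longrightarrow> y \<in> Ob D \<Longrightarrow>
    FO (fprod F G) (x, y) = (FO F x, FO G y)"
  by (simp add: fprod_def mk_ftor_def Ob_cprod Funs_FDom)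

lemma FA_fprod: "F \<in> Funs C C' \<Longrightarrow> G \<in> Funs D D' \<Longrightarrow> f \<in> Ar C \<Longrightarrow> g \<in> Ar D \<Longrightarrow>
    FA (fprod F G) (f, g) = (FA F f, FA G g)"
  by (simp add: fprod_def mk_ftor_def cprod_def mk_cat_simps Funs_FDom)

section \<open>The terminal category as a factor\<close>

lemma Funs_one_unique:
  fixes F G :: "('o, 'm, 'a code, 'a code) ftor"
  assumes "F \<in> Funs C one" and "G \<in> Funs C one"
  shows "F = G"
proof (rule ftor_eqI[OF assms])
  have star: "x = Star" if "x \<in> Ob one \<or> x \<in> Ar one" for x :: "'a code"
    using that by (simp add: one_def mk_cat_simps)
  show "FO F x = FO G x" if "x \<in> Ob C" for x
    using star FO_Ob[OF assms(1) that] FO_Ob[OF assms(2) that] by metis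
  show "FA F f = FA G f" if "f \<in> Ar C" for f
    using star hom_Ar[OF FA_hom[OF assms(1) homI[OF that refl refl]]]
      hom_Ar[OF FA_hom[OF assms(2) homI[OF that refl refl]]] by metis
qed

lemma hom_sprod:
  "h \<in> hom (A \<times>\<^sub>C B) x y \<longleftrightarrow> (\<exists>f g. h = Pr f g \<and> f \<in> Ar A \<and> g \<in> Ar B \<and>
    x = Pr (Src A f) (Src B g) \<and> y = Pr (Tgt A f) (Tgt B g))"
  by (auto simp: sprod_def hom_mk_cat)

lemma sprod_simps:
  "Pr x y \<in> Ob (A \<times>\<^sub>C B) \<longleftrightarrow> x \<in> Ob A \<and> y \<in> Ob B"
  "Pr f g \<in> Ar (A \<times>\<^sub>C B) \<longleftrightarrow> f \<in> Ar A \<and> g \<in> Ar B"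
  "x \<in> Ob A \<Longrightarrow> y \<in> Ob B \<Longrightarrow> Idn (A \<times>\<^sub>C B) (Pr x y) = Pr (Idn A x) (Idn B y)"
  "f \<in> Ar A \<Longrightarrow> g \<in> Ar B \<Longrightarrow> f' \<in> Ar A \<Longrightarrow> g' \<in> Ar B \<Longrightarrow> Src A f' = Tgt A f \<Longrightarrow> Src B g' = Tgt B g \<Longrightarrow>
    Cmp (A \<times>\<^sub>C B) (Pr f' g') (Pr f g) = Pr (Cmp A f' f) (Cmp B g' g)"
  by (auto simp: sprod_def mk_cat_simps Cmp_mk_cat)

lemma Ob_sprodE:
  assumes "z \<in> Ob (A \<times>\<^sub>C B)" obtains x y where "z = Pr x y" "x \<in> Ob A" "y \<in> Ob B"
  using assms by (auto simp: sprod_def mk_cat_simps)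

lemma Ar_sprodE:
  assumes "h \<in> Ar (A \<times>\<^sub>C B)" obtains f g where "h = Pr f g" "f \<in> Ar A" "g \<in> Ar B"
  using assms by (auto simp: sprod_def mk_cat_simps)

lemma pr1_Funs: "category (A \<times>\<^sub>C B) \<Longrightarrow> pr1 A B \<in> Funs (A \<times>\<^sub>C B) A"
  unfolding pr1_def
  by (rule mk_ftor_Funs) (auto simp: hom_sprod sprod_simps hom_def[of A] elim!: Ob_sprodE)

lemma pr2_Funs: "category (A \<times>\<^sub>C B) \<Longrightarrow> pr2 A B \<in> Funs (A \<times>\<^sub>C B) B"
  unfolding pr2_def
  by (rule mk_ftor_Funs) (auto simp: hom_sprod sprod_simps hom_def[of B] elim!: Ob_sprodE)

lemma sprod_ftor_Funs:
  assumes u: "u \<in> Funs A A'" and v: "v \<in> Funs B B'" and c: "category (A \<times>\<^sub>C B)"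
  shows "u \<times>\<^sub>F v \<in> Funs (A \<times>\<^sub>C B) (A' \<times>\<^sub>C B')"
  unfolding sprod_ftor_def Funs_FDom[OF u] Funs_FDom[OF v] Funs_FCod[OF u] Funs_FCod[OF v]
proof (rule mk_ftor_Funs[OF c])
  note ar = u[unfolded Funs_def] v[unfolded Funs_def]
  show "Pr (FO u (cfst x)) (FO v (csnd x)) \<in> Ob (A' \<times>\<^sub>C B')" if "x \<in> Ob (A \<times>\<^sub>C B)" for x
    using that by (auto elim!: Ob_sprodE simp: sprod_simps FO_Ob[OF u] FO_Ob[OF v])
  show "Pr (FA u (cfst h)) (FA v (csnd h)) \<in> hom (A' \<times>\<^sub>C B') (Pr (FO u (cfst x)) (FO v (csnd x))) (Pr (FO u (cfst y)) (FO v (csnd y)))"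
    if "h \<in> hom (A \<times>\<^sub>C B) x y" for h x y
    using that ar by (auto simp: hom_sprod PiE_iff)
  show "Pr (FA u (cfst (Idn (A \<times>\<^sub>C B) x))) (FA v (csnd (Idn (A \<times>\<^sub>C B) x))) = Idn (A' \<times>\<^sub>C B') (Pr (FO u (cfst x)) (FO v (csnd x)))"
    if "x \<in> Ob (A \<times>\<^sub>C B)" for x
    using that by (auto elim!: Ob_sprodE simp: sprod_simps FO_Ob[OF u] FO_Ob[OF v] FA_Idn[OF u] FA_Idn[OF v])
  show "Pr (FA u (cfst (Cmp (A \<times>\<^sub>C B) g f))) (FA v (csnd (Cmp (A \<times>\<^sub>C B) g f))) =
      Cmp (A' \<times>\<^sub>C B') (Pr (FA u (cfst g)) (FA v (csnd g))) (Pr (FA u (cfst f)) (FA v (csnd f)))"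
    if f: "f \<in> hom (A \<times>\<^sub>C B) x y" and g: "g \<in> hom (A \<times>\<^sub>C B) y z" for f g x y z
    using f g ar by (auto simp: hom_sprod sprod_simps PiE_iff composable_def)
qed

text \<open>The inverse of \<open>pr1 A one\<close>. External products with objects over
  \<open>one\<close> live over \<open>A \<times>\<^sub>C one\<close>, and this functor brings them
  back to \<open>A\<close>.\<close>

definition embed :: "'a scat \<Rightarrow> 'a sftor" where
  "embed A = mk_ftor A (A \<times>\<^sub>C one) (\<lambda>x. Pr x Star) (\<lambda>f. Pr f Star)"

lemma one_simps: "x \<in> Ob one \<longleftrightarrow> x = Star" "f \<in> Ar one \<longleftrightarrow> f = Star"
  "Src one Star = Star" "Tgt one Star = Star" "Idn one Star = Star" "Cmp one Star Star = Star"
  by (simp_all add: one_def mk_cat_simps Cmp_mk_cat)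

lemma embed_Funs: "category A \<Longrightarrow> embed A \<in> Funs A (A \<times>\<^sub>C one)"
  unfolding embed_def
  by (rule mk_ftor_Funs) (auto simp: hom_sprod sprod_simps one_simps hom_def[of A])

locale times_one =
  fixes A :: "'a scat" assumes A: "category A" and A1: "category (A \<times>\<^sub>C one)"
begin

lemma pr1_embed: "pr1 A one \<circ>\<^sub>F embed A = idf A"
  by (rule ftor_eqI[OF fcomp_Funs[OF embed_Funs[OF A] pr1_Funs[OF A1] A] idf_Funs[OF A]])
    (simp_all add: FO_fcomp[OF embed_Funs[OF A]] FA_fcomp[OF embed_Funs[OF A]] FO_idf FA_idf,
     simp_all add: pr1_def embed_def mk_ftor_def sprod_simps one_simps)

lemma embed_pr1: "embed A \<circ>\<^sub>F pr1 A one = idf (A \<times>\<^sub>C one)"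
  by (rule ftor_eqI[OF fcomp_Funs[OF pr1_Funs[OF A1] embed_Funs[OF A] A1] idf_Funs[OF A1]])
    (simp_all add: FO_fcomp[OF pr1_Funs[OF A1]] FA_fcomp[OF pr1_Funs[OF A1]] FO_idf FA_idf,
     auto simp: pr1_def embed_def mk_ftor_def sprod_simps one_simps elim!: Ob_sprodE Ar_sprodE)

end

context
  fixes A A' :: "'a scat" and u :: "'a sftor"
  assumes A: "category A" and A': "category A'" and A1: "category (A \<times>\<^sub>C one)" and A1': "category (A' \<times>\<^sub>C one)"
    and one: "category (one :: 'a scat)" and u: "u \<in> Funs A A'"
begin

private lemma u1: "u \<times>\<^sub>F idf one \<in> Funs (A \<times>\<^sub>C one) (A' \<times>\<^sub>C one)"
  using sprod_ftor_Funs[OF u idf_Funs[OF one] A1] .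

lemma pr1_sprod_ftor: "pr1 A' one \<circ>\<^sub>F (u \<times>\<^sub>F idf one) = u \<circ>\<^sub>F pr1 A one"
proof (rule ftor_eqI[OF fcomp_Funs[OF u1 pr1_Funs[OF A1'] A1] fcomp_Funs[OF pr1_Funs[OF A1] u A1]])
  show "FO (pr1 A' one \<circ>\<^sub>F (u \<times>\<^sub>F idf one)) x = FO (u \<circ>\<^sub>F pr1 A one) x" if "x \<in> Ob (A \<times>\<^sub>C one)" for x
    using that FO_Ob[OF u1 that] by (simp add: FO_fcomp[OF u1 that] FO_fcomp[OF pr1_Funs[OF A1] that])
      (simp add: pr1_def mk_ftor_def sprod_ftor_def Funs_FDom[OF u] Funs_FDom[OF idf_Funs[OF one]])
  show "FA (pr1 A' one \<circ>\<^sub>F (u \<times>\<^sub>F idf one)) f = FA (u \<circ>\<^sub>F pr1 A one) f" if "f \<in> Ar (A \<times>\<^sub>C one)" for f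
    using that hom_Ar[OF FA_hom[OF u1 homI[OF that refl refl]]]
    by (simp add: FA_fcomp[OF u1 that] FA_fcomp[OF pr1_Funs[OF A1] that])
      (simp add: pr1_def mk_ftor_def sprod_ftor_def Funs_FDom[OF u] Funs_FDom[OF idf_Funs[OF one]])
qed

text \<open>Formal from the corresponding equation for \<open>pr1\<close>, since
  \<open>embed\<close> and \<open>pr1\<close> are inverse to each other on both sides.\<close>

lemma sprod_ftor_embed: "(u \<times>\<^sub>F idf one) \<circ>\<^sub>F embed A = embed A' \<circ>\<^sub>F u"
proof -
  interpret t: times_one A by unfold_locales (rule A A1)+
  interpret t': times_one A' by unfold_locales (rule A' A1')+
  note e = embed_Funs[OF A] and e' = embed_Funs[OF A'] and p = pr1_Funs[OF A1] and p' = pr1_Funs[OF A1']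
  have "(u \<times>\<^sub>F idf one) \<circ>\<^sub>F embed A = (embed A' \<circ>\<^sub>F pr1 A' one) \<circ>\<^sub>F (u \<times>\<^sub>F idf one) \<circ>\<^sub>F embed A"
    using idf_fcomp[OF fcomp_Funs[OF e u1 A]] by (simp add: t'.embed_pr1)
  also have "\<dots> = embed A' \<circ>\<^sub>F (pr1 A' one \<circ>\<^sub>F (u \<times>\<^sub>F idf one)) \<circ>\<^sub>F embed A"
    by (simp add: fcomp_assoc[OF fcomp_Funs[OF e u1 A] p'] fcomp_assoc[OF e u1])
  also have "\<dots> = embed A' \<circ>\<^sub>F u \<circ>\<^sub>F pr1 A one \<circ>\<^sub>F embed A"
    by (simp add: pr1_sprod_ftor fcomp_assoc[OF e p])
  finally show ?thesis by (simp add: t.pr1_embed fcomp_idf[OF u])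
qed

end

section \<open>The structure isomorphisms of an action, in components\<close>

locale action =
  fixes U :: "'a code set set" and V :: "('a, 'o, 'm) prederiv" and D :: "('a, 'p, 'n) prederiv"
    and act :: "('a, 'o \<times> 'p, 'm \<times> 'n, 'p, 'n) pnat"
  assumes U: "universe U" and V: "derivator U V" and D: "derivator U D"
    and act: "pseudonatural U (V \<times>\<^sub>P D) D act"
begin

sublocale V: in_universe U V by unfold_locales (rule U V)+
sublocale D: in_universe U D by unfold_locales (rule U D)+

lemma PC_Funs: "A \<in> Cat U \<Longrightarrow> PC act A \<in> Funs (cprod (PD V A) (PD D A)) (PD D A)"
  using act by (simp add: pseudonatural_def pprod_def)

lemma PI_Ntrs:
  "A \<in> Cat U \<Longrightarrow> B \<in> Cat U \<Longrightarrow> u \<in> Funs A B \<Longrightarrow>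
    PI act u \<in> Ntrs (PF D u \<circ>\<^sub>F PC act B) (PC act A \<circ>\<^sub>F fprod (PF V u) (PF D u)) \<and> is_nat_iso (PI act u)"
  using act unfolding pseudonatural_def by (simp add: pprod_def)

lemma PI_vcomp:
  "A \<in> Cat U \<Longrightarrow> B \<in> Cat U \<Longrightarrow> C \<in> Cat U \<Longrightarrow> u \<in> Funs A B \<Longrightarrow> v \<in> Funs B C \<Longrightarrow>
    PI act (v \<circ>\<^sub>F u) = rwhisker (PI act u) (fprod (PF V v) (PF D v)) \<bullet> lwhisker (PF D u) (PI act v)"
proof -
  assume *: "A \<in> Cat U" "B \<in> Cat U" "C \<in> Cat U" "u \<in> Funs A B" "v \<in> Funs B C"
  have "PI act (v \<circ>\<^sub>F u) = rwhisker (PI act u) (PF (V \<times>\<^sub>P D) v) \<bullet> lwhisker (PF D u) (PI act v)"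
    using act * unfolding pseudonatural_def by (elim conjE) meson
  then show ?thesis by (simp add: pprod_def)
qed

lemma PI_PN:
  "A \<in> Cat U \<Longrightarrow> B \<in> Cat U \<Longrightarrow> u \<in> Funs A B \<Longrightarrow> v \<in> Funs A B \<Longrightarrow> \<alpha> \<in> Ntrs u v \<Longrightarrow>
    PI act v \<bullet> rwhisker (PN D \<alpha>) (PC act B) = lwhisker (PC act A) (PN (V \<times>\<^sub>P D) \<alpha>) \<bullet> PI act u"
  using act unfolding pseudonatural_def by (elim conjE) meson

lemma act_hom:
  "A \<in> Cat U \<Longrightarrow> f \<in> hom (PD V A) X X' \<Longrightarrow> g \<in> hom (PD D A) W W' \<Longrightarrow>
    FA (PC act A) (f, g) \<in> hom (PD D A) (FO (PC act A) (X, W)) (FO (PC act A) (X', W'))"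
  using FA_hom[OF PC_Funs] by (simp add: hom_cprod)

lemma act_Ob:
  "A \<in> Cat U \<Longrightarrow> X \<in> Ob (PD V A) \<Longrightarrow> W \<in> Ob (PD D A) \<Longrightarrow> FO (PC act A) (X, W) \<in> Ob (PD D A)"
  using FO_Ob[OF PC_Funs] by (simp add: Ob_cprod)

context
  fixes A B :: "'a scat" and u :: "'a sftor"
  assumes A: "A \<in> Cat U" and B: "B \<in> Cat U" and u: "u \<in> Funs A B"
begin

private lemmas VC = V.PD_category[OF B] and DC = D.PD_category[OF B]
private lemmas Vu = V.PF_Funs[OF A B u] and Du = D.PF_Funs[OF A B u]
private lemmas c = category_cprod[OF VC DC]
private lemmas src = fcomp_Funs[OF PC_Funs[OF B] Du c]

lemma PI_hom:
  assumes "X \<in> Ob (PD V B)" and "W \<in> Ob (PD D B)"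
  shows "NC (PI act u) (X, W) \<in> hom (PD D A) (FO (PF D u) (FO (PC act B) (X, W)))
    (FO (PC act A) (FO (PF V u) X, FO (PF D u) W))"
proof -
  have x: "(X, W) \<in> Ob (cprod (PD V B) (PD D B))" using assms by (simp add: Ob_cprod)
  show ?thesis
    using NC_hom[OF conjunct1[OF PI_Ntrs[OF A B u]] src x]
    by (simp add: FO_fcomp[OF PC_Funs[OF B] x] FO_fcomp[OF fprod_Funs[OF Vu Du VC DC] x] FO_fprod[OF Vu Du assms])
qed

lemma PI_iso: "X \<in> Ob (PD V B) \<Longrightarrow> W \<in> Ob (PD D B) \<Longrightarrow> is_iso (PD D A) (NC (PI act u) (X, W))"
  using PI_Ntrs[OF A B u] NSrc[OF conjunct1[OF PI_Ntrs[OF A B u]]]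
  by (simp add: is_nat_iso_def Funs_FDom[OF src] Funs_FCod[OF src] Ob_cprod)

lemma PI_nat:
  assumes f: "f \<in> hom (PD V B) X X'" and g: "g \<in> hom (PD D B) W W'"
  shows "Cmp (PD D A) (NC (PI act u) (X', W')) (FA (PF D u) (FA (PC act B) (f, g))) =
    Cmp (PD D A) (FA (PC act A) (FA (PF V u) f, FA (PF D u) g)) (NC (PI act u) (X, W))"
proof -
  have fg: "(f, g) \<in> hom (cprod (PD V B) (PD D B)) (X, W) (X', W')" using assms by (simp add: hom_cprod)
  show ?thesis
    using NC_nat[OF conjunct1[OF PI_Ntrs[OF A B u]] src fg]
    by (simp add: FA_fcomp[OF PC_Funs[OF B] hom_Ar[OF fg]] FA_fcomp[OF fprod_Funs[OF Vu Du VC DC] hom_Ar[OF fg]]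
      FA_fprod[OF Vu Du hom_Ar[OF f] hom_Ar[OF g]])
qed

lemma PI_fcomp:
  assumes C: "C \<in> Cat U" and v: "v \<in> Funs B C" and X: "X \<in> Ob (PD V C)" and W: "W \<in> Ob (PD D C)"
  shows "NC (PI act (v \<circ>\<^sub>F u)) (X, W) = Cmp (PD D A)
    (NC (PI act u) (FO (PF V v) X, FO (PF D v) W)) (FA (PF D u) (NC (PI act v) (X, W)))"
proof -
  note c' = V.PD_category[OF C] D.PD_category[OF C] and Vv = V.PF_Funs[OF B C v] and Dv = D.PF_Funs[OF B C v]
  note t = conjunct1[OF PI_Ntrs[OF B C v]] and F = fcomp_Funs[OF PC_Funs[OF C] Dv category_cprod[OF c']]
    and G = fcomp_Funs[OF fprod_Funs[OF Vv Dv c'] PC_Funs[OF B] category_cprod[OF c']]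
  have x: "(X, W) \<in> Ob (cprod (PD V C) (PD D C))" using X W by (simp add: Ob_cprod)
  show ?thesis
    unfolding PI_vcomp[OF A B C u v]
    using NC_vcomp[OF lwhisker_Ntrs[OF category_cprod[OF c'] F G Du t] fcomp_Funs[OF F Du category_cprod[OF c']] x]
    by (simp add: NC_lwhisker[OF t F x] NC_rwhisker[OF fprod_Funs[OF Vv Dv c'] x] FO_fprod[OF Vv Dv X W])
qed

text \<open>This is where the effect of a 2-cell in D gets tied to its effect in V: pseudonaturality
  on 2-cells, evaluated at a pair of objects.\<close>

lemma PI_2cell:
  assumes v: "v \<in> Funs A B" and \<alpha>: "\<alpha> \<in> Ntrs u v" and X: "X \<in> Ob (PD V B)" and W: "W \<in> Ob (PD D B)"
  shows "Cmp (PD D A) (NC (PI act v) (X, W)) (NC (PN D \<alpha>) (FO (PC act B) (X, W))) =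
    Cmp (PD D A) (FA (PC act A) (NC (PN V \<alpha>) X, NC (PN D \<alpha>) W)) (NC (PI act u) (X, W))"
proof -
  have x: "(X, W) \<in> Ob (cprod (PD V B) (PD D B))" using X W by (simp add: Ob_cprod)
  note Va = V.PN_Ntrs[OF A B u v \<alpha>] and Da = D.PN_Ntrs[OF A B u v \<alpha>]
  have r: "rwhisker (PN D \<alpha>) (PC act B) \<in> Ntrs (PF D u \<circ>\<^sub>F PC act B) (PF D v \<circ>\<^sub>F PC act B)"
    by (rule rwhisker_Ntrs[OF c Du D.PF_Funs[OF A B v] PC_Funs[OF B] Da])
  have src_PN: "NSrc (PN (V \<times>\<^sub>P D) \<alpha>) = fprod (PF V u) (PF D u)"
    by (simp add: pprod_def mk_nt_def NSrc[OF Va] NSrc[OF Da])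
  have l: "NC (lwhisker (PC act A) (PN (V \<times>\<^sub>P D) \<alpha>)) (X, W) = FA (PC act A) (NC (PN V \<alpha>) X, NC (PN D \<alpha>) W)"
    unfolding lwhisker_def src_PN
    using x X W by (simp add: NC_mk_nt[OF fcomp_Funs[OF fprod_Funs[OF Vu Du VC DC] PC_Funs[OF A] c]])
      (simp add: pprod_def NSrc[OF Va] NSrc[OF Da] NC_mk_nt[OF fprod_Funs[OF Vu Du VC DC]])
  have "NC (PI act v \<bullet> rwhisker (PN D \<alpha>) (PC act B)) (X, W) =
      Cmp (PD D A) (NC (PI act v) (X, W)) (NC (PN D \<alpha>) (FO (PC act B) (X, W)))"
    by (simp add: NC_vcomp[OF r src x] NC_rwhisker[OF PC_Funs[OF B] x])
  moreover have "NC (lwhisker (PC act A) (PN (V \<times>\<^sub>P D) \<alpha>) \<bullet> PI act u) (X, W) =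
      Cmp (PD D A) (FA (PC act A) (NC (PN V \<alpha>) X, NC (PN D \<alpha>) W)) (NC (PI act u) (X, W))"
    by (simp add: NC_vcomp[OF conjunct1[OF PI_Ntrs[OF A B u]] src x] l)
  ultimately show ?thesis using PI_PN[OF A B u v \<alpha>] by simp
qed

end

end

section \<open>Tensoring with a fixed object\<close>

text \<open>The structure isomorphisms run from the restriction of a product to the product of
  restrictions, while the squares below need the opposite direction.\<close>

lemma inv_ar_nat:
  assumes C: "category C" and t: "t \<in> hom C x y" "is_iso C t" and t': "t' \<in> hom C x' y'" "is_iso C t'"
    and f: "f \<in> hom C x x'" and g: "g \<in> hom C y y'" and eq: "Cmp C t' f = Cmp C g t"
  shows "Cmp C (inv_ar C t') g = Cmp C f (inv_ar C t)"
proof -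
  note i = inv_ar[OF C t(2,1)] and i' = inv_ar[OF C t'(2,1)]
  have "Cmp C (inv_ar C t') g = Cmp C (inv_ar C t') (Cmp C (Cmp C g t) (inv_ar C t))"
    using Cmp_assoc[OF C i(1) t(1) g] i(3) Cmp_Idn[OF C g] by simp
  also have "\<dots> = Cmp C (inv_ar C t') (Cmp C t' (Cmp C f (inv_ar C t)))"
    using eq Cmp_assoc[OF C i(1) f t'(1)] by simp
  also have "\<dots> = Cmp C f (inv_ar C t)"
    using Cmp_inv_cancel[OF C t'(2,1) Cmp_hom[OF C i(1) f]] .
  finally show ?thesis .
qed

context in_universe
begin

lemma FO_PF_fcomp:
  "A \<in> Cat U \<Longrightarrow> B \<in> Cat U \<Longrightarrow> C \<in> Cat U \<Longrightarrow> u \<in> Funs A B \<Longrightarrow> w \<in> Funs B C \<Longrightarrow> X \<in> Ob (PD D C) \<Longrightarrow>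
    FO (PF D (w \<circ>\<^sub>F u)) X = FO (PF D u) (FO (PF D w) X)"
  using FO_fcomp[OF PF_Funs] by (simp add: PF_fcomp)

lemma FA_PF_fcomp:
  "A \<in> Cat U \<Longrightarrow> B \<in> Cat U \<Longrightarrow> C \<in> Cat U \<Longrightarrow> u \<in> Funs A B \<Longrightarrow> w \<in> Funs B C \<Longrightarrow> f \<in> Ar (PD D C) \<Longrightarrow>
    FA (PF D (w \<circ>\<^sub>F u)) f = FA (PF D u) (FA (PF D w) f)"
  using FA_fcomp[OF PF_Funs] by (simp add: PF_fcomp)

end

text \<open>The unique functor to the terminal category, written as this composite so that
  restricting \<open>const1 A\<close> along \<open>embed A\<close> gives \<open>const A\<close> by
  strictness.\<close>

definition bang :: "'a scat \<Rightarrow> 'a sftor" where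
  "bang A = pr2 A one \<circ>\<^sub>F embed A"

context action
begin

text \<open>The internal product with an object \<open>W\<close> over the same \<open>A\<close>, in
  contrast to the external product \<open>ext\<close>.\<close>

definition right_act :: "'a scat \<Rightarrow> 'p \<Rightarrow> ('o, 'm, 'p, 'n) ftor" where
  "right_act A W = mk_ftor (PD V A) (PD D A)
     (\<lambda>X. FO (PC act A) (X, W)) (\<lambda>f. FA (PC act A) (f, Idn (PD D A) W))"

lemma right_act_Funs:
  assumes A: "A \<in> Cat U" and W: "W \<in> Ob (PD D A)"
  shows "right_act A W \<in> Funs (PD V A) (PD D A)"
  unfolding right_act_def
proof (rule mk_ftor_Funs[OF V.PD_category[OF A]])
  note w = Idn_hom[OF D.PD_category[OF A] W]
  show "FO (PC act A) (X, W) \<in> Ob (PD D A)" if "X \<in> Ob (PD V A)" for X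
    using act_Ob[OF A that W] .
  show "FA (PC act A) (f, Idn (PD D A) W) \<in> hom (PD D A) (FO (PC act A) (X, W)) (FO (PC act A) (Y, W))"
    if "f \<in> hom (PD V A) X Y" for f X Y
    using act_hom[OF A that w] .
  show "FA (PC act A) (Idn (PD V A) X, Idn (PD D A) W) = Idn (PD D A) (FO (PC act A) (X, W))"
    if X: "X \<in> Ob (PD V A)" for X
    using FA_Idn[OF PC_Funs[OF A], of "(X, W)"] X W by (simp add: Ob_cprod Idn_cprod)
  show "FA (PC act A) (Cmp (PD V A) g f, Idn (PD D A) W) =
      Cmp (PD D A) (FA (PC act A) (g, Idn (PD D A) W)) (FA (PC act A) (f, Idn (PD D A) W))"
    if f: "f \<in> hom (PD V A) X Y" and g: "g \<in> hom (PD V A) Y Z" for f g X Y Z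
    using FA_Cmp[OF PC_Funs[OF A], of "(f, Idn (PD D A) W)" "(X, W)" "(Y, W)" "(g, Idn (PD D A) W)" "(Z, W)"]
      f g w Cmp_Idn[OF D.PD_category[OF A] w] by (simp add: hom_cprod Cmp_cprod[OF f g w w])
qed

lemma FO_right_act: "X \<in> Ob (PD V A) \<Longrightarrow> FO (right_act A W) X = FO (PC act A) (X, W)"
  and FA_right_act: "f \<in> Ar (PD V A) \<Longrightarrow> FA (right_act A W) f = FA (PC act A) (f, Idn (PD D A) W)"
  by (simp_all add: right_act_def mk_ftor_def)

lemma PI_right_act_hom:
  assumes "A \<in> Cat U" "B \<in> Cat U" "u \<in> Funs A B" and X: "X \<in> Ob (PD V B)" and W: "W \<in> Ob (PD D B)"
  shows "NC (PI act u) (X, W) \<in> hom (PD D A) (FO (PF D u) (FO (right_act B W) X))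
    (FO (right_act A (FO (PF D u) W)) (FO (PF V u) X))"
  using PI_hom[OF assms] FO_Ob[OF V.PF_Funs[OF assms(1-3)] X] by (simp add: FO_right_act X)

lemma PI_right_act_nat:
  assumes A: "A \<in> Cat U" "B \<in> Cat U" "u \<in> Funs A B" and f: "f \<in> hom (PD V B) X X'" and W: "W \<in> Ob (PD D B)"
  shows "Cmp (PD D A) (NC (PI act u) (X', W)) (FA (PF D u) (FA (right_act B W) f)) =
    Cmp (PD D A) (FA (right_act A (FO (PF D u) W)) (FA (PF V u) f)) (NC (PI act u) (X, W))"
  using PI_nat[OF A f Idn_hom[OF D.PD_category[OF A(2)] W]] FA_Idn[OF D.PF_Funs[OF A] W]
    hom_Ar[OF f] hom_Ar[OF FA_hom[OF V.PF_Funs[OF A] f]] by (simp add: FA_right_act)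

text \<open>Left exactness of this square is the projection formula u_!(X \<otimes> u^* W) = u_! X
  \<otimes> W. Below it is established for \<open>W\<close> pulled back from the terminal
  category.\<close>

lemma right_act_square:
  assumes A: "A \<in> Cat U" "B \<in> Cat U" "u \<in> Funs A B" and W: "W \<in> Ob (PD D B)"
  shows "lax_square (PD V A) (PD V B) (PD D A) (PD D B) (PF V u) (right_act A (FO (PF D u) W)) (PF D u)
    (right_act B W) (\<lambda>X. inv_ar (PD D A) (NC (PI act u) (X, W)))"
proof
  note D = D.PD_category[OF A(1)]
  show "inv_ar (PD D A) (NC (PI act u) (X, W)) \<in>
      hom (PD D A) (FO (right_act A (FO (PF D u) W)) (FO (PF V u) X)) (FO (PF D u) (FO (right_act B W) X))"
    if X: "X \<in> Ob (PD V B)" for X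
    using inv_ar_hom[OF D PI_iso[OF A X W] PI_right_act_hom[OF A X W]] .
  show "Cmp (PD D A) (inv_ar (PD D A) (NC (PI act u) (X', W))) (FA (right_act A (FO (PF D u) W)) (FA (PF V u) f)) =
      Cmp (PD D A) (FA (PF D u) (FA (right_act B W) f)) (inv_ar (PD D A) (NC (PI act u) (X, W)))"
    if f: "f \<in> hom (PD V B) X X'" for f X X'
  proof -
    note x = hom_Ob1[OF V.PD_category[OF A(2)] f] and x' = hom_Ob2[OF V.PD_category[OF A(2)] f]
    show ?thesis
      by (rule inv_ar_nat[OF D PI_right_act_hom[OF A x W] PI_iso[OF A x W]
        PI_right_act_hom[OF A x' W] PI_iso[OF A x' W]
        FA_hom[OF D.PF_Funs[OF A] FA_hom[OF right_act_Funs[OF A(2) W] f]]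
        FA_hom[OF right_act_Funs[OF A(1) FO_Ob[OF D.PF_Funs[OF A] W]] FA_hom[OF V.PF_Funs[OF A] f]]
        PI_right_act_nat[OF A f W]])
  qed
qed (use assms in \<open>simp_all add: V.PD_category D.PD_category V.PF_Funs D.PF_Funs right_act_Funs FO_Ob[OF D.PF_Funs]\<close>)

lemma one: "one \<in> Cat U"
  using one_Cat[OF U] .

lemma times_one_Cat: "A \<in> Cat U \<Longrightarrow> A \<times>\<^sub>C one \<in> Cat U"
  using sprod_Cat[OF U _ one] .

end

locale action_at = action +
  fixes Z assumes Z: "Z \<in> Ob (PD D one)"
begin

text \<open>The assumptions on the action speak of the external product \<open>T A\<close>, which
  lives over \<open>A \<times>\<^sub>C one\<close>. The proof works with \<open>\<Phi> A\<close>,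
  the internal product with the constant diagram at \<open>Z\<close>, which stays over
  \<open>A\<close>.\<close>

abbreviation "T A \<equiv> tens1 V D D act A one Z"
abbreviation "const A \<equiv> FO (PF D (bang A)) Z"
abbreviation "\<Phi> A \<equiv> right_act A (const A)"
abbreviation "const1 A \<equiv> FO (PF D (pr2 A one)) Z"
abbreviation "times1 u \<equiv> u \<times>\<^sub>F idf one"

context
  fixes A assumes A: "A \<in> Cat U"
begin

lemma embed_one: "embed A \<in> Funs A (A \<times>\<^sub>C one)"
  and pr1_one: "pr1 A one \<in> Funs (A \<times>\<^sub>C one) A"
  and pr2_one: "pr2 A one \<in> Funs (A \<times>\<^sub>C one) one"
  and bang: "bang A \<in> Funs A one"
  using embed_Funs pr1_Funs pr2_Funs fcomp_Funs[OF embed_Funs pr2_Funs] Cat_category[OF A] Cat_category[OF times_one_Cat[OF A]]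
  by (simp_all add: bang_def)

lemma const: "const A \<in> Ob (PD D A)"
  using FO_Ob[OF D.PF_Funs[OF A one bang] Z] .

lemma const1: "const1 A \<in> Ob (PD D (A \<times>\<^sub>C one))"
  using FO_Ob[OF D.PF_Funs[OF times_one_Cat[OF A] one pr2_one] Z] .

lemma const_embed: "FO (PF D (embed A)) (const1 A) = const A"
  using D.FO_PF_fcomp[OF A times_one_Cat[OF A] one embed_one pr2_one Z] by (simp add: bang_def)

text \<open>An external product is an internal one after restriction along projections; on arrows
  this uses that restriction preserves the identity of \<open>Z\<close>.\<close>

lemma T_eq: "T A = right_act (A \<times>\<^sub>C one) (const1 A) \<circ>\<^sub>F PF V (pr1 A one)"
  using V.PF_Funs[OF times_one_Cat[OF A] A pr1_one] FA_Idn[OF D.PF_Funs[OF times_one_Cat[OF A] one pr2_one] Z]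
    hom_Ar[OF FA_hom[OF V.PF_Funs[OF times_one_Cat[OF A] A pr1_one] homI[OF _ refl refl]]]
  by (auto simp: tens1_def ext_def ext_ar_def fcomp_def mk_ftor_def right_act_def Funs_FDom Funs_FCod FO_Ob
    restrict_def fun_eq_iff)

lemma T_Funs: "T A \<in> Funs (PD V A) (PD D (A \<times>\<^sub>C one))"
  unfolding T_eq
  by (rule fcomp_Funs[OF V.PF_Funs[OF times_one_Cat[OF A] A pr1_one] right_act_Funs[OF times_one_Cat[OF A] const1] V.PD_category[OF A]])

lemma FO_T: "X \<in> Ob (PD V A) \<Longrightarrow> FO (T A) X = FO (right_act (A \<times>\<^sub>C one) (const1 A)) (FO (PF V (pr1 A one)) X)"
  and FA_T: "f \<in> Ar (PD V A) \<Longrightarrow> FA (T A) f = FA (right_act (A \<times>\<^sub>C one) (const1 A)) (FA (PF V (pr1 A one)) f)"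
  unfolding T_eq
  by (rule FO_fcomp[OF V.PF_Funs[OF times_one_Cat[OF A] A pr1_one]] FA_fcomp[OF V.PF_Funs[OF times_one_Cat[OF A] A pr1_one]], assumption)+

text \<open>Restriction along the isomorphism \<open>A \<cong> A \<times> 1\<close> turns the external product with \<open>Z\<close> into \<open>\<Phi> A\<close>.\<close>

lemma FO_pr1_embed: "X \<in> Ob (PD V A) \<Longrightarrow> FO (PF V (embed A)) (FO (PF V (pr1 A one)) X) = X"
  and FA_pr1_embed: "f \<in> Ar (PD V A) \<Longrightarrow> FA (PF V (embed A)) (FA (PF V (pr1 A one)) f) = f"
  using V.FO_PF_fcomp[OF A times_one_Cat[OF A] A embed_one pr1_one] V.FA_PF_fcomp[OF A times_one_Cat[OF A] A embed_one pr1_one]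
    times_one.pr1_embed[of A] Cat_category[OF A] Cat_category[OF times_one_Cat[OF A]] V.PF_idf[OF A]
  by (simp_all add: times_one_def FO_idf FA_idf)

text \<open>Restriction along \<open>embed A\<close> cancels \<open>pr1 A one\<close> strictly and
  turns \<open>const1 A\<close> into \<open>const A\<close>, so this structure isomorphism ends in
  \<open>FO (\<Phi> A) X\<close> on the nose.\<close>

definition "\<rho> X = NC (PI act (embed A)) (FO (PF V (pr1 A one)) X, const1 A)"

context
  fixes X assumes X: "X \<in> Ob (PD V A)"
begin

private lemma X1: "FO (PF V (pr1 A one)) X \<in> Ob (PD V (A \<times>\<^sub>C one))"
  using FO_Ob[OF V.PF_Funs[OF times_one_Cat[OF A] A pr1_one] X] .

lemma \<rho>_hom: "\<rho> X \<in> hom (PD D A) (FO (PF D (embed A)) (FO (T A) X)) (FO (\<Phi> A) X)"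
  using PI_right_act_hom[OF A times_one_Cat[OF A] embed_one X1 const1] by (simp add: \<rho>_def FO_T X const_embed FO_pr1_embed)

lemma \<rho>_iso: "is_iso (PD D A) (\<rho> X)"
  unfolding \<rho>_def by (rule PI_iso[OF A times_one_Cat[OF A] embed_one X1 const1])

end

lemma \<rho>_nat:
  assumes f: "f \<in> hom (PD V A) X Y"
  shows "Cmp (PD D A) (\<rho> Y) (FA (PF D (embed A)) (FA (T A) f)) = Cmp (PD D A) (FA (\<Phi> A) f) (\<rho> X)"
  using PI_right_act_nat[OF A times_one_Cat[OF A] embed_one FA_hom[OF V.PF_Funs[OF times_one_Cat[OF A] A pr1_one] f] const1]
  by (simp add: \<rho>_def FA_T hom_Ar[OF f] const_embed FA_pr1_embed)

end

context
  fixes A A' u assumes A: "A \<in> Cat U" and A': "A' \<in> Cat U" and u: "u \<in> Funs A A'"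
begin

text \<open>Functors to \<open>one\<close> are unique, so constant diagrams restrict to constant
  diagrams as an equality. This lets the squares for \<Phi> fit together without further
  isomorphisms.\<close>

lemma const_PF: "FO (PF D u) (const A') = const A"
  using D.FO_PF_fcomp[OF A A' one u bang[OF A'] Z]
    Funs_one_unique[OF fcomp_Funs[OF u bang[OF A'] Cat_category[OF A]] bang[OF A]] by simp

lemma \<Phi>_square:
  "lax_square (PD V A) (PD V A') (PD D A) (PD D A') (PF V u) (\<Phi> A) (PF D u) (\<Phi> A')
    (\<lambda>Y. inv_ar (PD D A) (NC (PI act u) (Y, const A')))"
  using right_act_square[OF A A' u const[OF A']] by (simp add: const_PF)

lemma times1_Funs: "times1 u \<in> Funs (A \<times>\<^sub>C one) (A' \<times>\<^sub>C one)"
  using sprod_ftor_Funs[OF u idf_Funs[OF Cat_category[OF one]] Cat_category[OF times_one_Cat[OF A]]] .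

lemma W1_PF: "FO (PF D (times1 u)) (const1 A') = const1 A"
  using D.FO_PF_fcomp[OF times_one_Cat[OF A] times_one_Cat[OF A'] one times1_Funs pr2_one[OF A'] Z]
    Funs_one_unique[OF fcomp_Funs[OF times1_Funs pr2_one[OF A'] Cat_category[OF times_one_Cat[OF A]]] pr2_one[OF A]] by simp

lemma pr1_times1: "pr1 A' one \<circ>\<^sub>F times1 u = u \<circ>\<^sub>F pr1 A one"
  and times1_embed: "times1 u \<circ>\<^sub>F embed A = embed A' \<circ>\<^sub>F u"
  by (rule pr1_sprod_ftor sprod_ftor_embed; simp add: A A' times_one_Cat one u Cat_category[where U = U])+

lemma FO_pr1_times1:
  "X \<in> Ob (PD V A') \<Longrightarrow> FO (PF V (times1 u)) (FO (PF V (pr1 A' one)) X) = FO (PF V (pr1 A one)) (FO (PF V u) X)"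
  using V.FO_PF_fcomp[OF times_one_Cat[OF A] times_one_Cat[OF A'] A' times1_Funs pr1_one[OF A']] V.FO_PF_fcomp[OF times_one_Cat[OF A] A A' pr1_one[OF A] u]
  by (simp add: pr1_times1)

lemma FA_pr1_times1:
  "f \<in> Ar (PD V A') \<Longrightarrow> FA (PF V (times1 u)) (FA (PF V (pr1 A' one)) f) = FA (PF V (pr1 A one)) (FA (PF V u) f)"
  using V.FA_PF_fcomp[OF times_one_Cat[OF A] times_one_Cat[OF A'] A' times1_Funs pr1_one[OF A']] V.FA_PF_fcomp[OF times_one_Cat[OF A] A A' pr1_one[OF A] u]
  by (simp add: pr1_times1)

abbreviation "\<tau> Y \<equiv> NC (PI act (times1 u)) (FO (PF V (pr1 A' one)) Y, const1 A')"

lemma ext_iso_\<tau>: "ext_iso V D D act u (idf one) Y Z = inv_ar (PD D (A \<times>\<^sub>C one)) (\<tau> Y)"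
  using Funs_FDom[OF idf_Funs[OF Cat_category[OF one]]] Funs_FCod[OF idf_Funs[OF Cat_category[OF one]]]
  by (simp add: ext_iso_def Funs_FDom[OF u] Funs_FCod[OF u])

lemma \<tau>_iso: "Y \<in> Ob (PD V A') \<Longrightarrow> is_iso (PD D (A \<times>\<^sub>C one)) (\<tau> Y)"
  and \<tau>_hom: "Y \<in> Ob (PD V A') \<Longrightarrow> \<tau> Y \<in> hom (PD D (A \<times>\<^sub>C one)) (FO (PF D (times1 u)) (FO (T A') Y)) (FO (T A) (FO (PF V u) Y))"
  using PI_iso[OF times_one_Cat[OF A] times_one_Cat[OF A'] times1_Funs FO_Ob[OF V.PF_Funs[OF times_one_Cat[OF A'] A' pr1_one[OF A']]] const1[OF A']]
    PI_right_act_hom[OF times_one_Cat[OF A] times_one_Cat[OF A'] times1_Funs FO_Ob[OF V.PF_Funs[OF times_one_Cat[OF A'] A' pr1_one[OF A']]] const1[OF A']]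
  by (simp_all add: FO_T A A' W1_PF FO_pr1_times1 FO_Ob[OF V.PF_Funs[OF A A' u]])

lemma T_square:
  "lax_square (PD V A) (PD V A') (PD D (A \<times>\<^sub>C one)) (PD D (A' \<times>\<^sub>C one)) (PF V u) (T A) (PF D (times1 u)) (T A')
    (\<lambda>Y. ext_iso V D D act u (idf one) Y Z)"
  unfolding ext_iso_\<tau>
proof
  note D = D.PD_category[OF times_one_Cat[OF A]]
  show "inv_ar (PD D (A \<times>\<^sub>C one)) (\<tau> Y) \<in>
      hom (PD D (A \<times>\<^sub>C one)) (FO (T A) (FO (PF V u) Y)) (FO (PF D (times1 u)) (FO (T A') Y))"
    if "Y \<in> Ob (PD V A')" for Y
    using inv_ar_hom[OF D \<tau>_iso[OF that] \<tau>_hom[OF that]] .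
  show "Cmp (PD D (A \<times>\<^sub>C one)) (inv_ar (PD D (A \<times>\<^sub>C one)) (\<tau> Y')) (FA (T A) (FA (PF V u) f)) =
      Cmp (PD D (A \<times>\<^sub>C one)) (FA (PF D (times1 u)) (FA (T A') f)) (inv_ar (PD D (A \<times>\<^sub>C one)) (\<tau> Y))"
    if f: "f \<in> hom (PD V A') Y Y'" for f Y Y'
  proof -
    note y = hom_Ob1[OF V.PD_category[OF A'] f] and y' = hom_Ob2[OF V.PD_category[OF A'] f]
    have "Cmp (PD D (A \<times>\<^sub>C one)) (\<tau> Y') (FA (PF D (times1 u)) (FA (T A') f)) =
        Cmp (PD D (A \<times>\<^sub>C one)) (FA (T A) (FA (PF V u) f)) (\<tau> Y)"
      using PI_right_act_nat[OF times_one_Cat[OF A] times_one_Cat[OF A'] times1_Funs FA_hom[OF V.PF_Funs[OF times_one_Cat[OF A'] A' pr1_one[OF A']] f] const1[OF A']]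
      by (simp add: FA_T A A' hom_Ar[OF f] hom_Ar[OF FA_hom[OF V.PF_Funs[OF A A' u] f]] W1_PF FA_pr1_times1)
    then show ?thesis
      by (rule inv_ar_nat[OF D \<tau>_hom[OF y] \<tau>_iso[OF y] \<tau>_hom[OF y'] \<tau>_iso[OF y']
        FA_hom[OF D.PF_Funs[OF times_one_Cat[OF A] times_one_Cat[OF A'] times1_Funs] FA_hom[OF T_Funs[OF A'] f]]
        FA_hom[OF T_Funs[OF A] FA_hom[OF V.PF_Funs[OF A A' u] f]]])
  qed
qed (simp_all add: V.PD_category D.PD_category V.PF_Funs D.PF_Funs[OF times_one_Cat[OF A] times_one_Cat[OF A'] times1_Funs] T_Funs A A' times_one_Cat u)

abbreviation "T_lan_exact \<equiv> lan_exact (T A) (PF D (times1 u)) (T A') (PF V u) (\<lambda>Y. ext_iso V D D act u (idf one) Y Z)"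

text \<open>With \<open>one\<close> as second category, \<open>ext_lan1\<close> is the left mate of
  the square \<open>T_square\<close>, spelled out.\<close>

lemma T_lan_exact_cocontinuous:
  assumes "cocontinuous2 U V D D act"
  shows T_lan_exact
proof -
  interpret l: lax_square "PD V A" "PD V A'" "PD D (A \<times>\<^sub>C one)" "PD D (A' \<times>\<^sub>C one)" "PF V u" "T A"
      "PF D (times1 u)" "T A'" "\<lambda>Y. ext_iso V D D act u (idf one) Y Z"
    using T_square .
  interpret u: adjoint_functors "PD V A" "PD V A'" "lan V u" "PF V u" "lan_unit V u" "lan_counit V u"
    using V.lan_adjoint[OF A A' u] .
  have "lan_exact_at (T A) (PF D (times1 u)) (T A') (PF V u) (\<lambda>Y. ext_iso V D D act u (idf one) Y Z) X"
    if X: "X \<in> Ob (PD V A)" for X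
  proof -
    have "is_iso (PD D (A' \<times>\<^sub>C one)) (ext_lan1 V D D act u one X Z)"
      using assms A A' one u X Z unfolding cocontinuous2_def by blast
    moreover have "ext V D act A' one (FO (lan V u) X) Z = FO (T A') (FO (lan V u) X)"
      using FO_Ob[OF u.F X] by (simp add: tens1_def mk_ftor_def)
    moreover have "ext_ar V D act A one (NC (lan_unit V u) X) (Idn (PD D one) Z) = FA (T A) (NC (lan_unit V u) X)"
      using hom_Ar[OF u.unit[OF X]] by (simp add: tens1_def mk_ftor_def)
    ultimately show ?thesis
      unfolding l.is_iso_left_mate[OF D.lan_adjoint[OF times_one_Cat[OF A] times_one_Cat[OF A'] times1_Funs] u.unit_universal[OF X], symmetric]
      by (simp add: ext_lan1_def Let_def Funs_FDom[OF u] Funs_FCod[OF u] Funs_FCod[OF times1_Funs])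
  qed
  then show ?thesis by (simp add: lan_exact_def l.P.FDom)
qed

text \<open>\<open>rhom_map1\<close> is the right mate of \<open>T_square\<close>, and the right
  adjoint of \<open>T A'\<close> supplies the couniversal arrows needed to pass to the left-hand
  condition. In other words, a left adjoint whose right adjoint commutes with restriction preserves
  left Kan extensions.\<close>

lemma T_lan_exact_enriched:
  assumes adj: "two_variable_left_adjoint U V D D act"
  shows T_lan_exact
proof -
  interpret l: lax_square "PD V A" "PD V A'" "PD D (A \<times>\<^sub>C one)" "PD D (A' \<times>\<^sub>C one)" "PF V u" "T A"
      "PF D (times1 u)" "T A'" "\<lambda>Y. ext_iso V D D act u (idf one) Y Z"
    using T_square .
  have r: "has_right_adjoint (T A)" "has_right_adjoint (T A')"
    using adj A A' one Z unfolding two_variable_left_adjoint_def by blast+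
  interpret t: adjoint_functors "PD V A'" "PD D (A' \<times>\<^sub>C one)" "T A'" "radj (T A')" "radj_unit (T A')" "radj_counit (T A')"
    using adjoint_functors_radj[OF l.Q.functor_between_axioms r(2)] .
  have "ran_exact_at (T A) (PF D (times1 u)) (T A') (PF V u) (\<lambda>Y. ext_iso V D D act u (idf one) Y Z) X"
    if X: "X \<in> Ob (PD D (A' \<times>\<^sub>C one))" for X
  proof -
    have "is_iso (PD V A) (rhom_map1 V D D act u one Z X)"
      using adj A A' one u X Z unfolding two_variable_left_adjoint_def by blast
    then show ?thesis
      unfolding l.is_iso_right_mate[OF adjoint_functors_radj[OF l.P.functor_between_axioms r(1)]
        t.counit_couniversal[OF X], symmetric]
      by (simp add: rhom_map1_def Let_def Funs_FDom[OF u] Funs_FCod[OF u])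
  qed
  then have "ran_exact (T A) (PF D (times1 u)) (T A') (PF V u) (\<lambda>Y. ext_iso V D D act u (idf one) Y Z)"
    by (simp add: ran_exact_def l.W.FDom)
  then show ?thesis
    by (rule l.ran_exact_imp_lan_exact) (use t.counit_couniversal in blast)
qed

text \<open>The universal arrow of the square for \<open>T\<close> is restricted along
  \<open>embed A\<close> by \<open>universal_transport\<close>, and the isomorphisms \<rho> then
  replace the two occurrences of \<open>T\<close> by \<Phi>.\<close>

lemma \<Phi>_lan_exact:
  assumes T: T_lan_exact
  shows "lan_exact (\<Phi> A) (PF D u) (\<Phi> A') (PF V u) (\<lambda>Y. inv_ar (PD D A) (NC (PI act u) (Y, const A')))"
proof -
  interpret l: lax_square "PD V A" "PD V A'" "PD D A" "PD D A'" "PF V u" "\<Phi> A" "PF D u" "\<Phi> A'"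
      "\<lambda>Y. inv_ar (PD D A) (NC (PI act u) (Y, const A'))"
    using \<Phi>_square .
  interpret t: lax_square "PD V A" "PD V A'" "PD D (A \<times>\<^sub>C one)" "PD D (A' \<times>\<^sub>C one)" "PF V u" "T A"
      "PF D (times1 u)" "T A'" "\<lambda>Y. ext_iso V D D act u (idf one) Y Z"
    using T_square .
  interpret o: times_one A by unfold_locales (rule Cat_category[OF A] Cat_category[OF times_one_Cat[OF A]])+
  interpret o': times_one A' by unfold_locales (rule Cat_category[OF A'] Cat_category[OF times_one_Cat[OF A']])+
  let ?R = "PF D (embed A)" and ?R' = "PF D (embed A')" and ?C = "PD D A"
  note R = D.PF_Funs[OF A times_one_Cat[OF A] embed_one[OF A]] and R' = D.PF_Funs[OF A' times_one_Cat[OF A'] embed_one[OF A']]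
  show ?thesis
  proof (rule l.lan_exactI)
    fix X Y g assume g: "universal (PF V u) X Y g"
    note y = l.U.universal_Ob[OF g] and x = l.U.universal_dom[OF g] and gh = l.U.universal_hom[OF g]
    note uy = FO_Ob[OF l.U.G y] and C = l.K
    let ?\<gamma> = "NC (PI act u) (Y, const A')" and ?E = "Cmp (PD D (A \<times>\<^sub>C one)) (inv_ar (PD D (A \<times>\<^sub>C one)) (\<tau> Y)) (FA (T A) g)"
    have \<gamma>: "?\<gamma> \<in> hom ?C (FO (PF D u) (FO (\<Phi> A') Y)) (FO (\<Phi> A) (FO (PF V u) Y))" "is_iso ?C ?\<gamma>"
      using PI_right_act_hom[OF A A' u y const[OF A']] PI_iso[OF A A' u y const[OF A']] by (simp_all add: const_PF)
    have E: "universal (PF D (times1 u)) (FO (T A) X) (FO (T A') Y) ?E"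
      using t.lan_exactD[OF T g] by (simp add: ext_iso_\<tau>)
    have RE: "universal (PF D u) (FO ?R (FO (T A) X)) (FO ?R' (FO (T A') Y)) (FA ?R ?E)"
    proof (rule universal_transport[OF t.W.functor_between_axioms l.W.functor_between_axioms
          D.functor_between[OF A times_one_Cat[OF A] embed_one[OF A]] D.functor_between[OF times_one_Cat[OF A] A pr1_one[OF A]]
          D.functor_between[OF A' times_one_Cat[OF A'] embed_one[OF A']] D.functor_between[OF times_one_Cat[OF A'] A' pr1_one[OF A']] _ _ _ _ _ _ E])
      show "PF D (pr1 A one) \<circ>\<^sub>F ?R = idf (PD D (A \<times>\<^sub>C one))" "?R \<circ>\<^sub>F PF D (pr1 A one) = idf ?C"
        "?R' \<circ>\<^sub>F PF D (pr1 A' one) = idf (PD D A')" "PF D (pr1 A' one) \<circ>\<^sub>F ?R' = idf (PD D (A' \<times>\<^sub>C one))"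
        by (simp_all add: A A' times_one_Cat embed_one pr1_one o.embed_pr1 o.pr1_embed o'.embed_pr1 o'.pr1_embed D.PF_idf
          D.PF_fcomp[OF A times_one_Cat[OF A] A, symmetric] D.PF_fcomp[OF A' times_one_Cat[OF A'] A', symmetric]
          D.PF_fcomp[OF times_one_Cat[OF A] A times_one_Cat[OF A], symmetric] D.PF_fcomp[OF times_one_Cat[OF A'] A' times_one_Cat[OF A'], symmetric])
      show "?R \<circ>\<^sub>F PF D (times1 u) = PF D u \<circ>\<^sub>F ?R'"
        by (simp add: D.PF_fcomp[OF A times_one_Cat[OF A] times_one_Cat[OF A'] embed_one[OF A] times1_Funs, symmetric]
          D.PF_fcomp[OF A A' times_one_Cat[OF A'] u embed_one[OF A'], symmetric] times1_embed)
      show "PF D (pr1 A one) \<circ>\<^sub>F PF D u = PF D (times1 u) \<circ>\<^sub>F PF D (pr1 A' one)"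
        by (simp add: D.PF_fcomp[OF times_one_Cat[OF A] A A' pr1_one[OF A] u, symmetric]
          D.PF_fcomp[OF times_one_Cat[OF A] times_one_Cat[OF A'] A' times1_Funs pr1_one[OF A'], symmetric] pr1_times1)
    qed
    note REh = l.W.universal_hom[OF RE]
    note \<rho>x = \<rho>_hom[OF A x] \<rho>_iso[OF A x] and \<rho>y = \<rho>_hom[OF A' y] \<rho>_iso[OF A' y] and \<rho>uy = \<rho>_hom[OF A uy]
    note i\<rho> = inv_ar[OF C \<rho>x(2,1)] and u\<rho> = FA_hom[OF l.W.G \<rho>y(1)]
    note y1 = FO_Ob[OF V.PF_Funs[OF times_one_Cat[OF A'] A' pr1_one[OF A']] y]
    note Te = FA_hom[OF T_Funs[OF A] gh] and \<tau>i = inv_ar_hom[OF t.K \<tau>_iso[OF y] \<tau>_hom[OF y]]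
    note \<Phi>embed_one = FA_hom[OF l.P.G gh]
    \<comment> \<open>Both sides are the structure isomorphism along
      \<open>times1 u \<circ>\<^sub>F embed A\<close>, which equals
      \<open>embed A' \<circ>\<^sub>F u\<close>, expanded along each of the two
      factorizations.\<close>
    have hex: "Cmp ?C ?\<gamma> (FA (PF D u) (\<rho> A' Y)) = Cmp ?C (\<rho> A (FO (PF V u) Y)) (FA ?R (\<tau> Y))"
      using PI_fcomp[OF A A' u times_one_Cat[OF A'] embed_one[OF A'] y1 const1[OF A']]
        PI_fcomp[OF A times_one_Cat[OF A] embed_one[OF A] times_one_Cat[OF A'] times1_Funs y1 const1[OF A']]
      by (simp add: \<rho>_def A A' times1_embed const_embed FO_pr1_embed W1_PF FO_pr1_times1 y)
    have R\<tau>: "FA ?R (\<tau> Y) \<in> hom ?C (FO (PF D u) (FO ?R' (FO (T A') Y))) (FO ?R (FO (T A) (FO (PF V u) Y)))"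
      using FA_hom[OF R \<tau>_hom[OF y]] hom_Src[OF REh]
        D.FO_PF_fcomp[OF A times_one_Cat[OF A] times_one_Cat[OF A'] embed_one[OF A] times1_Funs FO_Ob[OF t.Q.G y]]
        D.FO_PF_fcomp[OF A A' times_one_Cat[OF A'] u embed_one[OF A'] FO_Ob[OF t.Q.G y]] by (simp add: times1_embed)
    have "Cmp ?C ?\<gamma> (Cmp ?C (FA (PF D u) (\<rho> A' Y)) (FA ?R ?E)) =
        Cmp ?C (\<rho> A (FO (PF V u) Y)) (Cmp ?C (FA ?R (\<tau> Y)) (FA ?R ?E))"
      using Cmp_assoc[OF C REh u\<rho> \<gamma>(1)] Cmp_assoc[OF C REh R\<tau> \<rho>uy] hex by simp
    also have "Cmp ?C (FA ?R (\<tau> Y)) (FA ?R ?E) = FA ?R (FA (T A) g)"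
      using FA_Cmp[OF R Cmp_hom[OF t.K Te \<tau>i] \<tau>_hom[OF y]]
        Cmp_inv_cancel'[OF t.K \<tau>_iso[OF y] \<tau>_hom[OF y] Te] by simp
    also have "Cmp ?C (\<rho> A (FO (PF V u) Y)) (FA ?R (FA (T A) g)) = Cmp ?C (FA (\<Phi> A) g) (\<rho> A X)"
      using \<rho>_nat[OF A gh] .
    finally have "Cmp ?C (FA (PF D u) (\<rho> A' Y)) (FA ?R ?E) = Cmp ?C (inv_ar ?C ?\<gamma>) (Cmp ?C (FA (\<Phi> A) g) (\<rho> A X))"
      using Cmp_inv_cancel[OF C \<gamma>(2,1) Cmp_hom[OF C REh u\<rho>]] by simp
    then have "Cmp ?C (Cmp ?C (FA (PF D u) (\<rho> A' Y)) (FA ?R ?E)) (inv_ar ?C (\<rho> A X)) =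
        Cmp ?C (Cmp ?C (Cmp ?C (inv_ar ?C ?\<gamma>) (FA (\<Phi> A) g)) (\<rho> A X)) (inv_ar ?C (\<rho> A X))"
      using Cmp_assoc[OF C \<rho>x(1) \<Phi>embed_one l.hom[OF y]] by simp
    also have "\<dots> = Cmp ?C (inv_ar ?C ?\<gamma>) (FA (\<Phi> A) g)"
      using Cmp_assoc[OF C i\<rho>(1) \<rho>x(1) Cmp_hom[OF C \<Phi>embed_one l.hom[OF y]]] i\<rho>(3)
        Cmp_Idn[OF C Cmp_hom[OF C \<Phi>embed_one l.hom[OF y]]] by simp
    \<comment> \<open>The arrow for \<Phi> is thus the transported universal arrow with \<rho> at
      \<open>Y\<close>, restricted along \<open>u\<close>, on one end and the inverse of \<rho> at
      \<open>X\<close> on the other.\<close>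
    finally show "universal (PF D u) (FO (\<Phi> A) X) (FO (\<Phi> A') Y) (Cmp ?C (inv_ar ?C ?\<gamma>) (FA (\<Phi> A) g))"
      using l.W.universal_pre_iso[OF l.W.universal_post_iso[OF RE \<rho>y] i\<rho>(1) is_iso_inv_ar[OF C \<rho>x(2,1)]]
      by simp
  qed
qed

end

end

section \<open>Exactness in modules\<close>

context action_at
begin

text \<open>Constant diagrams are restricted along \<open>bang\<close>. Whiskering \<alpha> with
  \<open>bang B\<close> gives a transformation into the terminal category, necessarily an identity,
  so \<alpha> does not move the second factor of X \<otimes> Z.\<close>

lemma PN_const:
  assumes sA: "A \<in> Cat U" and sB: "B \<in> Cat U" and u: "u \<in> Funs A B" and v: "v \<in> Funs A B"
    and \<alpha>: "\<alpha> \<in> Ntrs u v"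
  shows "NC (PN D \<alpha>) (const B) = Idn (PD D A) (const A)"
proof -
  note F = fcomp_Funs[OF u bang[OF sB] Cat_category[OF sA]] and G = fcomp_Funs[OF v bang[OF sB] Cat_category[OF sA]]
  note l = lwhisker_Ntrs[OF Cat_category[OF sA] u v bang[OF sB] \<alpha>]
  have b: "bang B \<circ>\<^sub>F u = bang A" "bang B \<circ>\<^sub>F v = bang A"
    using Funs_one_unique[OF F bang[OF sA]] Funs_one_unique[OF G bang[OF sA]] by simp_all
  have 1: "NC (lwhisker (bang B) \<alpha>) x = Star" if "x \<in> Ob A" for x
    using hom_Ar[OF NC_hom[OF l F that]] by (simp add: one_simps)
  have "idn (bang A) \<in> Ntrs (bang A) (bang A)"
    unfolding idn_def Funs_FCod[OF bang[OF sA]]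
  proof (rule mk_nt_Ntrs[OF bang[OF sA] bang[OF sA] Cat_category[OF sA]])
    note o = Cat_category[OF one]
    show "Idn one (FO (bang A) x) \<in> hom one (FO (bang A) x) (FO (bang A) x)" if "x \<in> Ob A" for x
      using Idn_hom[OF o FO_Ob[OF bang[OF sA] that]] .
    show "Cmp one (Idn one (FO (bang A) y)) (FA (bang A) f) = Cmp one (FA (bang A) f) (Idn one (FO (bang A) x))"
      if "f \<in> hom A x y" for f x y
      using Cmp_Idn[OF o FA_hom[OF bang[OF sA] that]] Idn_Cmp[OF o FA_hom[OF bang[OF sA] that]] by simp
  qed
  moreover have "NC (idn (bang A)) x = Star" if "x \<in> Ob A" for x
    using FO_Ob[OF bang[OF sA] that] by (simp add: NC_idn[OF bang[OF sA] that] one_simps)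
  ultimately have w: "lwhisker (bang B) \<alpha> = idn (bang A)"
    using Ntrs_eqI[OF l[unfolded b] _ bang[OF sA]] 1 by simp
  have "NC (PN D \<alpha>) (const B) = NC (PN D (lwhisker (bang B) \<alpha>)) Z"
    unfolding D.PN_lwhisker[OF sA sB one u v \<alpha> bang[OF sB]]
    by (rule NC_rwhisker[OF D.PF_Funs[OF sB one bang[OF sB]] Z, symmetric])
  also have "\<dots> = Idn (PD D A) (const A)"
    unfolding w D.PN_idn[OF sA one bang[OF sA]] by (rule NC_idn[OF D.PF_Funs[OF sA one bang[OF sA]] Z])
  finally show ?thesis .
qed

text \<open>
  Since \<open>\<Phi>\<close> is pseudonatural and preserves universal arrows, it carries the universal arrow that
  witnesses exactness of the square at \<open>X\<close> to the one that witnesses exactness at \<open>\<Phi> X\<close>.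
\<close>

lemma lan_exact_at_\<Phi>:
  assumes T: "\<And>A A' u. A \<in> Cat U \<Longrightarrow> A' \<in> Cat U \<Longrightarrow> u \<in> Funs A A' \<Longrightarrow>
      lan_exact (T A) (PF D (times1 u)) (T A') (PF V u) (\<lambda>Y. ext_iso V D D act u (idf one) Y Z)"
    and sq: "small_square U K A M B p v u q \<alpha>" and ex: "lan_exact_in V p v u q \<alpha>" and X: "X \<in> Ob (PD V A)"
  shows "lan_exact_at (PF D p) (PF D v) (PF D q) (PF D u) (NC (PN D \<alpha>)) (FO (\<Phi> A) X)"
proof -
  interpret s: small_square U K A M B p v u q \<alpha> by fact
  interpret V: lax_square "PD V A" "PD V B" "PD V K" "PD V M" "PF V u" "PF V p" "PF V v" "PF V q" "NC (PN V \<alpha>)"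
    using V.lax_square[OF sq] .
  interpret D: lax_square "PD D A" "PD D B" "PD D K" "PD D M" "PF D u" "PF D p" "PF D v" "PF D q" "NC (PN D \<alpha>)"
    using D.lax_square[OF sq] .
  interpret u: lax_square "PD V A" "PD V B" "PD D A" "PD D B" "PF V u" "\<Phi> A" "PF D u" "\<Phi> B"
      "\<lambda>Y. inv_ar (PD D A) (NC (PI act u) (Y, const B))"
    using \<Phi>_square[OF s.A s.B s.u] .
  interpret v: lax_square "PD V K" "PD V M" "PD D K" "PD D M" "PF V v" "\<Phi> K" "PF D v" "\<Phi> M"
      "\<lambda>Y. inv_ar (PD D K) (NC (PI act v) (Y, const M))"
    using \<Phi>_square[OF s.K s.M s.v] .
  obtain Y g where g: "universal (PF V u) X Y g" using V.universal_exists[OF s.A s.B s.u X] by blast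
  note y = V.U.universal_Ob[OF g] and gh = V.U.universal_hom[OF g]
  note px = FO_Ob[OF V.P X] and qy = FO_Ob[OF V.Q y] and uy = FO_Ob[OF V.U y] and C = D.K
  let ?C = "PD D K" and ?\<xi> = "Cmp (PD V K) (NC (PN V \<alpha>) Y) (FA (PF V p) g)"
  let ?u = "NC (PI act u) (Y, const B)" and ?v = "NC (PI act v) (FO (PF V q) Y, const M)"
    and ?q = "NC (PI act q) (Y, const B)" and ?p = "NC (PI act p) (X, const A)"
    and ?pu = "NC (PI act p) (FO (PF V u) Y, const A)"
    and ?qv = "NC (PI act (q \<circ>\<^sub>F v)) (Y, const B)" and ?up = "NC (PI act (u \<circ>\<^sub>F p)) (Y, const B)"
  note PIh = PI_right_act_hom
  have uh: "?u \<in> hom (PD D A) (FO (PF D u) (FO (\<Phi> B) Y)) (FO (\<Phi> A) (FO (PF V u) Y))" "is_iso (PD D A) ?u"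
    using PIh[OF s.A s.B s.u y const[OF s.B]] PI_iso[OF s.A s.B s.u y const[OF s.B]] by (simp_all add: const_PF[OF s.A s.B s.u])
  have vh: "?v \<in> hom ?C (FO (PF D v) (FO (\<Phi> M) (FO (PF V q) Y))) (FO (\<Phi> K) (FO (PF V v) (FO (PF V q) Y)))" "is_iso ?C ?v"
    using PIh[OF s.K s.M s.v qy const[OF s.M]] PI_iso[OF s.K s.M s.v qy const[OF s.M]] by (simp_all add: const_PF[OF s.K s.M s.v])
  have qh: "?q \<in> hom (PD D M) (FO (PF D q) (FO (\<Phi> B) Y)) (FO (\<Phi> M) (FO (PF V q) Y))" "is_iso (PD D M) ?q"
    using PIh[OF s.M s.B s.q y const[OF s.B]] PI_iso[OF s.M s.B s.q y const[OF s.B]] by (simp_all add: const_PF[OF s.M s.B s.q])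
  have ph: "?p \<in> hom ?C (FO (PF D p) (FO (\<Phi> A) X)) (FO (\<Phi> K) (FO (PF V p) X))" "is_iso ?C ?p"
    using PIh[OF s.K s.A s.p X const[OF s.A]] PI_iso[OF s.K s.A s.p X const[OF s.A]] by (simp_all add: const_PF[OF s.K s.A s.p])
  have puh: "?pu \<in> hom ?C (FO (PF D p) (FO (\<Phi> A) (FO (PF V u) Y))) (FO (\<Phi> K) (FO (PF V p) (FO (PF V u) Y)))"
    using PIh[OF s.K s.A s.p uy const[OF s.A]] by (simp add: const_PF[OF s.K s.A s.p])
  have p_nat: "Cmp ?C ?pu (FA (PF D p) (FA (\<Phi> A) g)) = Cmp ?C (FA (\<Phi> K) (FA (PF V p) g)) ?p"
    using PI_right_act_nat[OF s.K s.A s.p gh const[OF s.A]] by (simp add: const_PF[OF s.K s.A s.p])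
  have qv: "?qv = Cmp ?C ?v (FA (PF D v) ?q)"
    using PI_fcomp[OF s.K s.M s.v s.B s.q y const[OF s.B]] by (simp add: const_PF[OF s.M s.B s.q])
  have up: "?up = Cmp ?C ?pu (FA (PF D p) ?u)"
    using PI_fcomp[OF s.K s.A s.p s.B s.u y const[OF s.B]] by (simp add: const_PF[OF s.A s.B s.u])
  have \<alpha>h: "NC (PN V \<alpha>) Y \<in> hom (PD V K) (FO (PF V p) (FO (PF V u) Y)) (FO (PF V v) (FO (PF V q) Y))"
    using V.hom[OF y] .
  \<comment> \<open>The second component of the 2-cell is an identity by \<open>PN_const\<close>, so
    its action is \<open>\<Phi> K\<close> of the component in V.\<close>
  have \<alpha>: "Cmp ?C ?qv (NC (PN D \<alpha>) (FO (\<Phi> B) Y)) = Cmp ?C (FA (\<Phi> K) (NC (PN V \<alpha>) Y)) ?up"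
    using PI_2cell[OF s.K s.B s.up s.qv s.\<alpha> y const[OF s.B]] hom_Ar[OF \<alpha>h]
    by (simp add: FO_right_act y FA_right_act PN_const[OF s.K s.B s.up s.qv s.\<alpha>])
  note \<Phi>By = FO_Ob[OF u.Q y]
  note \<alpha>Dh = D.hom[OF \<Phi>By]
  let ?e = "Cmp (PD D A) (inv_ar (PD D A) ?u) (FA (\<Phi> A) g)"
  have e: "universal (PF D u) (FO (\<Phi> A) X) (FO (\<Phi> B) Y) ?e"
    using u.lan_exactD[OF \<Phi>_lan_exact[OF s.A s.B s.u T[OF s.A s.B s.u]] g] .
  note eh = D.U.universal_hom[OF e]
  have x: "universal (PF D v) (FO (\<Phi> K) (FO (PF V p) X)) (FO (\<Phi> M) (FO (PF V q) Y)) (Cmp ?C (inv_ar ?C ?v) (FA (\<Phi> K) ?\<xi>))"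
    using v.lan_exactD[OF \<Phi>_lan_exact[OF s.K s.M s.v T[OF s.K s.M s.v]] V.lan_exactD[OF ex g]] .
  note xh = D.W.universal_hom[OF x]
  note \<xi>h = V.W.universal_hom[OF V.lan_exactD[OF ex g]]
  note iq = inv_ar[OF D.M qh(2,1)]
  \<comment> \<open>\<open>?L\<close> is the \<Phi>-image of the universal arrow in V, adjusted by
    structure isomorphisms at both ends, hence universal. \<open>?R\<close> is the arrow whose
    universality has to be shown. They are compared after the structure isomorphism along q v, that
    is, \<open>?v\<close> after the restriction of \<open>?q\<close>.\<close>
  let ?L = "Cmp ?C (FA (PF D v) (inv_ar (PD D M) ?q)) (Cmp ?C (Cmp ?C (inv_ar ?C ?v) (FA (\<Phi> K) ?\<xi>)) ?p)"
  let ?R = "Cmp ?C (NC (PN D \<alpha>) (FO (\<Phi> B) Y)) (FA (PF D p) ?e)"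
  have L: "universal (PF D v) (FO (PF D p) (FO (\<Phi> A) X)) (FO (PF D q) (FO (\<Phi> B) Y)) ?L"
    using D.W.universal_post_iso[OF D.W.universal_pre_iso[OF x ph] iq(1) is_iso_inv_ar[OF D.M qh(2,1)]] .
  have vq: "FA (PF D v) ?q \<in> hom ?C (FO (PF D v) (FO (PF D q) (FO (\<Phi> B) Y))) (FO (PF D v) (FO (\<Phi> M) (FO (PF V q) Y)))"
    "is_iso ?C (FA (PF D v) ?q)"
    using FA_hom[OF D.W qh(1)] is_iso_FA[OF D.M D.W qh] .
  have Rh: "?R \<in> hom ?C (FO (PF D p) (FO (\<Phi> A) X)) (FO (PF D v) (FO (PF D q) (FO (\<Phi> B) Y)))"
    using Cmp_hom[OF C FA_hom[OF D.P eh] \<alpha>Dh] .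
  note Lh = D.W.universal_hom[OF L] and vqi = FA_hom[OF D.W iq(1)] and xp = Cmp_hom[OF C ph(1) xh]
  have "Cmp ?C (FA (PF D v) ?q) ?L = Cmp ?C (Cmp ?C (inv_ar ?C ?v) (FA (\<Phi> K) ?\<xi>)) ?p"
    using Cmp_assoc[OF C xp vqi vq(1)] FA_Cmp[OF D.W iq(1) qh(1)] iq(3) FA_Idn[OF D.W FO_Ob[OF v.Q qy]] Idn_Cmp[OF C xp] by simp
  also have "\<dots> = Cmp ?C (inv_ar ?C ?v) (Cmp ?C (FA (\<Phi> K) ?\<xi>) ?p)"
    using Cmp_assoc[OF C ph(1) FA_hom[OF v.P \<xi>h] v.hom[OF qy]] .
  finally have l: "Cmp ?C ?v (Cmp ?C (FA (PF D v) ?q) ?L) = Cmp ?C (FA (\<Phi> K) ?\<xi>) ?p"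
    using Cmp_inv_cancel'[OF C vh(2,1) Cmp_hom[OF C ph(1) FA_hom[OF v.P \<xi>h]]] by simp
  note \<Phi>\<alpha> = FA_hom[OF v.P \<alpha>h] and pg = FA_hom[OF V.P gh] and pe = FA_hom[OF D.P eh] and pu = FA_hom[OF D.P uh(1)]
  \<comment> \<open>For \<open>?R\<close> the 2-cell law trades the structure isomorphism along q v
    for the one along u p; its factor \<open>?u\<close> cancels against the inverse of
    \<open>?u\<close> in \<open>?e\<close>.\<close>
  have "Cmp ?C ?v (Cmp ?C (FA (PF D v) ?q) ?R) = Cmp ?C (Cmp ?C ?qv (NC (PN D \<alpha>) (FO (\<Phi> B) Y))) (FA (PF D p) ?e)"
    unfolding qv using Cmp_assoc[OF C Rh vq(1) vh(1)] Cmp_assoc[OF C pe \<alpha>Dh Cmp_hom[OF C vq(1) vh(1)]] by simp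
  also have "\<dots> = Cmp ?C (FA (\<Phi> K) (NC (PN V \<alpha>) Y)) (Cmp ?C ?pu (Cmp ?C (FA (PF D p) ?u) (FA (PF D p) ?e)))"
    unfolding \<alpha> up using Cmp_assoc[OF C pe Cmp_hom[OF C pu puh] \<Phi>\<alpha>] Cmp_assoc[OF C pe pu puh] by simp
  also have "Cmp ?C (FA (PF D p) ?u) (FA (PF D p) ?e) = FA (PF D p) (FA (\<Phi> A) g)"
    using FA_Cmp[OF D.P eh uh(1)] Cmp_inv_cancel'[OF D.A uh(2,1) FA_hom[OF u.P gh]] by simp
  also have "Cmp ?C (FA (\<Phi> K) (NC (PN V \<alpha>) Y)) (Cmp ?C ?pu (FA (PF D p) (FA (\<Phi> A) g))) = Cmp ?C (FA (\<Phi> K) ?\<xi>) ?p"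
    unfolding p_nat using Cmp_assoc[OF C ph(1) FA_hom[OF v.P pg] \<Phi>\<alpha>] FA_Cmp[OF v.P pg \<alpha>h] by simp
  finally have "Cmp ?C ?v (Cmp ?C (FA (PF D v) ?q) ?R) = Cmp ?C ?v (Cmp ?C (FA (PF D v) ?q) ?L)"
    using l by simp
  then have "Cmp ?C (FA (PF D v) ?q) ?R = Cmp ?C (FA (PF D v) ?q) ?L"
    using Cmp_inv_cancel[OF C vh(2,1) Cmp_hom[OF C Rh vq(1)]] Cmp_inv_cancel[OF C vh(2,1) Cmp_hom[OF C Lh vq(1)]]
    by metis
  then have "?R = ?L"
    using Cmp_inv_cancel[OF C vq(2,1) Rh] Cmp_inv_cancel[OF C vq(2,1) Lh] by metis
  then show ?thesis
    using D.lan_exact_atI[OF e] L by simp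
qed

end

text \<open>\<open>X\<close> is the unit object of V over the terminal category and \<open>k\<close>
  the component at \<open>Z\<close> of the left unit constraint of the module.\<close>

lemma is_module_unit_iso:
  assumes U: "universe U" and M: "monoidal_derivator U M" and N: "is_module U M N"
    and Z: "Z \<in> Ob (PD (VD N) one)"
  obtains X k where "X \<in> Ob (PD (MD M) one)"
    and "k \<in> hom (PD (VD N) one) (FO (PC (VAct N) one) (X, Z)) Z" and "is_iso (PD (VD N) one) k"
proof -
  let ?V = "MD M" and ?D = "VD N" and ?S = "MUnit M" and ?act = "VAct N"
  let ?F = "?act \<circ>\<^sub>P ppair (const_on ?D ?S) (pid ?D)"
  note one = one_Cat[OF U]
  have S: "pseudonatural U punit ?V ?S"
    using M by (simp add: monoidal_derivator_def Let_def)
  have act: "action U ?V ?D ?act"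
    using U M N by unfold_locales (simp_all add: monoidal_derivator_def is_module_def Let_def)
  have l: "inv_modification U ?D ?D ?F (pid ?D) (VLeft N)"
    using N by (simp add: is_module_def Let_def)
  interpret action U ?V ?D ?act by (rule act)
  have "PC ?S one \<in> Funs unit_cat (PD ?V one)"
    using S one by (simp add: pseudonatural_def punit_def)
  then have s: "FO (PC ?S one) () \<in> Ob (PD ?V one)"
    by (rule FO_Ob) (simp add: unit_cat_def mk_cat_simps)
  have t: "VLeft N one \<in> Ntrs (PC ?F one) (PC (pid ?D) one)" and i: "is_nat_iso (VLeft N one)"
    using l one by (simp_all add: inv_modification_def modification_def)
  have dom: "FDom (PC ?F one) = PD ?D one" "FCod (PC ?F one) = PD ?D one"
    using Funs_FCod[OF PC_Funs[OF one]]
    by (simp_all add: pcomp_def ppair_def fpair_def const_on_def pbang_def fcomp_def mk_ftor_def Let_def)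
  have obj: "FO (PC ?F one) Z = FO (PC ?act one) (FO (PC ?S one) (), Z)"
    using Z by (simp add: pcomp_def ppair_def fpair_def const_on_def pbang_def fcomp_def mk_ftor_def Let_def
      pid_def idf_def)
  have "NC (VLeft N one) Z \<in> hom (PD ?D one) (FO (PC ?F one) Z) (FO (PC (pid ?D) one) Z)"
    using t Z dom unfolding Ntrs_def by auto
  moreover have "is_iso (PD ?D one) (NC (VLeft N one) Z)"
    using i Z dom by (simp add: is_nat_iso_def NSrc[OF t])
  moreover have "FO (PC (pid ?D) one) Z = Z"
    by (simp add: pid_def FO_idf[OF Z])
  ultimately show thesis
    using that[OF s] unfolding obj by simp
qed

text \<open>The two alternatives in \<open>co\<close> meet in a single fact, left exactness of all
  squares for \<open>T\<close>; from there on they are treated alike.\<close>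

lemma module_exact:
  fixes U :: "'a code set set"
  assumes U: "universe U" and M: "monoidal_derivator U M" and N: "is_module U M N"
    and co: "cocontinuous2 U (MD M) (VD N) (VD N) (VAct N) \<or>
      two_variable_left_adjoint U (MD M) (VD N) (VD N) (VAct N)"
    and sq: "small_square U K A L B p v u q \<alpha>" and ex: "exact (MD M) p v u q \<alpha>"
  shows "exact (VD N) p v u q \<alpha>"
proof -
  let ?V = "MD M" and ?D = "VD N"
  interpret action U ?V ?D "VAct N"
    using U M N by unfold_locales (simp_all add: monoidal_derivator_def is_module_def Let_def)
  interpret s: small_square U K A L B p v u q \<alpha> by fact
  \<comment> \<open>The case in which \<open>A\<close> and \<open>M\<close> are replaced by the
    terminal category, where each object can be reached by tensoring.\<close>
  have "lan_exact_in ?D p' v' u' q' \<beta>"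
    if sq': "small_square U K' one one B p' v' u' q' \<beta>" and lan_exact: "lan_exact_in ?V p' v' u' q' \<beta>"
    for K' p' v' u' q' \<beta>
  proof -
    interpret l: lax_square "PD ?D one" "PD ?D B" "PD ?D K'" "PD ?D one" "PF ?D u'" "PF ?D p'" "PF ?D v'" "PF ?D q'"
        "NC (PN ?D \<beta>)"
      using D.lax_square[OF sq'] .
    show ?thesis
      unfolding lan_exact_def l.P.FDom
    proof
      fix Z assume Z: "Z \<in> Ob (PD ?D one)"
      interpret action_at U ?V ?D "VAct N" Z by unfold_locales (rule Z)
      obtain X k where X: "X \<in> Ob (PD ?V one)" and k: "k \<in> hom (PD ?D one) (FO (PC (VAct N) one) (X, Z)) Z"
        "is_iso (PD ?D one) k"
        using is_module_unit_iso[OF U M N Z] .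
      \<comment> \<open>Over the terminal category the constant diagram at \<open>Z\<close> is
        \<open>Z\<close> itself, so \<open>FO (\<Phi> one) X\<close> is the product of
        \<open>X\<close> and \<open>Z\<close>, isomorphic to \<open>Z\<close> by
        \<open>k\<close>.\<close>
      have "(bang one :: 'a sftor) = idf one"
        using Funs_one_unique[OF bang[OF one] idf_Funs[OF Cat_category[OF one]]] .
      then have "FO (\<Phi> one) X = FO (PC (VAct N) one) (X, Z)"
        by (simp add: FO_right_act X D.PF_idf[OF one] FO_idf[OF Z])
      moreover have "lan_exact_at (PF ?D p') (PF ?D v') (PF ?D q') (PF ?D u') (NC (PN ?D \<beta>)) (FO (\<Phi> one) X)"
        using lan_exact_at_\<Phi>[OF _ sq' lan_exact X] co T_lan_exact_cocontinuous T_lan_exact_enriched by blast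
      ultimately show "lan_exact_at (PF ?D p') (PF ?D v') (PF ?D q') (PF ?D u') (NC (PN ?D \<beta>)) Z"
        using l.lan_exact_at_iso k by simp
    qed
  qed
  \<comment> \<open>The point squares are built from the given square of small categories alone, so
    one and the same family tests exactness in V and in D.\<close>
  then show ?thesis
    using ex small_square.paste_left_square[OF s.paste_right_square]
    unfolding V.exact_iff_lan_exact_in[OF sq] D.exact_iff_lan_exact_in[OF sq] V.lan_exact_in_iff_points[OF sq] D.lan_exact_in_iff_points[OF sq]
    by blast
qed

theorem proposition13p15:
  fixes U :: "'a code set set"
    and V :: "('a, 'o, 'm) monoidal"
    and K A M B :: "'a scat"
    and p v u q :: "'a sftor"
    and \<alpha> :: "'a sntrans"
  assumes "universe U"
    and "monoidal_derivator U V"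
    and "K \<in> Cat U" and "A \<in> Cat U" and "M \<in> Cat U" and "B \<in> Cat U"
    and "p \<in> Funs K A" and "v \<in> Funs K M" and "u \<in> Funs A B" and "q \<in> Funs M B"
    and "\<alpha> \<in> Ntrs (u \<circ>\<^sub>F p) (q \<circ>\<^sub>F v)"
    and "exact (MD V) p v u q \<alpha>"
  shows "(\<forall>D :: ('a, 'o, 'm, 'p, 'n) vmodule.
            cocontinuous_module U V D \<longrightarrow> exact (VD D) p v u q \<alpha>) \<and>
         (\<forall>D :: ('a, 'o, 'm, 'p, 'n) vmodule.
            enriched_derivator U V D \<longrightarrow> exact (VD D) p v u q \<alpha>)"
proof -
  have sq: "small_square U K A M B p v u q \<alpha>"
    by (rule small_square.intro) (rule assms)+
  show ?thesis
    using module_exact[OF assms(1,2) _ _ sq assms(12)]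
    by (auto simp: cocontinuous_module_def enriched_derivator_def)
qed

end
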